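(* Let $(\mathcal{M},\otimes,\mathbf{1},\sigma)$ be an abelian symmetric monoidal category that satisfies the faithful coflatness condition. For every morphism $f:A\to B$ in $\mathsf{Hopf}_{\mathrm{coc}}(\mathcal{M})$, writing $\pi:=\mathsf{coker}(\mathsf{ker}(f)):A\to Q$ (kernel and cokernel taken in $\mathcal{M}$), the morphism $\pi$ is the coequalizer in $\mathcal{M}$ of the pair $(\varepsilon_A\otimes\mathrm{Id}_A)e_{A,A},\ (\mathrm{Id}_A\otimes\varepsilon_A)e_{A,A}:A\square_Q A\to A$. As a consequence, $\phi_A(\mathsf{hker}(f))=\mathsf{hcoker}(\mathsf{hker}(f))=\mathsf{coker}(\mathsf{ker}(f))$ (as quotients of $A$, i.e. up to isomorphism of codomains), and $f$ factorizes as a regular epimorphism (in fact, a cokernel) in $\mathsf{Hopf}_{\mathrm{coc}}(\mathcal{M})$ followed by a monomorphism in $\mathsf{Hopf}_{\mathrm{coc}}(\mathcal{M})$.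
   Context: Associativity and unit constraints are suppressed. An abelian symmetric monoidal category is a symmetric monoidal category $(\mathcal{M},\otimes,\mathbf{1},\sigma)$ such that $\mathcal{M}$ is abelian and, for every object $M$, the functors $M\otimes(-)$ and $(-)\otimes M$ are additive and exact. $\mathsf{Hopf}_{\mathrm{coc}}(\mathcal{M})$ is the category of Hopf monoids $(A,m_A,u_A,\Delta_A,\varepsilon_A,S_A)$ in $\mathcal{M}$ with $\sigma_{A,A}\Delta_A=\Delta_A$ and Hopf monoid morphisms; it is pointed with zero object $\mathbf{1}$ (zero morphism $A\to B$: $u_B\varepsilon_A$). $\mathsf{hker}$ and $\mathsf{hcoker}$ denote kernels and cokernels in $\mathsf{Hopf}_{\mathrm{coc}}(\mathcal{M})$; $\mathsf{ker}$ and $\mathsf{coker}$ those in $\mathcal{M}$. For a Hopf monoid morphism $f$, the codomain $Q$ of $\mathsf{coker}(\mathsf{ker}(f))$ carries a unique cocommutative Hopf monoid structure for which $\mathsf{coker}(\mathsf{ker}(f))$ is a Hopf monoid morphism. For a monomorphism $i:K\to A$ in $\mathsf{Hopf}_{\mathrm{coc}}(\mathcal{M})$, $\phi_A(i)$ denotes the coequalizer in $\mathcal{M}$ of $m_A(\mathrm{Id}_A\otimes i),\ \mathrm{Id}_A\otimes\varepsilon_K:A\otimes K\to A$. For a comonoid morphism $\pi:A\to Q$, $e_{A,A}:A\square_Q A\to A\otimes A$ is the equalizer in $\mathcal{M}$ of $(\mathrm{Id}_A\otimes\pi)\Delta_A\otimes\mathrm{Id}_A$ and $\mathrm{Id}_A\otimes(\pi\otimes\mathrm{Id}_A)\Delta_A$,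 $A\otimes A\to A\otimes Q\otimes A$. In general, for a right $Q$-comodule $(V,\rho_V)$ and a left $Q$-comodule $(W,\lambda_W)$, $V\square_Q W$ is the equalizer in $\mathcal{M}$ of $\rho_V\otimes\mathrm{Id}_W,\ \mathrm{Id}_V\otimes\lambda_W: V\otimes W\to V\otimes Q\otimes W$; this gives functors $(-)\square_Q W:\mathcal{M}^Q\to\mathcal{M}$ from right $Q$-comodules. $\mathsf{Comon}_{\mathrm{coc}}({}_A\mathcal{M})$: objects are cocommutative comonoids $Q$ in $\mathcal{M}$ with a left $A$-action $\mu_Q$ such that $\Delta_Q,\varepsilon_Q$ are left $A$-linear, where $Q\otimes Q$ has action $(\mu_Q\otimes\mu_Q)(\mathrm{Id}_A\otimes\sigma_{A,Q}\otimes\mathrm{Id}_Q)(\Delta_A\otimes\mathrm{Id}_{Q\otimes Q})$ and $\mathbf{1}$ has action $\varepsilon_A$; morphisms are left $A$-linear comonoid morphisms; $A$ is an object of it via $m_A$. Faithful coflatness condition: for any $A$ in $\mathsf{Hopf}_{\mathrm{coc}}(\mathcal{M})$ and any morphism $\pi:A\to Q$ in $\mathsf{Comon}_{\mathrm{coc}}({}_A\mathcal{M})$ which is an epimorphism in $\mathcal{M}$, the functor $(-)\square_Q A$ preserves and reflects epimorphisms, where $A$ is a left $Q$-comodule via $(\pi\otimes\mathrm{Id}_A)\Delta_A$. *)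

theory Defs
  imports "HOL-Algebra.Group"
begin

section \<open>Categories\<close>

text \<open>Only the elements of \<open>Arr C\<close> are arrows; all operations are unspecified outside.
  \<open>Cmp C g f\<close> is "g after f".\<close>

record ('o, 'm) cat =
  Ob :: "'o set"
  Arr :: "'m set"
  Dom :: "'m \<Rightarrow> 'o"
  Cod :: "'m \<Rightarrow> 'o"
  Idn :: "'o \<Rightarrow> 'm"
  Cmp :: "'m \<Rightarrow> 'm \<Rightarrow> 'm"  (infixr \<open>\<cdot>\<index>\<close> 65)

definition Hom :: "('o, 'm, 'z) cat_scheme \<Rightarrow> 'o \<Rightarrow> 'o \<Rightarrow> 'm set" where
  "Hom C X Y = {f \<in> Arr C. Dom C f = X \<and> Cod C f = Y}"

locale category =
  fixes C :: "('o, 'm, 'z) cat_scheme" (structure)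
  assumes arr_dom: "f \<in> Arr C \<Longrightarrow> Dom C f \<in> Ob C"
    and arr_cod: "f \<in> Arr C \<Longrightarrow> Cod C f \<in> Ob C"
    and id_hom: "X \<in> Ob C \<Longrightarrow> Idn C X \<in> Hom C X X"
    and cmp_hom: "f \<in> Hom C X Y \<Longrightarrow> g \<in> Hom C Y Z \<Longrightarrow> g \<cdot> f \<in> Hom C X Z"
    and cmp_id_left: "f \<in> Hom C X Y \<Longrightarrow> Idn C Y \<cdot> f = f"
    and cmp_id_right: "f \<in> Hom C X Y \<Longrightarrow> f \<cdot> Idn C X = f"
    and cmp_assoc: "f \<in> Hom C W X \<Longrightarrow> g \<in> Hom C X Y \<Longrightarrow> h \<in> Hom C Y Z \<Longrightarrow>
      (h \<cdot> g) \<cdot> f = h \<cdot> (g \<cdot> f)"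

definition is_mono :: "('o, 'm, 'z) cat_scheme \<Rightarrow> 'm \<Rightarrow> bool" where
  "is_mono C f \<longleftrightarrow> f \<in> Arr C \<and>
    (\<forall>X. \<forall>g \<in> Hom C X (Dom C f). \<forall>h \<in> Hom C X (Dom C f).
      f \<cdot>\<^bsub>C\<^esub> g = f \<cdot>\<^bsub>C\<^esub> h \<longrightarrow> g = h)"

definition is_epi :: "('o, 'm, 'z) cat_scheme \<Rightarrow> 'm \<Rightarrow> bool" where
  "is_epi C f \<longleftrightarrow> f \<in> Arr C \<and>
    (\<forall>Y. \<forall>g \<in> Hom C (Cod C f) Y. \<forall>h \<in> Hom C (Cod C f) Y.
      g \<cdot>\<^bsub>C\<^esub> f = h \<cdot>\<^bsub>C\<^esub> f \<longrightarrow> g = h)"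

definition are_inverse :: "('o, 'm, 'z) cat_scheme \<Rightarrow> 'm \<Rightarrow> 'm \<Rightarrow> bool" where
  "are_inverse C f g \<longleftrightarrow> f \<in> Arr C \<and> g \<in> Hom C (Cod C f) (Dom C f) \<and>
    g \<cdot>\<^bsub>C\<^esub> f = Idn C (Dom C f) \<and> f \<cdot>\<^bsub>C\<^esub> g = Idn C (Cod C f)"

definition is_iso :: "('o, 'm, 'z) cat_scheme \<Rightarrow> 'm \<Rightarrow> bool" where
  "is_iso C f \<longleftrightarrow> (\<exists>g. are_inverse C f g)"

definition inv_arr :: "('o, 'm, 'z) cat_scheme \<Rightarrow> 'm \<Rightarrow> 'm" where
  "inv_arr C f = (THE g. are_inverse C f g)"

definition is_equalizer :: "('o, 'm, 'z) cat_scheme \<Rightarrow> 'm \<Rightarrow> 'm \<Rightarrow> 'm \<Rightarrow> bool" where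
  "is_equalizer C e f g \<longleftrightarrow> f \<in> Arr C \<and> g \<in> Hom C (Dom C f) (Cod C f) \<and>
    e \<in> Hom C (Dom C e) (Dom C f) \<and> f \<cdot>\<^bsub>C\<^esub> e = g \<cdot>\<^bsub>C\<^esub> e \<and>
    (\<forall>X. \<forall>x \<in> Hom C X (Dom C f). f \<cdot>\<^bsub>C\<^esub> x = g \<cdot>\<^bsub>C\<^esub> x \<longrightarrow>
      (\<exists>!y. y \<in> Hom C X (Dom C e) \<and> e \<cdot>\<^bsub>C\<^esub> y = x))"

definition is_coequalizer :: "('o, 'm, 'z) cat_scheme \<Rightarrow> 'm \<Rightarrow> 'm \<Rightarrow> 'm \<Rightarrow> bool" where
  "is_coequalizer C q f g \<longleftrightarrow> f \<in> Arr C \<and> g \<in> Hom C (Dom C f) (Cod C f) \<and>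
    q \<in> Hom C (Cod C f) (Cod C q) \<and> q \<cdot>\<^bsub>C\<^esub> f = q \<cdot>\<^bsub>C\<^esub> g \<and>
    (\<forall>Y. \<forall>x \<in> Hom C (Cod C f) Y. x \<cdot>\<^bsub>C\<^esub> f = x \<cdot>\<^bsub>C\<^esub> g \<longrightarrow>
      (\<exists>!y. y \<in> Hom C (Cod C q) Y \<and> y \<cdot>\<^bsub>C\<^esub> q = x))"

definition is_regular_epi :: "('o, 'm, 'z) cat_scheme \<Rightarrow> 'm \<Rightarrow> bool" where
  "is_regular_epi C q \<longleftrightarrow> (\<exists>f g. is_coequalizer C q f g)"

definition is_zero_ob :: "('o, 'm, 'z) cat_scheme \<Rightarrow> 'o \<Rightarrow> bool" where
  "is_zero_ob C z \<longleftrightarrow> z \<in> Ob C \<and>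
    (\<forall>X \<in> Ob C. (\<exists>!f. f \<in> Hom C X z) \<and> (\<exists>!f. f \<in> Hom C z X))"

definition is_zero_arr :: "('o, 'm, 'z) cat_scheme \<Rightarrow> 'm \<Rightarrow> bool" where
  "is_zero_arr C f \<longleftrightarrow> f \<in> Arr C \<and>
    (\<exists>z. is_zero_ob C z \<and> (\<exists>g \<in> Hom C (Dom C f) z. \<exists>h \<in> Hom C z (Cod C f). f = h \<cdot>\<^bsub>C\<^esub> g))"

definition is_kernel :: "('o, 'm, 'z) cat_scheme \<Rightarrow> 'm \<Rightarrow> 'm \<Rightarrow> bool" where
  "is_kernel C k f \<longleftrightarrow> f \<in> Arr C \<and> k \<in> Hom C (Dom C k) (Dom C f) \<and>
    is_zero_arr C (f \<cdot>\<^bsub>C\<^esub> k) \<and>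
    (\<forall>X. \<forall>x \<in> Hom C X (Dom C f). is_zero_arr C (f \<cdot>\<^bsub>C\<^esub> x) \<longrightarrow>
      (\<exists>!y. y \<in> Hom C X (Dom C k) \<and> k \<cdot>\<^bsub>C\<^esub> y = x))"

definition is_cokernel :: "('o, 'm, 'z) cat_scheme \<Rightarrow> 'm \<Rightarrow> 'm \<Rightarrow> bool" where
  "is_cokernel C q f \<longleftrightarrow> f \<in> Arr C \<and> q \<in> Hom C (Cod C f) (Cod C q) \<and>
    is_zero_arr C (q \<cdot>\<^bsub>C\<^esub> f) \<and>
    (\<forall>Y. \<forall>x \<in> Hom C (Cod C f) Y. is_zero_arr C (x \<cdot>\<^bsub>C\<^esub> f) \<longrightarrow>
      (\<exists>!y. y \<in> Hom C (Cod C q) Y \<and> y \<cdot>\<^bsub>C\<^esub> q = x))"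

definition same_quotient :: "('o, 'm, 'z) cat_scheme \<Rightarrow> 'm \<Rightarrow> 'm \<Rightarrow> bool" where
  "same_quotient C p q \<longleftrightarrow> p \<in> Arr C \<and> q \<in> Arr C \<and> Dom C p = Dom C q \<and>
    (\<exists>t \<in> Hom C (Cod C p) (Cod C q). is_iso C t \<and> t \<cdot>\<^bsub>C\<^esub> p = q)"

text \<open>A functor is represented by its action on arrows, the action on objects being
  recovered from the identities.\<close>

definition preserves_epis ::
  "('o, 'm, 'z) cat_scheme \<Rightarrow> ('p, 'n, 'y) cat_scheme \<Rightarrow> ('m \<Rightarrow> 'n) \<Rightarrow> bool" where
  "preserves_epis C D F \<longleftrightarrow> (\<forall>g \<in> Arr C. is_epi C g \<longrightarrow> is_epi D (F g))"

definition reflects_epis ::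
  "('o, 'm, 'z) cat_scheme \<Rightarrow> ('p, 'n, 'y) cat_scheme \<Rightarrow> ('m \<Rightarrow> 'n) \<Rightarrow> bool" where
  "reflects_epis C D F \<longleftrightarrow> (\<forall>g \<in> Arr C. is_epi D (F g) \<longrightarrow> is_epi C g)"

text \<open>The category of objects of \<open>C\<close> equipped with extra structure: \<open>U\<close> is the
  underlying object, \<open>H X Y h\<close> says that \<open>h\<close> respects the structures of \<open>X\<close> and \<open>Y\<close>.\<close>

definition structured_cat ::
  "('o, 'm, 'z) cat_scheme \<Rightarrow> 's set \<Rightarrow> ('s \<Rightarrow> 'o) \<Rightarrow> ('s \<Rightarrow> 's \<Rightarrow> 'm \<Rightarrow> bool)
    \<Rightarrow> ('s, 's \<times> 'm \<times> 's) cat" where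
  "structured_cat C S U H =
    \<lparr>Ob = S,
     Arr = {(X, h, Y). X \<in> S \<and> Y \<in> S \<and> h \<in> Hom C (U X) (U Y) \<and> H X Y h},
     Dom = (\<lambda>(X, h, Y). X),
     Cod = (\<lambda>(X, h, Y). Y),
     Idn = (\<lambda>X. (X, Idn C (U X), X)),
     Cmp = (\<lambda>(X', g, Y') (X, f, Y). (X, g \<cdot>\<^bsub>C\<^esub> f, Y'))\<rparr>"

definition und :: "'s \<times> 'm \<times> 's \<Rightarrow> 'm" where
  "und f = fst (snd f)"


section \<open>Abelian categories\<close>

record ('o, 'm) pacat = "('o, 'm) cat" +
  Add :: "'m \<Rightarrow> 'm \<Rightarrow> 'm"
  Zer :: "'o \<Rightarrow> 'o \<Rightarrow> 'm"

definition hom_group :: "('o, 'm, 'z) pacat_scheme \<Rightarrow> 'o \<Rightarrow> 'o \<Rightarrow> 'm monoid" where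
  "hom_group C X Y = \<lparr>carrier = Hom C X Y, monoid.mult = Add C, one = Zer C X Y\<rparr>"

definition is_biproduct ::
  "('o, 'm, 'z) pacat_scheme \<Rightarrow> 'o \<Rightarrow> 'o \<Rightarrow> 'o \<Rightarrow> 'm \<Rightarrow> 'm \<Rightarrow> 'm \<Rightarrow> 'm \<Rightarrow> bool" where
  "is_biproduct C X Y P i1 i2 p1 p2 \<longleftrightarrow>
    i1 \<in> Hom C X P \<and> i2 \<in> Hom C Y P \<and> p1 \<in> Hom C P X \<and> p2 \<in> Hom C P Y \<and>
    p1 \<cdot>\<^bsub>C\<^esub> i1 = Idn C X \<and> p2 \<cdot>\<^bsub>C\<^esub> i2 = Idn C Y \<and>
    Add C (i1 \<cdot>\<^bsub>C\<^esub> p1) (i2 \<cdot>\<^bsub>C\<^esub> p2) = Idn C P"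

locale abelian_category = category C
  for C :: "('o, 'm, 'z) pacat_scheme" (structure) +
  assumes hom_comm_group: "X \<in> Ob C \<Longrightarrow> Y \<in> Ob C \<Longrightarrow> comm_group (hom_group C X Y)"
    and cmp_add_left: "f \<in> Hom C X Y \<Longrightarrow> g \<in> Hom C Y Z \<Longrightarrow> h \<in> Hom C Y Z \<Longrightarrow>
      Add C g h \<cdot> f = Add C (g \<cdot> f) (h \<cdot> f)"
    and cmp_add_right: "f \<in> Hom C X Y \<Longrightarrow> g \<in> Hom C X Y \<Longrightarrow> h \<in> Hom C Y Z \<Longrightarrow>
      h \<cdot> Add C f g = Add C (h \<cdot> f) (h \<cdot> g)"
    and ex_zero_ob: "\<exists>z. is_zero_ob C z"
    and ex_biproduct: "X \<in> Ob C \<Longrightarrow> Y \<in> Ob C \<Longrightarrow>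
      \<exists>P i1 i2 p1 p2. is_biproduct C X Y P i1 i2 p1 p2"
    and ex_kernel: "f \<in> Arr C \<Longrightarrow> \<exists>k. is_kernel C k f"
    and ex_cokernel: "f \<in> Arr C \<Longrightarrow> \<exists>q. is_cokernel C q f"
    and mono_normal: "is_mono C f \<Longrightarrow> \<exists>g. is_kernel C f g"
    and epi_normal: "is_epi C f \<Longrightarrow> \<exists>g. is_cokernel C f g"

definition is_short_exact :: "('o, 'm, 'z) cat_scheme \<Rightarrow> 'm \<Rightarrow> 'm \<Rightarrow> bool" where
  "is_short_exact C i p \<longleftrightarrow> is_kernel C i p \<and> is_cokernel C p i"

definition additive_on :: "('o, 'm, 'z) pacat_scheme \<Rightarrow> ('m \<Rightarrow> 'm) \<Rightarrow> bool" where
  "additive_on C F \<longleftrightarrow>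
    (\<forall>X Y. \<forall>f \<in> Hom C X Y. \<forall>g \<in> Hom C X Y. F (Add C f g) = Add C (F f) (F g))"

definition exact_on :: "('o, 'm, 'z) pacat_scheme \<Rightarrow> ('m \<Rightarrow> 'm) \<Rightarrow> bool" where
  "exact_on C F \<longleftrightarrow> (\<forall>i p. is_short_exact C i p \<longrightarrow> is_short_exact C (F i) (F p))"


section \<open>Abelian symmetric monoidal categories\<close>

text \<open>Strictness is not assumed: the associativity constraint
  \<open>Asc M X Y Z : (X \<otimes> Y) \<otimes> Z \<rightarrow> X \<otimes> (Y \<otimes> Z)\<close> and the unit constraints
  \<open>LUn M X : 1 \<otimes> X \<rightarrow> X\<close>, \<open>RUn M X : X \<otimes> 1 \<rightarrow> X\<close> are explicit.
  The tensor product is \<open>\<boxtimes>\<close> on objects and \<open>\<odot>\<close> on arrows.\<close>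

record ('o, 'm) smc = "('o, 'm) pacat" +
  TenO :: "'o \<Rightarrow> 'o \<Rightarrow> 'o"  (infixr \<open>\<boxtimes>\<index>\<close> 75)
  TenA :: "'m \<Rightarrow> 'm \<Rightarrow> 'm"  (infixr \<open>\<odot>\<index>\<close> 75)
  Unt :: "'o"
  Asc :: "'o \<Rightarrow> 'o \<Rightarrow> 'o \<Rightarrow> 'm"
  LUn :: "'o \<Rightarrow> 'm"
  RUn :: "'o \<Rightarrow> 'm"
  Sym :: "'o \<Rightarrow> 'o \<Rightarrow> 'm"

locale abelian_smc = abelian_category M
  for M :: "('o, 'm, 'z) smc_scheme" (structure) +
  assumes unt_ob: "Unt M \<in> Ob M"
    and ten_ob: "X \<in> Ob M \<Longrightarrow> Y \<in> Ob M \<Longrightarrow> X \<boxtimes> Y \<in> Ob M"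
    and ten_hom: "f \<in> Hom M X X' \<Longrightarrow> g \<in> Hom M Y Y' \<Longrightarrow> f \<odot> g \<in> Hom M (X \<boxtimes> Y) (X' \<boxtimes> Y')"
    and ten_id: "X \<in> Ob M \<Longrightarrow> Y \<in> Ob M \<Longrightarrow> Idn M X \<odot> Idn M Y = Idn M (X \<boxtimes> Y)"
    and ten_cmp: "f \<in> Hom M X X' \<Longrightarrow> f' \<in> Hom M X' X'' \<Longrightarrow> g \<in> Hom M Y Y' \<Longrightarrow> g' \<in> Hom M Y' Y'' \<Longrightarrow>
      (f' \<cdot> f) \<odot> (g' \<cdot> g) = (f' \<odot> g') \<cdot> (f \<odot> g)"
    and asc_hom: "X \<in> Ob M \<Longrightarrow> Y \<in> Ob M \<Longrightarrow> Z \<in> Ob M \<Longrightarrow>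
      Asc M X Y Z \<in> Hom M ((X \<boxtimes> Y) \<boxtimes> Z) (X \<boxtimes> (Y \<boxtimes> Z))"
    and asc_iso: "X \<in> Ob M \<Longrightarrow> Y \<in> Ob M \<Longrightarrow> Z \<in> Ob M \<Longrightarrow> is_iso M (Asc M X Y Z)"
    and asc_nat: "f \<in> Hom M X X' \<Longrightarrow> g \<in> Hom M Y Y' \<Longrightarrow> h \<in> Hom M Z Z' \<Longrightarrow>
      Asc M X' Y' Z' \<cdot> ((f \<odot> g) \<odot> h) = (f \<odot> (g \<odot> h)) \<cdot> Asc M X Y Z"
    and lun_hom: "X \<in> Ob M \<Longrightarrow> LUn M X \<in> Hom M (Unt M \<boxtimes> X) X"
    and lun_iso: "X \<in> Ob M \<Longrightarrow> is_iso M (LUn M X)"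
    and lun_nat: "f \<in> Hom M X X' \<Longrightarrow> LUn M X' \<cdot> (Idn M (Unt M) \<odot> f) = f \<cdot> LUn M X"
    and run_hom: "X \<in> Ob M \<Longrightarrow> RUn M X \<in> Hom M (X \<boxtimes> Unt M) X"
    and run_iso: "X \<in> Ob M \<Longrightarrow> is_iso M (RUn M X)"
    and run_nat: "f \<in> Hom M X X' \<Longrightarrow> RUn M X' \<cdot> (f \<odot> Idn M (Unt M)) = f \<cdot> RUn M X"
    and pentagon: "W \<in> Ob M \<Longrightarrow> X \<in> Ob M \<Longrightarrow> Y \<in> Ob M \<Longrightarrow> Z \<in> Ob M \<Longrightarrow>
      Asc M W X (Y \<boxtimes> Z) \<cdot> Asc M (W \<boxtimes> X) Y Z =
      (Idn M W \<odot> Asc M X Y Z) \<cdot> Asc M W (X \<boxtimes> Y) Z \<cdot> (Asc M W X Y \<odot> Idn M Z)"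
    and triangle: "X \<in> Ob M \<Longrightarrow> Y \<in> Ob M \<Longrightarrow>
      (Idn M X \<odot> LUn M Y) \<cdot> Asc M X (Unt M) Y = RUn M X \<odot> Idn M Y"
    and sym_hom: "X \<in> Ob M \<Longrightarrow> Y \<in> Ob M \<Longrightarrow> Sym M X Y \<in> Hom M (X \<boxtimes> Y) (Y \<boxtimes> X)"
    and sym_nat: "f \<in> Hom M X X' \<Longrightarrow> g \<in> Hom M Y Y' \<Longrightarrow>
      Sym M X' Y' \<cdot> (f \<odot> g) = (g \<odot> f) \<cdot> Sym M X Y"
    and sym_sym: "X \<in> Ob M \<Longrightarrow> Y \<in> Ob M \<Longrightarrow> Sym M Y X \<cdot> Sym M X Y = Idn M (X \<boxtimes> Y)"
    and hexagon: "X \<in> Ob M \<Longrightarrow> Y \<in> Ob M \<Longrightarrow> Z \<in> Ob M \<Longrightarrow>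
      Asc M Y Z X \<cdot> Sym M X (Y \<boxtimes> Z) \<cdot> Asc M X Y Z =
      (Idn M Y \<odot> Sym M X Z) \<cdot> Asc M Y X Z \<cdot> (Sym M X Y \<odot> Idn M Z)"
    and ten_left_additive: "X \<in> Ob M \<Longrightarrow> additive_on M (\<lambda>f. Idn M X \<odot> f)"
    and ten_right_additive: "X \<in> Ob M \<Longrightarrow> additive_on M (\<lambda>f. f \<odot> Idn M X)"
    and ten_left_exact: "X \<in> Ob M \<Longrightarrow> exact_on M (\<lambda>f. Idn M X \<odot> f)"
    and ten_right_exact: "X \<in> Ob M \<Longrightarrow> exact_on M (\<lambda>f. f \<odot> Idn M X)"

text \<open>The middle-four interchange \<open>(W \<otimes> X) \<otimes> (Y \<otimes> Z) \<rightarrow> (W \<otimes> Y) \<otimes> (X \<otimes> Z)\<close>, i.e.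
  \<open>Id \<otimes> \<sigma> \<otimes> Id\<close> with the associativity constraints written out.\<close>

definition mid_swap :: "('o, 'm, 'z) smc_scheme \<Rightarrow> 'o \<Rightarrow> 'o \<Rightarrow> 'o \<Rightarrow> 'o \<Rightarrow> 'm" where
  "mid_swap M W X Y Z =
    inv_arr M (Asc M W Y (X \<boxtimes>\<^bsub>M\<^esub> Z)) \<cdot>\<^bsub>M\<^esub>
    (Idn M W \<odot>\<^bsub>M\<^esub>
      (Asc M Y X Z \<cdot>\<^bsub>M\<^esub> (Sym M X Y \<odot>\<^bsub>M\<^esub> Idn M Z) \<cdot>\<^bsub>M\<^esub> inv_arr M (Asc M X Y Z))) \<cdot>\<^bsub>M\<^esub>
    Asc M W X (Y \<boxtimes>\<^bsub>M\<^esub> Z)"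


section \<open>Comonoids, Hopf monoids and their modules and comodules\<close>

record ('o, 'm) comon =
  cob :: "'o"
  comul :: "'m"
  counit :: "'m"

definition comonoid :: "('o, 'm, 'z) smc_scheme \<Rightarrow> ('o, 'm, 'y) comon_scheme \<Rightarrow> bool" where
  "comonoid M Q \<longleftrightarrow>
    cob Q \<in> Ob M \<and>
    comul Q \<in> Hom M (cob Q) (cob Q \<boxtimes>\<^bsub>M\<^esub> cob Q) \<and>
    counit Q \<in> Hom M (cob Q) (Unt M) \<and>
    Asc M (cob Q) (cob Q) (cob Q) \<cdot>\<^bsub>M\<^esub> (comul Q \<odot>\<^bsub>M\<^esub> Idn M (cob Q)) \<cdot>\<^bsub>M\<^esub> comul Q =
      (Idn M (cob Q) \<odot>\<^bsub>M\<^esub> comul Q) \<cdot>\<^bsub>M\<^esub> comul Q \<and>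
    LUn M (cob Q) \<cdot>\<^bsub>M\<^esub> (counit Q \<odot>\<^bsub>M\<^esub> Idn M (cob Q)) \<cdot>\<^bsub>M\<^esub> comul Q = Idn M (cob Q) \<and>
    RUn M (cob Q) \<cdot>\<^bsub>M\<^esub> (Idn M (cob Q) \<odot>\<^bsub>M\<^esub> counit Q) \<cdot>\<^bsub>M\<^esub> comul Q = Idn M (cob Q)"

definition cocommutative :: "('o, 'm, 'z) smc_scheme \<Rightarrow> ('o, 'm, 'y) comon_scheme \<Rightarrow> bool" where
  "cocommutative M Q \<longleftrightarrow> Sym M (cob Q) (cob Q) \<cdot>\<^bsub>M\<^esub> comul Q = comul Q"

definition comonoid_hom ::
  "('o, 'm, 'z) smc_scheme \<Rightarrow> ('o, 'm, 'x) comon_scheme \<Rightarrow> ('o, 'm, 'y) comon_scheme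
    \<Rightarrow> 'm \<Rightarrow> bool" where
  "comonoid_hom M P Q f \<longleftrightarrow>
    f \<in> Hom M (cob P) (cob Q) \<and>
    comul Q \<cdot>\<^bsub>M\<^esub> f = (f \<odot>\<^bsub>M\<^esub> f) \<cdot>\<^bsub>M\<^esub> comul P \<and>
    counit Q \<cdot>\<^bsub>M\<^esub> f = counit P"

record ('o, 'm) hopf = "('o, 'm) comon" +
  mul :: "'m"
  unit :: "'m"
  antipode :: "'m"

text \<open>The last six conditions say that comultiplication and counit are multiplicative
  and unital, and that the antipode is the convolution inverse of the identity.\<close>

definition hopf_monoid :: "('o, 'm, 'z) smc_scheme \<Rightarrow> ('o, 'm) hopf \<Rightarrow> bool" where
  "hopf_monoid M A \<longleftrightarrow>
    comonoid M A \<and>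
    mul A \<in> Hom M (cob A \<boxtimes>\<^bsub>M\<^esub> cob A) (cob A) \<and>
    unit A \<in> Hom M (Unt M) (cob A) \<and>
    antipode A \<in> Hom M (cob A) (cob A) \<and>
    mul A \<cdot>\<^bsub>M\<^esub> (mul A \<odot>\<^bsub>M\<^esub> Idn M (cob A)) =
      mul A \<cdot>\<^bsub>M\<^esub> (Idn M (cob A) \<odot>\<^bsub>M\<^esub> mul A) \<cdot>\<^bsub>M\<^esub> Asc M (cob A) (cob A) (cob A) \<and>
    mul A \<cdot>\<^bsub>M\<^esub> (unit A \<odot>\<^bsub>M\<^esub> Idn M (cob A)) = LUn M (cob A) \<and>
    mul A \<cdot>\<^bsub>M\<^esub> (Idn M (cob A) \<odot>\<^bsub>M\<^esub> unit A) = RUn M (cob A) \<and>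
    comul A \<cdot>\<^bsub>M\<^esub> mul A =
      (mul A \<odot>\<^bsub>M\<^esub> mul A) \<cdot>\<^bsub>M\<^esub> mid_swap M (cob A) (cob A) (cob A) (cob A) \<cdot>\<^bsub>M\<^esub>
      (comul A \<odot>\<^bsub>M\<^esub> comul A) \<and>
    comul A \<cdot>\<^bsub>M\<^esub> unit A = (unit A \<odot>\<^bsub>M\<^esub> unit A) \<cdot>\<^bsub>M\<^esub> inv_arr M (LUn M (Unt M)) \<and>
    counit A \<cdot>\<^bsub>M\<^esub> mul A = LUn M (Unt M) \<cdot>\<^bsub>M\<^esub> (counit A \<odot>\<^bsub>M\<^esub> counit A) \<and>
    counit A \<cdot>\<^bsub>M\<^esub> unit A = Idn M (Unt M) \<and>
    mul A \<cdot>\<^bsub>M\<^esub> (antipode A \<odot>\<^bsub>M\<^esub> Idn M (cob A)) \<cdot>\<^bsub>M\<^esub> comul A = unit A \<cdot>\<^bsub>M\<^esub> counit A \<and>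
    mul A \<cdot>\<^bsub>M\<^esub> (Idn M (cob A) \<odot>\<^bsub>M\<^esub> antipode A) \<cdot>\<^bsub>M\<^esub> comul A = unit A \<cdot>\<^bsub>M\<^esub> counit A"

text \<open>Compatibility with the antipodes is automatic for monoid and comonoid morphisms.\<close>

definition hopf_hom :: "('o, 'm, 'z) smc_scheme \<Rightarrow> ('o, 'm) hopf \<Rightarrow> ('o, 'm) hopf \<Rightarrow> 'm \<Rightarrow> bool" where
  "hopf_hom M A B f \<longleftrightarrow>
    comonoid_hom M A B f \<and>
    f \<cdot>\<^bsub>M\<^esub> mul A = mul B \<cdot>\<^bsub>M\<^esub> (f \<odot>\<^bsub>M\<^esub> f) \<and>
    f \<cdot>\<^bsub>M\<^esub> unit A = unit B"

definition HopfCoc ::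
  "('o, 'm, 'z) smc_scheme \<Rightarrow> (('o, 'm) hopf, ('o, 'm) hopf \<times> 'm \<times> ('o, 'm) hopf) cat" where
  "HopfCoc M = structured_cat M {A. hopf_monoid M A \<and> cocommutative M A} cob (hopf_hom M)"

text \<open>The category of right \<open>Q\<close>-comodules. The record \<open>comod\<close> serves for left and
  right comodules alike.\<close>

record ('o, 'm) comod =
  cmob :: "'o"
  coact :: "'m"

definition right_comodule ::
  "('o, 'm, 'z) smc_scheme \<Rightarrow> ('o, 'm, 'y) comon_scheme \<Rightarrow> ('o, 'm) comod \<Rightarrow> bool" where
  "right_comodule M Q V \<longleftrightarrow>
    cmob V \<in> Ob M \<and>
    coact V \<in> Hom M (cmob V) (cmob V \<boxtimes>\<^bsub>M\<^esub> cob Q) \<and>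
    Asc M (cmob V) (cob Q) (cob Q) \<cdot>\<^bsub>M\<^esub> (coact V \<odot>\<^bsub>M\<^esub> Idn M (cob Q)) \<cdot>\<^bsub>M\<^esub> coact V =
      (Idn M (cmob V) \<odot>\<^bsub>M\<^esub> comul Q) \<cdot>\<^bsub>M\<^esub> coact V \<and>
    RUn M (cmob V) \<cdot>\<^bsub>M\<^esub> (Idn M (cmob V) \<odot>\<^bsub>M\<^esub> counit Q) \<cdot>\<^bsub>M\<^esub> coact V = Idn M (cmob V)"

definition right_comodule_hom ::
  "('o, 'm, 'z) smc_scheme \<Rightarrow> ('o, 'm, 'y) comon_scheme \<Rightarrow> ('o, 'm) comod \<Rightarrow> ('o, 'm) comod
    \<Rightarrow> 'm \<Rightarrow> bool" where
  "right_comodule_hom M Q V W g \<longleftrightarrow>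
    g \<in> Hom M (cmob V) (cmob W) \<and>
    coact W \<cdot>\<^bsub>M\<^esub> g = (g \<odot>\<^bsub>M\<^esub> Idn M (cob Q)) \<cdot>\<^bsub>M\<^esub> coact V"

definition RComod ::
  "('o, 'm, 'z) smc_scheme \<Rightarrow> ('o, 'm, 'y) comon_scheme
    \<Rightarrow> (('o, 'm) comod, ('o, 'm) comod \<times> 'm \<times> ('o, 'm) comod) cat" where
  "RComod M Q = structured_cat M {V. right_comodule M Q V} cmob (right_comodule_hom M Q)"

text \<open>\<open>e : V \<box>\<^sub>Q W \<rightarrow> V \<otimes> W\<close> is the cotensor product of a right comodule \<open>V\<close> and a left
  comodule \<open>W\<close> over a comonoid with underlying object \<open>q\<close>.\<close>

definition is_cotensor ::
  "('o, 'm, 'z) smc_scheme \<Rightarrow> 'o \<Rightarrow> ('o, 'm) comod \<Rightarrow> ('o, 'm) comod \<Rightarrow> 'm \<Rightarrow> bool" where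
  "is_cotensor M q V W e \<longleftrightarrow>
    is_equalizer M e
      (Asc M (cmob V) q (cmob W) \<cdot>\<^bsub>M\<^esub> (coact V \<odot>\<^bsub>M\<^esub> Idn M (cmob W)))
      (Idn M (cmob V) \<odot>\<^bsub>M\<^esub> coact W)"

definition cotensor :: "('o, 'm, 'z) smc_scheme \<Rightarrow> 'o \<Rightarrow> ('o, 'm) comod \<Rightarrow> ('o, 'm) comod \<Rightarrow> 'm" where
  "cotensor M q V W = (SOME e. is_cotensor M q V W e)"

text \<open>The functor \<open>(-) \<box>\<^sub>Q W\<close> from right \<open>Q\<close>-comodules to \<open>M\<close>.\<close>

definition cotensor_functor ::
  "('o, 'm, 'z) smc_scheme \<Rightarrow> 'o \<Rightarrow> ('o, 'm) comod
    \<Rightarrow> ('o, 'm) comod \<times> 'm \<times> ('o, 'm) comod \<Rightarrow> 'm" where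
  "cotensor_functor M q W = (\<lambda>(V, g, V').
    THE h. h \<in> Hom M (Dom M (cotensor M q V W)) (Dom M (cotensor M q V' W)) \<and>
      cotensor M q V' W \<cdot>\<^bsub>M\<^esub> h = (g \<odot>\<^bsub>M\<^esub> Idn M (cmob W)) \<cdot>\<^bsub>M\<^esub> cotensor M q V W)"

text \<open>\<open>A\<close> as a right, respectively left, comodule along a comonoid morphism
  \<open>p : A \<rightarrow> Q\<close>.\<close>

definition right_coreg :: "('o, 'm, 'z) smc_scheme \<Rightarrow> ('o, 'm, 'y) comon_scheme \<Rightarrow> 'm \<Rightarrow> ('o, 'm) comod" where
  "right_coreg M A p = \<lparr>cmob = cob A, coact = (Idn M (cob A) \<odot>\<^bsub>M\<^esub> p) \<cdot>\<^bsub>M\<^esub> comul A\<rparr>"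

definition left_coreg :: "('o, 'm, 'z) smc_scheme \<Rightarrow> ('o, 'm, 'y) comon_scheme \<Rightarrow> 'm \<Rightarrow> ('o, 'm) comod" where
  "left_coreg M A p = \<lparr>cmob = cob A, coact = (p \<odot>\<^bsub>M\<^esub> Idn M (cob A)) \<cdot>\<^bsub>M\<^esub> comul A\<rparr>"

text \<open>The category of cocommutative comonoids in left \<open>A\<close>-modules.\<close>

record ('o, 'm) modcomon = "('o, 'm) comon" +
  act :: "'m"

definition module_comonoid ::
  "('o, 'm, 'z) smc_scheme \<Rightarrow> ('o, 'm) hopf \<Rightarrow> ('o, 'm) modcomon \<Rightarrow> bool" where
  "module_comonoid M A Q \<longleftrightarrow>
    comonoid M Q \<and> cocommutative M Q \<and>
    act Q \<in> Hom M (cob A \<boxtimes>\<^bsub>M\<^esub> cob Q) (cob Q) \<and>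
    act Q \<cdot>\<^bsub>M\<^esub> (mul A \<odot>\<^bsub>M\<^esub> Idn M (cob Q)) =
      act Q \<cdot>\<^bsub>M\<^esub> (Idn M (cob A) \<odot>\<^bsub>M\<^esub> act Q) \<cdot>\<^bsub>M\<^esub> Asc M (cob A) (cob A) (cob Q) \<and>
    act Q \<cdot>\<^bsub>M\<^esub> (unit A \<odot>\<^bsub>M\<^esub> Idn M (cob Q)) = LUn M (cob Q) \<and>
    comul Q \<cdot>\<^bsub>M\<^esub> act Q =
      ((act Q \<odot>\<^bsub>M\<^esub> act Q) \<cdot>\<^bsub>M\<^esub> mid_swap M (cob A) (cob A) (cob Q) (cob Q) \<cdot>\<^bsub>M\<^esub>
        (comul A \<odot>\<^bsub>M\<^esub> Idn M (cob Q \<boxtimes>\<^bsub>M\<^esub> cob Q))) \<cdot>\<^bsub>M\<^esub>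
      (Idn M (cob A) \<odot>\<^bsub>M\<^esub> comul Q) \<and>
    counit Q \<cdot>\<^bsub>M\<^esub> act Q =
      (counit A \<cdot>\<^bsub>M\<^esub> RUn M (cob A)) \<cdot>\<^bsub>M\<^esub> (Idn M (cob A) \<odot>\<^bsub>M\<^esub> counit Q)"

definition module_comonoid_hom ::
  "('o, 'm, 'z) smc_scheme \<Rightarrow> ('o, 'm) hopf \<Rightarrow> ('o, 'm) modcomon \<Rightarrow> ('o, 'm) modcomon
    \<Rightarrow> 'm \<Rightarrow> bool" where
  "module_comonoid_hom M A P Q f \<longleftrightarrow>
    comonoid_hom M P Q f \<and>
    f \<cdot>\<^bsub>M\<^esub> act P = act Q \<cdot>\<^bsub>M\<^esub> (Idn M (cob A) \<odot>\<^bsub>M\<^esub> f)"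

definition ComonCocMod ::
  "('o, 'm, 'z) smc_scheme \<Rightarrow> ('o, 'm) hopf
    \<Rightarrow> (('o, 'm) modcomon, ('o, 'm) modcomon \<times> 'm \<times> ('o, 'm) modcomon) cat" where
  "ComonCocMod M A =
    structured_cat M {Q. module_comonoid M A Q} cob (module_comonoid_hom M A)"

definition reg_module_comonoid :: "('o, 'm) hopf \<Rightarrow> ('o, 'm) modcomon" where
  "reg_module_comonoid A = \<lparr>cob = cob A, comul = comul A, counit = counit A, act = mul A\<rparr>"

definition faithfully_coflat :: "('o, 'm, 'z) smc_scheme \<Rightarrow> bool" where
  "faithfully_coflat M \<longleftrightarrow>
    (\<forall>A \<in> Ob (HopfCoc M). \<forall>Q p.
      (reg_module_comonoid A, p, Q) \<in> Arr (ComonCocMod M A) \<and> is_epi M p \<longrightarrow>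
      preserves_epis (RComod M Q) M (cotensor_functor M (cob Q) (left_coreg M A p)) \<and>
      reflects_epis (RComod M Q) M (cotensor_functor M (cob Q) (left_coreg M A p)))"

text \<open>\<open>c\<close> is (a choice of) \<open>\<phi>\<^sub>A(i)\<close> for a morphism \<open>i : K \<rightarrow> A\<close> of Hopf monoids.\<close>

definition is_phi ::
  "('o, 'm, 'z) smc_scheme \<Rightarrow> ('o, 'm) hopf \<times> 'm \<times> ('o, 'm) hopf \<Rightarrow> 'm \<Rightarrow> bool" where
  "is_phi M i c = (case i of (K, j, A) \<Rightarrow>
    is_coequalizer M c
      (mul A \<cdot>\<^bsub>M\<^esub> (Idn M (cob A) \<odot>\<^bsub>M\<^esub> j))
      (RUn M (cob A) \<cdot>\<^bsub>M\<^esub> (Idn M (cob A) \<odot>\<^bsub>M\<^esub> counit K)))"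

end

theory Submission
  imports Defs
begin

text \<open>Write \<open>f = i \<pi>\<close> with \<open>i\<close> mono and let \<open>j : K \<rightarrow> A\<close> be the kernel of \<open>f\<close> among cocommutative Hopf monoids, i.e. the
  group-theoretic kernel computed in the category of cocommutative comonoids, whose product is \<open>\<otimes>\<close>.
  Let \<open>n : N \<rightarrow> A\<close> be the kernel of \<open>\<pi>\<close> in \<open>M\<close>. The difference \<open>a \<otimes> k \<mapsto> a k - a \<epsilon>(k)\<close> factors as \<open>n d\<close>
  with a morphism \<open>d : A \<otimes> K \<rightarrow> N\<close> of right \<open>Q\<close>-comodules, and \<open>\<pi>\<close> is the coequalizer \<open>\<phi>(j)\<close> as soon as \<open>d\<close> is epi. By
  faithful coflatness it suffices that \<open>d \<box>\<^sub>Q A\<close> is epi, and it is even split: in terms of generalized elements,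
  \<open>(a, c) \<mapsto> (c, c\<inverse> a, c)\<close> maps \<open>A \<box>\<^sub>Q A\<close> to \<open>(A \<otimes> K) \<box>\<^sub>Q A\<close>, and \<open>d \<box>\<^sub>Q A\<close> takes its value to \<open>(a, c) - (c, c)\<close>,
  whose second term vanishes on \<open>N \<box>\<^sub>Q A\<close> because \<open>\<epsilon> n = 0\<close>.
  All other claims follow from this coequalizer; for \<open>A \<box>\<^sub>Q A\<close> one uses \<open>(a, k) \<mapsto> (a k, a)\<close>.\<close>

text \<open>The hypothesis detects epimorphisms only between comodules. So \<open>d\<close> must be
  a comodule morphism although, as a difference of comonoid morphisms, it respects no comonoid
  structure. For this reason the element calculus admits arbitrary arrows as components and asks for
  comonoid morphisms only where an element is duplicated or discarded. What is reflected is moreover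
  an epi among comodules, which still has to be compared with an epi in \<open>M\<close>; there the
  cokernel of \<open>d\<close> is used, as it is again a comodule. The element
  \<open>c\<inverse> a\<close> lives on \<open>A \<box>\<^sub>Q A\<close>, which is only given a
  comonoid structure. Hence the universal property of \<open>K\<close> is kept for all cocommutative
  comonoids and not just for Hopf monoids. Neither equalizers nor images in \<open>M\<close> are
  comonoids for free; both become so through one criterion, that in the cocommutative case a left
  coideal is a subcomonoid, which rests on exactness of the tensor product. As the constraints are
  explicit, the fact that \<open>\<otimes>\<close> is the product of cocommutative comonoids has to
  be extracted from pentagon and hexagon; once this is done, tuples hide the constraints.\<close>

context category
begin

section \<open>Composition, monos, epis and isomorphisms in an arbitrary category\<close>

lemma Hom_iff [simp]: "f \<in> Hom C X Y \<longleftrightarrow> f \<in> Arr C \<and> Dom C f = X \<and> Cod C f = Y"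
  by (auto simp: Hom_def)

lemma cmp_arr [simp]: "f \<in> Arr C \<Longrightarrow> g \<in> Arr C \<Longrightarrow> Cod C f = Dom C g \<Longrightarrow> g \<cdot> f \<in> Arr C"
  and cmp_dom [simp]: "f \<in> Arr C \<Longrightarrow> g \<in> Arr C \<Longrightarrow> Cod C f = Dom C g \<Longrightarrow> Dom C (g \<cdot> f) = Dom C f"
  and cmp_cod [simp]: "f \<in> Arr C \<Longrightarrow> g \<in> Arr C \<Longrightarrow> Cod C f = Dom C g \<Longrightarrow> Cod C (g \<cdot> f) = Cod C g"
  using cmp_hom[of f "Dom C f" "Cod C f" g "Cod C g"] by auto

lemma dom_ob [simp]: "f \<in> Arr C \<Longrightarrow> Dom C f \<in> Ob C"
  and cod_ob [simp]: "f \<in> Arr C \<Longrightarrow> Cod C f \<in> Ob C"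
  by (rule arr_dom arr_cod, assumption)+

lemma id_arr [simp]: "X \<in> Ob C \<Longrightarrow> Idn C X \<in> Arr C"
  and id_dom [simp]: "X \<in> Ob C \<Longrightarrow> Dom C (Idn C X) = X"
  and id_cod [simp]: "X \<in> Ob C \<Longrightarrow> Cod C (Idn C X) = X"
  using id_hom[of X] by auto

lemma id_left [simp]: "f \<in> Arr C \<Longrightarrow> Cod C f = Y \<Longrightarrow> Idn C Y \<cdot> f = f"
  and id_right [simp]: "f \<in> Arr C \<Longrightarrow> Dom C f = X \<Longrightarrow> f \<cdot> Idn C X = f"
  using cmp_id_left[of f "Dom C f" Y] cmp_id_right[of f X "Cod C f"] by auto

lemma assoc [simp]: "f \<in> Arr C \<Longrightarrow> g \<in> Arr C \<Longrightarrow> h \<in> Arr C \<Longrightarrow> Cod C f = Dom C g \<Longrightarrow> Cod C g = Dom C h \<Longrightarrow>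
    (h \<cdot> g) \<cdot> f = h \<cdot> g \<cdot> f"
  using cmp_assoc[of f "Dom C f" "Cod C f" g "Cod C g" h "Cod C h"] by auto

text \<open>As a simp rule, \<open>assoc\<close> nests every composite to the right, so the left
  side of \<open>g \<cdot> f = k\<close> no longer occurs as a subterm once something is
  precomposed. This form carries the remaining tail \<open>r\<close> along.\<close>

lemma cmp_ext: "g \<cdot> f = k \<Longrightarrow> f \<in> Arr C \<Longrightarrow> g \<in> Arr C \<Longrightarrow> Cod C f = Dom C g \<Longrightarrow>
    r \<in> Arr C \<Longrightarrow> Cod C r = Dom C f \<Longrightarrow> g \<cdot> f \<cdot> r = k \<cdot> r"
  using assoc[of r f g] by argo

lemma cmp_ext2: "g \<cdot> f = k \<cdot> l \<Longrightarrow> f \<in> Arr C \<Longrightarrow> g \<in> Arr C \<Longrightarrow> k \<in> Arr C \<Longrightarrow> l \<in> Arr C \<Longrightarrow>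
    Cod C f = Dom C g \<Longrightarrow> Cod C l = Dom C k \<Longrightarrow> Dom C l = Dom C f \<Longrightarrow>
    r \<in> Arr C \<Longrightarrow> Cod C r = Dom C f \<Longrightarrow> g \<cdot> f \<cdot> r = k \<cdot> l \<cdot> r"
  using assoc[of r f g] assoc[of r l k] by argo

lemma mono_arr [simp]: "is_mono C f \<Longrightarrow> f \<in> Arr C"
  and epi_arr [simp]: "is_epi C f \<Longrightarrow> f \<in> Arr C"
  unfolding is_mono_def is_epi_def by blast+

lemma mono_cancel: "is_mono C f \<Longrightarrow> f \<cdot> g = f \<cdot> h \<Longrightarrow> g \<in> Arr C \<Longrightarrow> h \<in> Arr C \<Longrightarrow>
    Cod C g = Dom C f \<Longrightarrow> Cod C h = Dom C f \<Longrightarrow> Dom C g = Dom C h \<Longrightarrow> g = h"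
  unfolding is_mono_def Hom_def by blast

lemma epi_cancel: "is_epi C f \<Longrightarrow> g \<cdot> f = h \<cdot> f \<Longrightarrow> g \<in> Arr C \<Longrightarrow> h \<in> Arr C \<Longrightarrow>
    Dom C g = Cod C f \<Longrightarrow> Dom C h = Cod C f \<Longrightarrow> Cod C g = Cod C h \<Longrightarrow> g = h"
  unfolding is_epi_def Hom_def by blast

lemma monoI: "f \<in> Arr C \<Longrightarrow> (\<And>g h. g \<in> Arr C \<Longrightarrow> h \<in> Arr C \<Longrightarrow> Cod C g = Dom C f \<Longrightarrow> Cod C h = Dom C f \<Longrightarrow>
    Dom C g = Dom C h \<Longrightarrow> f \<cdot> g = f \<cdot> h \<Longrightarrow> g = h) \<Longrightarrow> is_mono C f"
  unfolding is_mono_def Hom_def by blast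

lemma epiI: "f \<in> Arr C \<Longrightarrow> (\<And>g h. g \<in> Arr C \<Longrightarrow> h \<in> Arr C \<Longrightarrow> Dom C g = Cod C f \<Longrightarrow> Dom C h = Cod C f \<Longrightarrow>
    Cod C g = Cod C h \<Longrightarrow> g \<cdot> f = h \<cdot> f \<Longrightarrow> g = h) \<Longrightarrow> is_epi C f"
  unfolding is_epi_def Hom_def by blast

lemma mono_comp: "is_mono C f \<Longrightarrow> is_mono C g \<Longrightarrow> Cod C f = Dom C g \<Longrightarrow> is_mono C (g \<cdot> f)"
proof (rule monoI, goal_cases)
  case (2 x y)
  then have "g \<cdot> (f \<cdot> x) = g \<cdot> (f \<cdot> y)" by simp
  with 2 mono_cancel[of g "f \<cdot> x" "f \<cdot> y"] have "f \<cdot> x = f \<cdot> y" by auto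
  with 2 mono_cancel[of f x y] show ?case by auto
qed auto

lemma epi_comp: "is_epi C f \<Longrightarrow> is_epi C g \<Longrightarrow> Cod C f = Dom C g \<Longrightarrow> is_epi C (g \<cdot> f)"
proof (rule epiI, goal_cases)
  case (2 x y)
  then have "(x \<cdot> g) \<cdot> f = (y \<cdot> g) \<cdot> f" by simp
  with 2 epi_cancel[of f "x \<cdot> g" "y \<cdot> g"] have "x \<cdot> g = y \<cdot> g" by auto
  with 2 epi_cancel[of g x y] show ?case by auto
qed auto

lemma are_inverse_unique:
  assumes g: "are_inverse C f g" and h: "are_inverse C f h"
  shows "g = h"
proof -
  have "g = g \<cdot> (f \<cdot> h)" using g h by (simp add: are_inverse_def)
  also have "\<dots> = (g \<cdot> f) \<cdot> h" using g h assoc[of h f g] by (simp add: are_inverse_def)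
  also have "\<dots> = h" using g h id_left[of h] by (simp add: are_inverse_def)
  finally show ?thesis .
qed

lemma are_inverse_inv_arr: "is_iso C f \<Longrightarrow> are_inverse C f (inv_arr C f)"
  unfolding is_iso_def inv_arr_def by (metis are_inverse_unique theI')

lemma inv_arr_eqI: "are_inverse C f g \<Longrightarrow> inv_arr C f = g"
  using are_inverse_inv_arr are_inverse_unique is_iso_def by metis

lemma iso_arr: "is_iso C f \<Longrightarrow> f \<in> Arr C"
  by (auto simp: is_iso_def are_inverse_def)

lemma inv_arr [simp]: "is_iso C f \<Longrightarrow> inv_arr C f \<in> Arr C"
  and inv_dom [simp]: "is_iso C f \<Longrightarrow> Dom C (inv_arr C f) = Cod C f"
  and inv_cod [simp]: "is_iso C f \<Longrightarrow> Cod C (inv_arr C f) = Dom C f"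
  and inv_left [simp]: "is_iso C f \<Longrightarrow> inv_arr C f \<cdot> f = Idn C (Dom C f)"
  and inv_right [simp]: "is_iso C f \<Longrightarrow> f \<cdot> inv_arr C f = Idn C (Cod C f)"
  using are_inverse_inv_arr[of f] by (auto simp: are_inverse_def)

lemma inv_left_ext [simp]: "is_iso C f \<Longrightarrow> r \<in> Arr C \<Longrightarrow> Cod C r = Dom C f \<Longrightarrow> inv_arr C f \<cdot> f \<cdot> r = r"
  and inv_right_ext [simp]: "is_iso C f \<Longrightarrow> r \<in> Arr C \<Longrightarrow> Cod C r = Cod C f \<Longrightarrow> f \<cdot> inv_arr C f \<cdot> r = r"
  by (simp_all flip: assoc add: iso_arr)

lemma iso_mono: "is_iso C f \<Longrightarrow> is_mono C f"
proof (rule monoI, goal_cases)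
  case (2 x y)
  have "x = inv_arr C f \<cdot> (f \<cdot> x)" using 2(1-6) by simp
  also have "\<dots> = y" using 2(1-6) by (simp only: 2(7)) simp
  finally show ?case .
qed (auto simp: iso_arr)

lemma iso_epi: "is_iso C f \<Longrightarrow> is_epi C f"
proof (rule epiI, goal_cases)
  case (2 x y)
  have "x = (x \<cdot> f) \<cdot> inv_arr C f" using 2(1-6) by (simp add: iso_arr)
  also have "\<dots> = y" using 2(1-6) by (simp only: 2(7)) (simp add: iso_arr)
  finally show ?case .
qed (auto simp: iso_arr)

lemma iso_inv: "is_iso C f \<Longrightarrow> is_iso C (inv_arr C f)"
  unfolding is_iso_def[of _ "inv_arr C f"] are_inverse_def by (rule exI[of _ f]) (simp add: iso_arr)

lemma are_inverse_isoI: "are_inverse C f g \<Longrightarrow> is_iso C f"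
  by (auto simp: is_iso_def)

lemma iso_comp: "is_iso C f \<Longrightarrow> is_iso C g \<Longrightarrow> Cod C f = Dom C g \<Longrightarrow> is_iso C (g \<cdot> f)"
  by (rule are_inverse_isoI[of _ "inv_arr C f \<cdot> inv_arr C g"]) (simp add: are_inverse_def iso_arr)

section \<open>Equalizers, coequalizers, kernels and cokernels in an arbitrary category\<close>

lemma equalizerD:
  assumes "is_equalizer C e f g"
  shows "f \<in> Arr C" "g \<in> Arr C" "Dom C g = Dom C f" "Cod C g = Cod C f"
    "e \<in> Arr C" "Cod C e = Dom C f" "f \<cdot> e = g \<cdot> e"
  using assms unfolding is_equalizer_def Hom_def mem_Collect_eq by - (elim conjE, assumption)+

lemma equalizerI:
  assumes "f \<in> Arr C" "g \<in> Arr C" "Dom C g = Dom C f" "Cod C g = Cod C f"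
    "e \<in> Arr C" "Cod C e = Dom C f" "f \<cdot> e = g \<cdot> e"
    and "\<And>x. x \<in> Arr C \<Longrightarrow> Cod C x = Dom C f \<Longrightarrow> f \<cdot> x = g \<cdot> x \<Longrightarrow>
      \<exists>!y. y \<in> Hom C (Dom C x) (Dom C e) \<and> e \<cdot> y = x"
  shows "is_equalizer C e f g"
  unfolding is_equalizer_def
proof (intro conjI allI ballI impI)
  fix X x assume "x \<in> Hom C X (Dom C f)" "f \<cdot> x = g \<cdot> x"
  then show "\<exists>!y. y \<in> Hom C X (Dom C e) \<and> e \<cdot> y = x" using assms(8)[of x] by simp
qed (use assms(1-7) in simp_all)

lemma coequalizerI:
  assumes "f \<in> Arr C" "g \<in> Arr C" "Dom C g = Dom C f" "Cod C g = Cod C f"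
    "q \<in> Arr C" "Dom C q = Cod C f" "q \<cdot> f = q \<cdot> g"
    and "\<And>x. x \<in> Arr C \<Longrightarrow> Dom C x = Cod C f \<Longrightarrow> x \<cdot> f = x \<cdot> g \<Longrightarrow>
      \<exists>!y. y \<in> Hom C (Cod C q) (Cod C x) \<and> y \<cdot> q = x"
  shows "is_coequalizer C q f g"
  unfolding is_coequalizer_def
proof (intro conjI allI ballI impI)
  fix X x assume "x \<in> Hom C (Cod C f) X" "x \<cdot> f = x \<cdot> g"
  then show "\<exists>!y. y \<in> Hom C (Cod C q) X \<and> y \<cdot> q = x" using assms(8)[of x] by simp
qed (use assms(1-7) in simp_all)

lemma equalizer_ex1:
  assumes "is_equalizer C e f g" "x \<in> Arr C" "Cod C x = Dom C f" "f \<cdot> x = g \<cdot> x"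
  shows "\<exists>!y. y \<in> Hom C (Dom C x) (Dom C e) \<and> e \<cdot> y = x"
  by (rule assms(1)[unfolded is_equalizer_def, THEN conjunct2, THEN conjunct2, THEN conjunct2, THEN conjunct2,
      rule_format]) (use assms(2-4) in simp_all)

lemma equalizer_factor:
  assumes "is_equalizer C e f g" "x \<in> Arr C" "Cod C x = Dom C f" "f \<cdot> x = g \<cdot> x"
  shows "\<exists>y. y \<in> Arr C \<and> Dom C y = Dom C x \<and> Cod C y = Dom C e \<and> e \<cdot> y = x"
  using equalizer_ex1[OF assms] by auto

lemma equalizer_mono: "is_equalizer C e f g \<Longrightarrow> is_mono C e"
proof (rule monoI, goal_cases)
  case (2 x y)
  note e = equalizerD[OF 2(1)]
  have "f \<cdot> (e \<cdot> x) = (f \<cdot> e) \<cdot> x" using 2(2,4) e(1-6) by simp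
  also have "\<dots> = g \<cdot> (e \<cdot> x)" unfolding e(7) using 2(2,4) e(1-6) by simp
  finally have "\<exists>!y. y \<in> Hom C (Dom C (e \<cdot> x)) (Dom C e) \<and> e \<cdot> y = e \<cdot> x"
    using 2(2,4) e(1-6) by (intro equalizer_ex1[OF 2(1)]) simp_all
  moreover have "x \<in> Hom C (Dom C (e \<cdot> x)) (Dom C e)" "y \<in> Hom C (Dom C (e \<cdot> x)) (Dom C e)"
    using 2(2-6) e by simp_all
  ultimately show ?case using 2(7) by metis
qed (auto dest: equalizerD)

text \<open>A mono \<open>h\<close> cancels, so both pairs are equalized by the same arrows. This
  allows the parallel pair that defines a cotensor product to be replaced by one with permuted
  factors.\<close>

lemma equalizer_cmp_mono:
  assumes h: "is_mono C h" and f: "f \<in> Arr C" "g \<in> Arr C" "Dom C g = Dom C f" "Cod C f = Dom C h" "Cod C g = Dom C h"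
    and e: "is_equalizer C e (h \<cdot> f) (h \<cdot> g)"
  shows "is_equalizer C e f g"
proof (rule equalizerI)
  note * = equalizerD[OF e]
  show "e \<in> Arr C" "Cod C e = Dom C f" using * f h by simp_all
  then show "f \<cdot> e = g \<cdot> e" using *(7) f h mono_cancel[OF h, of "f \<cdot> e" "g \<cdot> e"] by simp
  fix x assume x: "x \<in> Arr C" "Cod C x = Dom C f" "f \<cdot> x = g \<cdot> x"
  then show "\<exists>!y. y \<in> Hom C (Dom C x) (Dom C e) \<and> e \<cdot> y = x"
    using f h by (intro equalizer_ex1[OF e]) simp_all
qed (use f in simp_all)

lemma split_epi: "h \<cdot> t = Idn C (Cod C h) \<Longrightarrow> h \<in> Arr C \<Longrightarrow> t \<in> Arr C \<Longrightarrow> Cod C t = Dom C h \<Longrightarrow> is_epi C h"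
proof (rule epiI, goal_cases)
  case (2 x y)
  have "x = (x \<cdot> h) \<cdot> t" using 2(1-9) by simp
  also have "\<dots> = y" using 2(1-9) by (simp only: 2(10)) simp
  finally show ?case .
qed auto

lemma kernelD:
  assumes "is_kernel C k f"
  shows "f \<in> Arr C" "k \<in> Arr C" "Cod C k = Dom C f" "is_zero_arr C (f \<cdot> k)"
  using assms unfolding is_kernel_def Hom_def mem_Collect_eq by - (elim conjE, assumption)+

lemma cokernelD:
  assumes "is_cokernel C q f"
  shows "f \<in> Arr C" "q \<in> Arr C" "Dom C q = Cod C f" "is_zero_arr C (q \<cdot> f)"
  using assms unfolding is_cokernel_def Hom_def mem_Collect_eq by - (elim conjE, assumption)+

lemma coequalizerD:
  assumes "is_coequalizer C q f g"
  shows "f \<in> Arr C" "g \<in> Arr C" "Dom C g = Dom C f" "Cod C g = Cod C f"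
    "q \<in> Arr C" "Dom C q = Cod C f" "q \<cdot> f = q \<cdot> g"
  using assms unfolding is_coequalizer_def Hom_def mem_Collect_eq by - (elim conjE, assumption)+

lemma coequalizer_ex1:
  assumes "is_coequalizer C e f g" "x \<in> Arr C" "Dom C x = Cod C f" "x \<cdot> f = x \<cdot> g"
  shows "\<exists>!y. y \<in> Hom C (Cod C e) (Cod C x) \<and> y \<cdot> e = x"
  by (rule assms(1)[unfolded is_coequalizer_def, THEN conjunct2, THEN conjunct2, THEN conjunct2, THEN conjunct2,
      rule_format]) (use assms(2-4) in simp_all)

lemma coequalizer_factor:
  assumes "is_coequalizer C e f g" "x \<in> Arr C" "Dom C x = Cod C f" "x \<cdot> f = x \<cdot> g"
  shows "\<exists>y. y \<in> Arr C \<and> Dom C y = Cod C e \<and> Cod C y = Cod C x \<and> y \<cdot> e = x"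
  using coequalizer_ex1[OF assms] by auto

lemma coequalizer_epi: "is_coequalizer C q f g \<Longrightarrow> is_epi C q"
proof (rule epiI, goal_cases)
  case (2 x y)
  note e = coequalizerD[OF 2(1)]
  have "(x \<cdot> q) \<cdot> f = x \<cdot> (q \<cdot> f)" using 2(2,4) e(1-6) by simp
  also have "\<dots> = (x \<cdot> q) \<cdot> g" unfolding e(7) using 2(2,4) e(1-6) by simp
  finally have "\<exists>!y. y \<in> Hom C (Cod C q) (Cod C (x \<cdot> q)) \<and> y \<cdot> q = x \<cdot> q"
    using 2(2,4) e(1-6) by (intro coequalizer_ex1[OF 2(1)]) simp_all
  moreover have "x \<in> Hom C (Cod C q) (Cod C (x \<cdot> q))" "y \<in> Hom C (Cod C q) (Cod C (x \<cdot> q))"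
    using 2(2-6) e by simp_all
  ultimately show ?case using 2(7) by metis
qed (auto dest: coequalizerD)

section \<open>Quotients up to isomorphism\<close>

lemma coequalizer_unique:
  assumes p: "is_coequalizer C p f g" and q: "is_coequalizer C q f g"
  shows "same_quotient C p q"
proof -
  note e = coequalizerD[OF p] coequalizerD[OF q]
  obtain y where y: "y \<in> Arr C" "Dom C y = Cod C p" "Cod C y = Cod C q" "y \<cdot> p = q"
    using e coequalizer_factor[OF p, of q] by auto
  obtain z where z: "z \<in> Arr C" "Dom C z = Cod C q" "Cod C z = Cod C p" "z \<cdot> q = p"
    using e coequalizer_factor[OF q, of p] by auto
  have "(z \<cdot> y) \<cdot> p = Idn C (Cod C p) \<cdot> p" "(y \<cdot> z) \<cdot> q = Idn C (Cod C q) \<cdot> q"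
    using y z e by simp_all
  then have "z \<cdot> y = Idn C (Cod C p)" "y \<cdot> z = Idn C (Cod C q)"
    using y z e epi_cancel[OF coequalizer_epi[OF p], of "z \<cdot> y" "Idn C (Cod C p)"]
      epi_cancel[OF coequalizer_epi[OF q], of "y \<cdot> z" "Idn C (Cod C q)"] by auto
  then have "are_inverse C y z" using y z by (simp add: are_inverse_def)
  then show ?thesis using y e unfolding same_quotient_def by (auto intro: are_inverse_isoI)
qed

text \<open>Only zero arrows and unique factorizations enter, no addition, because the lemma is also
  applied to cocommutative Hopf monoids, whose hom sets carry no group structure here.\<close>

lemma cokernel_unique:
  assumes p: "is_cokernel C p f" and q: "is_cokernel C q f"
  shows "same_quotient C p q"
proof -
  have ex1: "\<exists>!y. y \<in> Hom C (Cod C p) (Cod C x) \<and> y \<cdot> p = x" if "is_cokernel C p f" "is_cokernel C x f" for p x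
  proof -
    have "x \<in> Hom C (Cod C f) (Cod C x)" "is_zero_arr C (x \<cdot> f)" using cokernelD[OF that(2)] by simp_all
    then show ?thesis
      by (rule that(1)[unfolded is_cokernel_def, THEN conjunct2, THEN conjunct2, THEN conjunct2, rule_format])
  qed
  note [simp] = cokernelD(2)[OF p] cokernelD(2)[OF q]
  have d [simp]: "Dom C p = Cod C f" "Dom C q = Cod C f" using cokernelD(3)[OF p] cokernelD(3)[OF q] .
  obtain y where y: "y \<in> Arr C" "Dom C y = Cod C p" "Cod C y = Cod C q" "y \<cdot> p = q" using ex1[OF p q] by auto
  obtain z where z: "z \<in> Arr C" "Dom C z = Cod C q" "Cod C z = Cod C p" "z \<cdot> q = p" using ex1[OF q p] by auto
  have "z \<cdot> y \<in> Hom C (Cod C p) (Cod C p)" "Idn C (Cod C p) \<in> Hom C (Cod C p) (Cod C p)"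
    "y \<cdot> z \<in> Hom C (Cod C q) (Cod C q)" "Idn C (Cod C q) \<in> Hom C (Cod C q) (Cod C q)" using y z by simp_all
  moreover have "(z \<cdot> y) \<cdot> p = p" "Idn C (Cod C p) \<cdot> p = p" "(y \<cdot> z) \<cdot> q = q" "Idn C (Cod C q) \<cdot> q = q"
    using y z by simp_all
  ultimately have "z \<cdot> y = Idn C (Cod C p)" "y \<cdot> z = Idn C (Cod C q)"
    using ex1[OF p p] ex1[OF q q] by metis+
  then have "are_inverse C y z" using y z by (simp add: are_inverse_def)
  then show ?thesis using y d are_inverse_isoI[of y z] unfolding same_quotient_def by auto
qed

lemma same_quotient_sym: assumes "same_quotient C p q" shows "same_quotient C q p"
proof -
  obtain t where t: "t \<in> Hom C (Cod C p) (Cod C q)" "is_iso C t" "t \<cdot> p = q" and pq: "p \<in> Arr C" "q \<in> Arr C" "Dom C p = Dom C q"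
    using assms unfolding same_quotient_def by blast
  have "inv_arr C t \<cdot> (t \<cdot> p) = p" using t(1,2) pq(1) by simp
  then have "inv_arr C t \<cdot> q = p" unfolding t(3) .
  moreover have "inv_arr C t \<in> Hom C (Cod C q) (Cod C p)" using t(1,2) by simp
  ultimately show ?thesis using pq iso_inv[OF t(2)] unfolding same_quotient_def by metis
qed

lemma same_quotient_trans: assumes "same_quotient C p q" "same_quotient C q r" shows "same_quotient C p r"
proof -
  obtain t where t: "t \<in> Hom C (Cod C p) (Cod C q)" "is_iso C t" "t \<cdot> p = q" and pq: "p \<in> Arr C" "q \<in> Arr C" "Dom C p = Dom C q"
    using assms(1) unfolding same_quotient_def by blast
  obtain s where s: "s \<in> Hom C (Cod C q) (Cod C r)" "is_iso C s" "s \<cdot> q = r" and qr: "r \<in> Arr C" "Dom C q = Dom C r"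
    using assms(2) unfolding same_quotient_def by blast
  have "(s \<cdot> t) \<cdot> p = s \<cdot> (t \<cdot> p)" using s(1) t(1) pq(1) by simp
  also have "\<dots> = r" by (simp only: t(3) s(3))
  finally have "(s \<cdot> t) \<cdot> p = r" .
  moreover have "is_iso C (s \<cdot> t)" using s(1,2) t(1,2) by (intro iso_comp) simp_all
  moreover have "s \<cdot> t \<in> Hom C (Cod C p) (Cod C r)" "Dom C p = Dom C r" using s(1) t(1) pq(3) qr(2) by simp_all
  ultimately show ?thesis using pq(1) qr(1) unfolding same_quotient_def by blast
qed

end

context abelian_category
begin

section \<open>Zero arrows, kernels and cokernels in an abelian category\<close>

lemma add_hom [simp]: assumes "f \<in> Arr C" "g \<in> Arr C" "Dom C g = Dom C f" "Cod C g = Cod C f"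
  shows "Add C f g \<in> Arr C" "Dom C (Add C f g) = Dom C f" "Cod C (Add C f g) = Cod C f"
proof -
  interpret G: comm_group "hom_group C (Dom C f) (Cod C f)" using hom_comm_group assms by simp
  show "Add C f g \<in> Arr C" "Dom C (Add C f g) = Dom C f" "Cod C (Add C f g) = Cod C f"
    using G.m_closed[of f g] assms by (auto simp: hom_group_def)
qed

lemma zer_hom [simp]: assumes "X \<in> Ob C" "Y \<in> Ob C"
  shows "Zer C X Y \<in> Arr C" "Dom C (Zer C X Y) = X" "Cod C (Zer C X Y) = Y"
proof -
  interpret G: comm_group "hom_group C X Y" using hom_comm_group assms by simp
  show "Zer C X Y \<in> Arr C" "Dom C (Zer C X Y) = X" "Cod C (Zer C X Y) = Y"
    using G.one_closed by (auto simp: hom_group_def)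
qed

lemma add_zer_left: "f \<in> Arr C \<Longrightarrow> Dom C f = X \<Longrightarrow> Cod C f = Y \<Longrightarrow> Add C (Zer C X Y) f = f"
proof -
  assume f: "f \<in> Arr C" "Dom C f = X" "Cod C f = Y"
  then interpret G: comm_group "hom_group C X Y" using hom_comm_group by auto
  show ?thesis using G.l_one[of f] f by (simp add: hom_group_def)
qed

text \<open>A group has only one idempotent. Together with biadditivity of composition this makes
  every composite with \<open>Zer\<close> vanish.\<close>

lemma add_idem: "Add C f f = f \<Longrightarrow> f \<in> Arr C \<Longrightarrow> f = Zer C (Dom C f) (Cod C f)"
proof -
  assume f: "Add C f f = f" "f \<in> Arr C"
  then interpret G: comm_group "hom_group C (Dom C f) (Cod C f)" using hom_comm_group by auto
  show ?thesis using G.l_cancel_one[of f f] f by (simp add: hom_group_def)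
qed

lemma cmp_zer [simp]:
  assumes "h \<in> Arr C" "X \<in> Ob C" "Dom C h = Y"
  shows "h \<cdot> Zer C X Y = Zer C X (Cod C h)"
proof -
  have Y: "Y \<in> Ob C" using assms by auto
  have "Add C (h \<cdot> Zer C X Y) (h \<cdot> Zer C X Y) = h \<cdot> Add C (Zer C X Y) (Zer C X Y)"
    using cmp_add_right[of "Zer C X Y" X Y "Zer C X Y" h "Cod C h"] assms Y by simp
  also have "Add C (Zer C X Y) (Zer C X Y) = Zer C X Y" using assms Y by (simp add: add_zer_left)
  finally have "h \<cdot> Zer C X Y = Zer C (Dom C (h \<cdot> Zer C X Y)) (Cod C (h \<cdot> Zer C X Y))"
    by (rule add_idem) (use assms Y in simp)
  also have "\<dots> = Zer C X (Cod C h)" using assms Y by simp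
  finally show ?thesis .
qed

lemma zer_cmp [simp]:
  assumes "h \<in> Arr C" "Z \<in> Ob C" "Cod C h = Y"
  shows "Zer C Y Z \<cdot> h = Zer C (Dom C h) Z"
proof -
  have Y: "Y \<in> Ob C" using assms by auto
  have "Add C (Zer C Y Z \<cdot> h) (Zer C Y Z \<cdot> h) = Add C (Zer C Y Z) (Zer C Y Z) \<cdot> h"
    using cmp_add_left[of h "Dom C h" Y "Zer C Y Z" Z "Zer C Y Z"] assms Y by simp
  also have "Add C (Zer C Y Z) (Zer C Y Z) = Zer C Y Z" using assms Y by (simp add: add_zer_left)
  finally have "Zer C Y Z \<cdot> h = Zer C (Dom C (Zer C Y Z \<cdot> h)) (Cod C (Zer C Y Z \<cdot> h))"
    by (rule add_idem) (use assms Y in simp)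
  also have "\<dots> = Zer C (Dom C h) Z" using assms Y by simp
  finally show ?thesis .
qed

text \<open>Reconciles two notions of zero: kernels are defined by factoring through a zero object,
  hom groups by their neutral element. They meet at a zero object, whose only endomorphism is at
  once the identity and \<open>Zer\<close>.\<close>

lemma zero_arr_iff: "is_zero_arr C f \<longleftrightarrow> f \<in> Arr C \<and> f = Zer C (Dom C f) (Cod C f)"
proof (intro iffI conjI)
  assume a: "is_zero_arr C f"
  then show fa: "f \<in> Arr C" unfolding is_zero_arr_def by blast
  from a obtain z g h where z: "is_zero_ob C z" and g: "g \<in> Hom C (Dom C f) z"
    and h: "h \<in> Hom C z (Cod C f)" and f: "f = h \<cdot> g"
    unfolding is_zero_arr_def by blast
  have zo: "z \<in> Ob C" and ex1: "\<exists>!i. i \<in> Hom C z z" using z unfolding is_zero_ob_def by blast+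
  have "Idn C z \<in> Hom C z z" "Zer C z z \<in> Hom C z z" using zo by simp_all
  with ex1 have "Idn C z = Zer C z z" by blast
  then have "h \<cdot> Idn C z \<cdot> g = h \<cdot> Zer C z z \<cdot> g" by simp
  then have "h \<cdot> g = Zer C (Dom C f) (Cod C f)" using g h zo fa by simp
  then show "f = Zer C (Dom C f) (Cod C f)" using f by metis
next
  assume "f \<in> Arr C \<and> f = Zer C (Dom C f) (Cod C f)"
  then have f: "f \<in> Arr C" and f0: "Zer C (Dom C f) (Cod C f) = f" by metis+
  obtain z where z: "is_zero_ob C z" using ex_zero_ob by blast
  then have zo: "z \<in> Ob C" unfolding is_zero_ob_def by blast
  have "f = Zer C z (Cod C f) \<cdot> Zer C (Dom C f) z" using f f0 zo by simp
  then show "is_zero_arr C f" unfolding is_zero_arr_def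
    by (intro conjI exI[of _ z] bexI[of _ "Zer C z (Cod C f)"] bexI[of _ "Zer C (Dom C f) z"] f z)
      (use f zo in simp_all)
qed

lemma zero_cmp_iff: "f \<in> Arr C \<Longrightarrow> g \<in> Arr C \<Longrightarrow> Cod C f = Dom C g \<Longrightarrow>
    is_zero_arr C (g \<cdot> f) \<longleftrightarrow> g \<cdot> f = Zer C (Dom C f) (Cod C g)"
  using zero_arr_iff[of "g \<cdot> f"] by (metis cmp_arr cmp_dom cmp_cod)

lemma kernel_zero: "is_kernel C k f \<Longrightarrow> f \<cdot> k = Zer C (Dom C k) (Cod C f)"
  using kernelD[of k f] zero_cmp_iff[of k f] by blast

lemma cokernel_zero: "is_cokernel C q f \<Longrightarrow> q \<cdot> f = Zer C (Dom C f) (Cod C q)"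
  using cokernelD[of q f] zero_cmp_iff[of f q] by force

lemma kernel_ex1:
  assumes "is_kernel C k f" "x \<in> Arr C" "Cod C x = Dom C f" "f \<cdot> x = Zer C (Dom C x) (Cod C f)"
  shows "\<exists>!y. y \<in> Hom C (Dom C x) (Dom C k) \<and> k \<cdot> y = x"
  by (rule assms(1)[unfolded is_kernel_def, THEN conjunct2, THEN conjunct2, THEN conjunct2, rule_format])
    (use assms(2-4) kernelD(1)[OF assms(1)] zero_cmp_iff[of x f] in simp_all)

lemma cokernel_ex1:
  assumes "is_cokernel C q f" "x \<in> Arr C" "Dom C x = Cod C f" "x \<cdot> f = Zer C (Dom C f) (Cod C x)"
  shows "\<exists>!y. y \<in> Hom C (Cod C q) (Cod C x) \<and> y \<cdot> q = x"
  by (rule assms(1)[unfolded is_cokernel_def, THEN conjunct2, THEN conjunct2, THEN conjunct2, rule_format])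
    (use assms(2-4) cokernelD(1)[OF assms(1)] zero_cmp_iff[of f x] in simp_all)

lemma kernelI:
  assumes "f \<in> Arr C" "k \<in> Arr C" "Cod C k = Dom C f" "f \<cdot> k = Zer C (Dom C k) (Cod C f)"
    and "\<And>x. x \<in> Arr C \<Longrightarrow> Cod C x = Dom C f \<Longrightarrow> f \<cdot> x = Zer C (Dom C x) (Cod C f) \<Longrightarrow>
      \<exists>!y. y \<in> Hom C (Dom C x) (Dom C k) \<and> k \<cdot> y = x"
  shows "is_kernel C k f"
  unfolding is_kernel_def
proof (intro conjI allI ballI impI)
  fix X x assume x: "x \<in> Hom C X (Dom C f)" "is_zero_arr C (f \<cdot> x)"
  then have "f \<cdot> x = Zer C (Dom C x) (Cod C f)" using assms(1) zero_cmp_iff[of x f] by simp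
  then show "\<exists>!y. y \<in> Hom C X (Dom C k) \<and> k \<cdot> y = x" using x(1) assms(5)[of x] by simp
qed (use assms(1-4) zero_cmp_iff[of k f] in simp_all)

lemma cokernelI:
  assumes "f \<in> Arr C" "q \<in> Arr C" "Dom C q = Cod C f" "q \<cdot> f = Zer C (Dom C f) (Cod C q)"
    and "\<And>x. x \<in> Arr C \<Longrightarrow> Dom C x = Cod C f \<Longrightarrow> x \<cdot> f = Zer C (Dom C f) (Cod C x) \<Longrightarrow>
      \<exists>!y. y \<in> Hom C (Cod C q) (Cod C x) \<and> y \<cdot> q = x"
  shows "is_cokernel C q f"
  unfolding is_cokernel_def
proof (intro conjI allI ballI impI)
  fix X x assume x: "x \<in> Hom C (Cod C f) X" "is_zero_arr C (x \<cdot> f)"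
  then have "x \<cdot> f = Zer C (Dom C f) (Cod C x)" using assms(1) zero_cmp_iff[of f x] by simp
  then show "\<exists>!y. y \<in> Hom C (Cod C q) X \<and> y \<cdot> q = x" using x(1) assms(5)[of x] by simp
qed (use assms(1-4) zero_cmp_iff[of f q] in simp_all)

lemma kernel_iff_equalizer:
  assumes f: "f \<in> Arr C"
  shows "is_kernel C k f \<longleftrightarrow> is_equalizer C k f (Zer C (Dom C f) (Cod C f))"
proof
  assume k: "is_kernel C k f"
  show "is_equalizer C k f (Zer C (Dom C f) (Cod C f))"
    by (rule equalizerI) (use f kernelD[OF k] kernel_zero[OF k] kernel_ex1[OF k] in simp_all)
next
  assume k: "is_equalizer C k f (Zer C (Dom C f) (Cod C f))"
  show "is_kernel C k f"
    by (rule kernelI) (use f equalizerD[OF k] equalizer_ex1[OF k] in simp_all)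
qed

lemma cokernel_iff_coequalizer:
  assumes f: "f \<in> Arr C"
  shows "is_cokernel C q f \<longleftrightarrow> is_coequalizer C q f (Zer C (Dom C f) (Cod C f))"
proof
  assume k: "is_cokernel C q f"
  show "is_coequalizer C q f (Zer C (Dom C f) (Cod C f))"
    by (rule coequalizerI) (use f cokernelD[OF k] cokernel_zero[OF k] cokernel_ex1[OF k] in simp_all)
next
  assume k: "is_coequalizer C q f (Zer C (Dom C f) (Cod C f))"
  show "is_cokernel C q f"
    by (rule cokernelI) (use f coequalizerD[OF k] coequalizer_ex1[OF k] in simp_all)
qed

lemma kernel_mono: "is_kernel C k f \<Longrightarrow> is_mono C k"
  using equalizer_mono kernel_iff_equalizer kernelD by metis

lemma cokernel_epi: "is_cokernel C q f \<Longrightarrow> is_epi C q"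
  using coequalizer_epi cokernel_iff_coequalizer cokernelD by metis

lemma kernel_factor:
  assumes "is_kernel C k f" "x \<in> Arr C" "Cod C x = Dom C f" "f \<cdot> x = Zer C (Dom C x) (Cod C f)"
  shows "\<exists>y. y \<in> Arr C \<and> Dom C y = Dom C x \<and> Cod C y = Dom C k \<and> k \<cdot> y = x"
  using kernel_ex1[OF assms] by auto

lemma cokernel_factor:
  assumes "is_cokernel C q f" "x \<in> Arr C" "Dom C x = Cod C f" "x \<cdot> f = Zer C (Dom C f) (Cod C x)"
  shows "\<exists>y. y \<in> Arr C \<and> Dom C y = Cod C q \<and> Cod C y = Cod C x \<and> y \<cdot> q = x"
  using cokernel_ex1[OF assms] by auto

section \<open>Subtraction of parallel arrows\<close>

definition dif :: "'m \<Rightarrow> 'm \<Rightarrow> 'm" where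
  "dif f g = Add C f (m_inv (hom_group C (Dom C f) (Cod C f)) g)"

lemma dif_hom [simp]: assumes "f \<in> Arr C" "g \<in> Arr C" "Dom C g = Dom C f" "Cod C g = Cod C f"
  shows "dif f g \<in> Arr C" "Dom C (dif f g) = Dom C f" "Cod C (dif f g) = Cod C f"
proof -
  interpret G: comm_group "hom_group C (Dom C f) (Cod C f)" using hom_comm_group assms by simp
  show "dif f g \<in> Arr C" "Dom C (dif f g) = Dom C f" "Cod C (dif f g) = Cod C f"
    using G.m_closed[OF _ G.inv_closed[of g], of f] assms by (auto simp: hom_group_def dif_def)
qed

text \<open>Characterizes the difference by addition alone, so that the later facts about
  \<open>dif\<close> follow from biadditivity without touching group inverses.\<close>

lemma dif_iff: assumes "f \<in> Arr C" "g \<in> Arr C" "Dom C g = Dom C f" "Cod C g = Cod C f"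
    "d \<in> Arr C" "Dom C d = Dom C f" "Cod C d = Cod C f"
  shows "d = dif f g \<longleftrightarrow> Add C d g = f"
proof -
  interpret G: comm_group "hom_group C (Dom C f) (Cod C f)" using hom_comm_group assms by simp
  show ?thesis using G.inv_solve_right[of d f g] assms by (auto simp: hom_group_def dif_def)
qed

lemma dif_add: assumes "f \<in> Arr C" "g \<in> Arr C" "Dom C g = Dom C f" "Cod C g = Cod C f"
  shows "Add C (dif f g) g = f"
  using dif_iff[of f g "dif f g"] assms by simp

lemma cmp_dif: assumes "f \<in> Arr C" "g \<in> Arr C" "Dom C g = Dom C f" "Cod C g = Cod C f" "h \<in> Arr C" "Dom C h = Cod C f"
  shows "h \<cdot> dif f g = dif (h \<cdot> f) (h \<cdot> g)"
  using assms dif_iff[of "h \<cdot> f" "h \<cdot> g" "h \<cdot> dif f g"] cmp_add_right[of "dif f g" "Dom C f" "Cod C f" g h "Cod C h"]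
  by (simp add: dif_add)

lemma dif_cmp: assumes "f \<in> Arr C" "g \<in> Arr C" "Dom C g = Dom C f" "Cod C g = Cod C f" "h \<in> Arr C" "Cod C h = Dom C f"
  shows "dif f g \<cdot> h = dif (f \<cdot> h) (g \<cdot> h)"
  using assms dif_iff[of "f \<cdot> h" "g \<cdot> h" "dif f g \<cdot> h"] cmp_add_left[of h "Dom C h" "Dom C f" "dif f g" "Cod C f" g]
  by (simp add: dif_add)

lemma dif_zero_iff: assumes "f \<in> Arr C" "g \<in> Arr C" "Dom C g = Dom C f" "Cod C g = Cod C f"
  shows "dif f g = Zer C (Dom C f) (Cod C f) \<longleftrightarrow> f = g"
  using dif_iff[of f g "Zer C (Dom C f) (Cod C f)"] assms by (auto simp: add_zer_left)

lemma dif_zer: "f \<in> Arr C \<Longrightarrow> X = Dom C f \<Longrightarrow> Y = Cod C f \<Longrightarrow> dif f (Zer C X Y) = f"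
proof -
  assume f: "f \<in> Arr C" "X = Dom C f" "Y = Cod C f"
  then interpret G: comm_group "hom_group C (Dom C f) (Cod C f)" using hom_comm_group by simp
  have "Add C f (Zer C X Y) = f" using G.r_one[of f] f by (simp add: hom_group_def)
  then show ?thesis using dif_iff[of f "Zer C X Y" f] f by simp
qed

text \<open>\<open>f \<cdot> x = g \<cdot> x\<close> says that the difference annihilates
  \<open>x\<close>. All equalizers needed below are obtained in this way, since the axioms grant
  kernels.\<close>

lemma kernel_dif_iff: assumes fg: "f \<in> Arr C" "g \<in> Arr C" "Dom C g = Dom C f" "Cod C g = Cod C f"
  shows "is_kernel C e (dif f g) \<longleftrightarrow> is_equalizer C e f g"
proof -
  have *: "dif f g \<cdot> x = Zer C (Dom C x) (Cod C f) \<longleftrightarrow> f \<cdot> x = g \<cdot> x" if "x \<in> Arr C" "Cod C x = Dom C f" for x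
    using fg that dif_cmp[of f g x] dif_zero_iff[of "f \<cdot> x" "g \<cdot> x"] by simp
  show ?thesis
  proof
    assume k: "is_kernel C e (dif f g)"
    show "is_equalizer C e f g"
      by (rule equalizerI) (use fg kernelD[OF k] kernel_zero[OF k] kernel_ex1[OF k] * in simp_all)
  next
    assume k: "is_equalizer C e f g"
    show "is_kernel C e (dif f g)"
      by (rule kernelI) (use fg equalizerD[OF k] equalizer_ex1[OF k] * in simp_all)
  qed
qed

section \<open>Normal monos and epis, image factorization\<close>

lemma mono_zeroI: assumes "f \<in> Arr C"
    "\<And>x. x \<in> Arr C \<Longrightarrow> Cod C x = Dom C f \<Longrightarrow> f \<cdot> x = Zer C (Dom C x) (Cod C f) \<Longrightarrow> x = Zer C (Dom C x) (Cod C x)"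
  shows "is_mono C f"
proof (rule monoI, goal_cases)
  case (2 g h)
  have "f \<cdot> dif g h = Zer C (Dom C g) (Cod C f)"
    using 2 assms(1) by (simp add: cmp_dif dif_zero_iff[THEN iffD2, of "f \<cdot> h" "f \<cdot> h", simplified])
  then have "dif g h = Zer C (Dom C g) (Cod C g)" using assms(2)[of "dif g h"] 2 by simp
  with 2 dif_zero_iff[of g h] show ?case by simp
qed (use assms in auto)

text \<open>\<open>i\<close> is a kernel of some \<open>g\<close>. As \<open>g\<close> annihilates
  \<open>i\<close>, it factors through the cokernel \<open>p\<close>; so whatever \<open>p\<close>
  annihilates is annihilated by \<open>g\<close> and lifts along \<open>i\<close>.\<close>

lemma mono_kernel_of_cokernel: assumes "is_mono C i" "is_cokernel C p i"
  shows "is_kernel C i p"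
proof -
  obtain g where g: "is_kernel C i g" using mono_normal assms by auto
  note [simp] = kernelD(1-3)[OF g] cokernelD(1-3)[OF assms(2)]
  obtain g' where g' [simp]: "g' \<in> Arr C" "Dom C g' = Cod C p" "Cod C g' = Cod C g" and g'p: "g' \<cdot> p = g"
    using kernel_zero[OF g] cokernel_factor[OF assms(2), of g] by auto
  show ?thesis
  proof (rule kernelI)
    fix x assume x [simp]: "x \<in> Arr C" "Cod C x = Dom C p" and 0: "p \<cdot> x = Zer C (Dom C x) (Cod C p)"
    have "g \<cdot> x = g' \<cdot> p \<cdot> x" unfolding g'p[symmetric] by simp
    also have "\<dots> = Zer C (Dom C x) (Cod C g)" by (simp add: 0)
    finally show "\<exists>!y. y \<in> Hom C (Dom C x) (Dom C i) \<and> i \<cdot> y = x"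
      by (intro kernel_ex1[OF g]) simp_all
  qed (simp_all add: cokernel_zero[OF assms(2)])
qed

lemma epi_cokernel_of_kernel: assumes "is_epi C p" "is_kernel C i p"
  shows "is_cokernel C p i"
proof -
  obtain g where g: "is_cokernel C p g" using epi_normal assms by auto
  note [simp] = cokernelD(2)[OF g] cokernelD(1)[OF g] kernelD(1-3)[OF assms(2)]
  have [simp]: "Cod C g = Dom C p" using cokernelD(3)[OF g] by simp
  obtain g' where g' [simp]: "g' \<in> Arr C" "Cod C g' = Dom C i" "Dom C g' = Dom C g" and ig': "i \<cdot> g' = g"
    using cokernel_zero[OF g] kernel_factor[OF assms(2), of g] by auto
  show ?thesis
  proof (rule cokernelI)
    fix x assume x [simp]: "x \<in> Arr C" "Dom C x = Cod C i" and 0: "x \<cdot> i = Zer C (Dom C i) (Cod C x)"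
    have "x \<cdot> g = (x \<cdot> i) \<cdot> g'" unfolding ig'[symmetric] by simp
    also have "\<dots> = Zer C (Dom C g) (Cod C x)" unfolding 0 by simp
    finally show "\<exists>!y. y \<in> Hom C (Cod C p) (Cod C x) \<and> y \<cdot> p = x"
      by (intro cokernel_ex1[OF g]) simp_all
  qed (simp_all add: kernel_zero[OF assms(2)])
qed

text \<open>That \<open>i\<close> is mono is the content. Let \<open>i\<close> annihilate
  \<open>x\<close>, and let \<open>c\<close> be the cokernel of \<open>x\<close>. The epi
  \<open>c \<cdot> \<pi>\<close> is a cokernel of some \<open>g\<close>. Then \<open>f\<close>
  annihilates \<open>g\<close>, so \<open>g\<close> factors through \<open>k\<close>, so
  \<open>\<pi>\<close> annihilates \<open>g\<close> and factors through
  \<open>c \<cdot> \<pi>\<close>. Hence \<open>c\<close> has a retraction \<open>s\<close>, and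
  \<open>x = s \<cdot> c \<cdot> x\<close> is zero.\<close>

lemma mono_epi_factorization:
  assumes k: "is_kernel C k f" and q: "is_cokernel C \<pi> k"
  obtains i where "is_mono C i" "Dom C i = Cod C \<pi>" "Cod C i = Cod C f" "i \<cdot> \<pi> = f"
proof -
  note [simp] = kernelD(1-3)[OF k] cokernelD(1-3)[OF q]
  obtain i where i [simp]: "i \<in> Arr C" "Dom C i = Cod C \<pi>" "Cod C i = Cod C f" and f: "i \<cdot> \<pi> = f"
    using kernel_zero[OF k] cokernel_factor[OF q, of f] by auto
  have "is_mono C i"
  proof (rule mono_zeroI)
    fix x assume x [simp]: "x \<in> Arr C" "Cod C x = Dom C i" and 0: "i \<cdot> x = Zer C (Dom C x) (Cod C i)"
    obtain c where c: "is_cokernel C c x" using ex_cokernel[of x] x by blast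
    note [simp] = cokernelD(1-3)[OF c]
    obtain i' where i' [simp]: "i' \<in> Arr C" "Dom C i' = Cod C c" "Cod C i' = Cod C i" and i'c: "i' \<cdot> c = i"
      using 0 cokernel_factor[OF c, of i] by auto
    have "is_epi C (c \<cdot> \<pi>)" by (intro epi_comp cokernel_epi[OF q] cokernel_epi[OF c]) simp
    then obtain g where g: "is_cokernel C (c \<cdot> \<pi>) g" using epi_normal by auto
    note [simp] = cokernelD(1)[OF g] and cg = cokernelD(3)[OF g]
    have [simp]: "Cod C g = Dom C f" using cg by simp
    have "f \<cdot> g = (i \<cdot> \<pi>) \<cdot> g" unfolding f ..
    also have "\<dots> = i' \<cdot> (c \<cdot> \<pi>) \<cdot> g" unfolding i'c[symmetric] by simp
    also have "\<dots> = Zer C (Dom C g) (Cod C f)" by (simp only: cokernel_zero[OF g]) simp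
    finally obtain g' where [simp]: "g' \<in> Arr C" "Cod C g' = Dom C k" "Dom C g' = Dom C g" and g': "k \<cdot> g' = g"
      using kernel_factor[OF k, of g] by auto
    have "\<pi> \<cdot> g = (\<pi> \<cdot> k) \<cdot> g'" unfolding g'[symmetric] by simp
    also have "\<dots> = Zer C (Dom C g) (Cod C \<pi>)" by (simp only: cokernel_zero[OF q]) simp
    finally obtain s where [simp]: "s \<in> Arr C" "Dom C s = Cod C c" "Cod C s = Cod C \<pi>" and s: "s \<cdot> (c \<cdot> \<pi>) = \<pi>"
      using cokernel_factor[OF g, of \<pi>] by auto
    have "(s \<cdot> c) \<cdot> \<pi> = Idn C (Cod C \<pi>) \<cdot> \<pi>" using s by simp
    then have sc: "s \<cdot> c = Idn C (Cod C \<pi>)" using epi_cancel[OF cokernel_epi[OF q], of "s \<cdot> c" "Idn C (Cod C \<pi>)"] by auto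
    have "x = (s \<cdot> c) \<cdot> x" by (simp only: sc) simp
    also have "\<dots> = s \<cdot> c \<cdot> x" by simp
    finally show "x = Zer C (Dom C x) (Cod C x)" by (simp add: cokernel_zero[OF c])
  qed simp
  with that f show ?thesis by auto
qed

lemma kernel_cmp_mono: assumes "is_kernel C k p" "is_mono C i" "Dom C i = Cod C p"
  shows "is_kernel C k (i \<cdot> p)"
proof (rule kernelI)
  note [simp] = kernelD(1-3)[OF assms(1)] mono_arr[OF assms(2)] assms(3)
  show "(i \<cdot> p) \<cdot> k = Zer C (Dom C k) (Cod C (i \<cdot> p))" by (simp add: kernel_zero[OF assms(1)])
  fix x assume [simp]: "x \<in> Arr C" "Cod C x = Dom C (i \<cdot> p)" and "(i \<cdot> p) \<cdot> x = Zer C (Dom C x) (Cod C (i \<cdot> p))"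
  then have "p \<cdot> x = Zer C (Dom C x) (Cod C p)"
    using mono_cancel[OF assms(2), of "p \<cdot> x" "Zer C (Dom C x) (Cod C p)"] by simp
  then show "\<exists>!y. y \<in> Hom C (Dom C x) (Dom C k) \<and> k \<cdot> y = x"
    by (intro kernel_ex1[OF assms(1)]) simp_all
qed (use assms kernelD(1-3)[OF assms(1)] in simp_all)

text \<open>\<open>p\<close> is the cokernel of its kernel \<open>g\<close>, and \<open>a\<close>
  annihilates \<open>g\<close> because \<open>m\<close> cancels. Such diagonals produce the
  multiplication, the antipode and the coideal structure on the image of a Hopf monoid
  morphism.\<close>

lemma diagonal_fill_in:
  assumes p: "is_epi C p" and m: "is_mono C m" and sq: "m \<cdot> a = b \<cdot> p"
    and a: "a \<in> Arr C" "Dom C a = Dom C p" "Cod C a = Dom C m" and b: "b \<in> Arr C" "Dom C b = Cod C p" "Cod C b = Cod C m"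
  obtains d where "d \<in> Arr C" "Dom C d = Cod C p" "Cod C d = Dom C m" "d \<cdot> p = a" "m \<cdot> d = b"
proof -
  note [simp] = epi_arr[OF p] mono_arr[OF m] a b
  obtain g where g: "is_kernel C g p" using ex_kernel epi_arr[OF p] by blast
  note c = epi_cokernel_of_kernel[OF p g]
  note [simp] = kernelD(2,3)[OF g]
  have "m \<cdot> a \<cdot> g = (m \<cdot> a) \<cdot> g" by simp
  also have "\<dots> = b \<cdot> (p \<cdot> g)" unfolding sq by simp
  also have "\<dots> = m \<cdot> Zer C (Dom C g) (Dom C m)" unfolding kernel_zero[OF g] by simp
  finally have "a \<cdot> g = Zer C (Dom C g) (Dom C m)"
    using mono_cancel[OF m, of "a \<cdot> g" "Zer C (Dom C g) (Dom C m)"] by simp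
  then obtain d where d: "d \<in> Arr C" "Dom C d = Cod C p" "Cod C d = Dom C m" and dp: "d \<cdot> p = a"
    using cokernel_factor[OF c, of a] by auto
  have "(m \<cdot> d) \<cdot> p = m \<cdot> (d \<cdot> p)" using d by simp
  also have "\<dots> = b \<cdot> p" unfolding dp by (rule sq)
  finally have "m \<cdot> d = b" using epi_cancel[OF p, of "m \<cdot> d" b] d by simp
  with d dp show thesis by (intro that)
qed

end

context abelian_smc
begin

abbreviation \<open>idn \<equiv> Idn M\<close>
abbreviation \<open>asc \<equiv> Asc M\<close>
abbreviation \<open>asci X Y Z \<equiv> inv_arr M (Asc M X Y Z)\<close>
abbreviation \<open>swp \<equiv> Sym M\<close>
abbreviation \<open>lun \<equiv> LUn M\<close>
abbreviation \<open>run \<equiv> RUn M\<close>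
abbreviation \<open>I \<equiv> Unt M\<close>

section \<open>Functoriality of the tensor product and naturality of the constraints\<close>

lemma ten_arr [simp]: assumes "f \<in> Arr M" "g \<in> Arr M"
  shows "f \<odot> g \<in> Arr M" "Dom M (f \<odot> g) = Dom M f \<boxtimes> Dom M g" "Cod M (f \<odot> g) = Cod M f \<boxtimes> Cod M g"
  using ten_hom[of f "Dom M f" "Cod M f" g "Dom M g" "Cod M g"] assms by auto

declare ten_ob [simp] unt_ob [simp] ten_id [simp] asc_iso [simp] lun_iso [simp] run_iso [simp]

lemma asc_arr [simp]: assumes "X \<in> Ob M" "Y \<in> Ob M" "Z \<in> Ob M"
  shows "asc X Y Z \<in> Arr M" "Dom M (asc X Y Z) = (X \<boxtimes> Y) \<boxtimes> Z" "Cod M (asc X Y Z) = X \<boxtimes> Y \<boxtimes> Z"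
  using asc_hom[OF assms] by auto

lemma sym_arr [simp]: assumes "X \<in> Ob M" "Y \<in> Ob M"
  shows "swp X Y \<in> Arr M" "Dom M (swp X Y) = X \<boxtimes> Y" "Cod M (swp X Y) = Y \<boxtimes> X"
  using sym_hom[OF assms] by auto

lemma lun_arr [simp]: assumes "X \<in> Ob M"
  shows "lun X \<in> Arr M" "Dom M (lun X) = I \<boxtimes> X" "Cod M (lun X) = X"
  using lun_hom[OF assms] by auto

lemma run_arr [simp]: assumes "X \<in> Ob M"
  shows "run X \<in> Arr M" "Dom M (run X) = X \<boxtimes> I" "Cod M (run X) = X"
  using run_hom[OF assms] by auto

text \<open>Simp normal form: adjacent tensors of arrows fuse into one. Constraints such as
  \<open>asc\<close> remain as barriers in between and are moved past tensors by explicit naturality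
  steps.\<close>

lemma ten_cmp' [simp]:
  "f \<in> Arr M \<Longrightarrow> f' \<in> Arr M \<Longrightarrow> g \<in> Arr M \<Longrightarrow> g' \<in> Arr M \<Longrightarrow> Cod M f = Dom M f' \<Longrightarrow> Cod M g = Dom M g' \<Longrightarrow>
    (f' \<odot> g') \<cdot> (f \<odot> g) = (f' \<cdot> f) \<odot> (g' \<cdot> g)"
  using ten_cmp[of f "Dom M f" "Cod M f" f' "Cod M f'" g "Dom M g" "Cod M g" g' "Cod M g'"] by simp

lemma ten_cmp_ext [simp]:
  "f \<in> Arr M \<Longrightarrow> f' \<in> Arr M \<Longrightarrow> g \<in> Arr M \<Longrightarrow> g' \<in> Arr M \<Longrightarrow> Cod M f = Dom M f' \<Longrightarrow> Cod M g = Dom M g' \<Longrightarrow>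
    r \<in> Arr M \<Longrightarrow> Cod M r = Dom M f \<boxtimes> Dom M g \<Longrightarrow>
    (f' \<odot> g') \<cdot> (f \<odot> g) \<cdot> r = ((f' \<cdot> f) \<odot> (g' \<cdot> g)) \<cdot> r"
  by (rule cmp_ext) simp_all

lemma asc_nat': "f \<in> Arr M \<Longrightarrow> g \<in> Arr M \<Longrightarrow> h \<in> Arr M \<Longrightarrow> Cod M f = X \<Longrightarrow> Cod M g = Y \<Longrightarrow> Cod M h = Z \<Longrightarrow>
    asc X Y Z \<cdot> ((f \<odot> g) \<odot> h) = (f \<odot> g \<odot> h) \<cdot> asc (Dom M f) (Dom M g) (Dom M h)"
  using asc_nat[of f "Dom M f" X g "Dom M g" Y h "Dom M h" Z] by simp

lemma asc_nat_ext: "f \<in> Arr M \<Longrightarrow> g \<in> Arr M \<Longrightarrow> h \<in> Arr M \<Longrightarrow> Cod M f = X \<Longrightarrow> Cod M g = Y \<Longrightarrow> Cod M h = Z \<Longrightarrow>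
    r \<in> Arr M \<Longrightarrow> Cod M r = (Dom M f \<boxtimes> Dom M g) \<boxtimes> Dom M h \<Longrightarrow>
    asc X Y Z \<cdot> ((f \<odot> g) \<odot> h) \<cdot> r = (f \<odot> g \<odot> h) \<cdot> asc (Dom M f) (Dom M g) (Dom M h) \<cdot> r"
  by (rule cmp_ext2[OF asc_nat']) auto

lemma inv_square: assumes "v \<cdot> f = g \<cdot> u" "is_iso M u" "is_iso M v" "f \<in> Arr M" "g \<in> Arr M"
    "Dom M f = Dom M u" "Dom M g = Cod M u" "Cod M f = Dom M v" "Cod M g = Cod M v"
  shows "inv_arr M v \<cdot> g = f \<cdot> inv_arr M u"
proof -
  note [simp] = assms(2-9) iso_arr[OF assms(2)] iso_arr[OF assms(3)]
  have "inv_arr M v \<cdot> g = inv_arr M v \<cdot> (g \<cdot> u) \<cdot> inv_arr M u" by simp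
  also have "\<dots> = f \<cdot> inv_arr M u" unfolding assms(1)[symmetric] by simp
  finally show ?thesis .
qed

lemma asci_nat: "f \<in> Arr M \<Longrightarrow> g \<in> Arr M \<Longrightarrow> h \<in> Arr M \<Longrightarrow> Cod M f = X \<Longrightarrow> Cod M g = Y \<Longrightarrow> Cod M h = Z \<Longrightarrow>
    asci X Y Z \<cdot> (f \<odot> g \<odot> h) = ((f \<odot> g) \<odot> h) \<cdot> asci (Dom M f) (Dom M g) (Dom M h)"
  by (rule inv_square[OF asc_nat']) auto

lemma lun_nat': "f \<in> Arr M \<Longrightarrow> Cod M f = X \<Longrightarrow> lun X \<cdot> (idn I \<odot> f) = f \<cdot> lun (Dom M f)"
  using lun_nat[of f "Dom M f" X] by simp

lemma run_nat': "f \<in> Arr M \<Longrightarrow> Cod M f = X \<Longrightarrow> run X \<cdot> (f \<odot> idn I) = f \<cdot> run (Dom M f)"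
  using run_nat[of f "Dom M f" X] by simp

lemma sym_nat': "f \<in> Arr M \<Longrightarrow> g \<in> Arr M \<Longrightarrow> Cod M f = X \<Longrightarrow> Cod M g = Y \<Longrightarrow>
    swp X Y \<cdot> (f \<odot> g) = (g \<odot> f) \<cdot> swp (Dom M f) (Dom M g)"
  using sym_nat[of f "Dom M f" X g "Dom M g" Y] by simp

lemma sym_inverse: "X \<in> Ob M \<Longrightarrow> Y \<in> Ob M \<Longrightarrow> are_inverse M (swp X Y) (swp Y X)"
  by (simp add: are_inverse_def sym_sym)

lemma sym_iso [simp]: "X \<in> Ob M \<Longrightarrow> Y \<in> Ob M \<Longrightarrow> is_iso M (swp X Y)"
  using are_inverse_isoI sym_inverse by blast

lemma ten_iso: assumes "is_iso M f" "is_iso M g"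
  shows "are_inverse M (f \<odot> g) (inv_arr M f \<odot> inv_arr M g)" "is_iso M (f \<odot> g)"
proof -
  show "are_inverse M (f \<odot> g) (inv_arr M f \<odot> inv_arr M g)"
    using assms iso_arr[of f] iso_arr[of g] by (simp add: are_inverse_def)
  then show "is_iso M (f \<odot> g)" by (rule are_inverse_isoI)
qed

lemma id_iso [simp]: "X \<in> Ob M \<Longrightarrow> is_iso M (idn X)"
  by (rule are_inverse_isoI[of _ "idn X"]) (simp add: are_inverse_def)

declare ten_iso(2) [simp] iso_comp [simp]

lemma iso_cancel_right: assumes "g \<cdot> u = h \<cdot> u" "is_iso M u" "g \<in> Arr M" "h \<in> Arr M"
    "Dom M g = Cod M u" "Dom M h = Cod M u" "Cod M g = Cod M h" shows "g = h"
  by (rule epi_cancel[OF iso_epi assms(1)]) (use assms in auto)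

lemma iso_cancel_left: assumes "u \<cdot> g = u \<cdot> h" "is_iso M u" "g \<in> Arr M" "h \<in> Arr M"
    "Cod M g = Dom M u" "Cod M h = Dom M u" "Dom M g = Dom M h" shows "g = h"
  by (rule mono_cancel[OF iso_mono assms(1)]) (use assms in auto)

text \<open>\<open>lun\<close> is a natural isomorphism from tensoring with \<open>I\<close> to the
  identity functor. An identity about units may therefore be proved after tensoring with
  \<open>I\<close>, where pentagon and triangle apply.\<close>

lemma ten_unit_left_faithful: assumes "idn I \<odot> f = idn I \<odot> g" "f \<in> Arr M" "g \<in> Arr M"
    "Dom M f = Dom M g" "Cod M f = Cod M g"
  shows "f = g"
proof (rule iso_cancel_right[of _ "lun (Dom M f)"])
  have "f \<cdot> lun (Dom M f) = lun (Cod M f) \<cdot> (idn I \<odot> f)" using assms(2-) by (simp add: lun_nat')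
  also have "\<dots> = g \<cdot> lun (Dom M f)" unfolding assms(1) using assms(2-) by (simp add: lun_nat')
  finally show "f \<cdot> lun (Dom M f) = g \<cdot> lun (Dom M f)" .
qed (use assms in auto)

lemma ten_unit_right_faithful: assumes "f \<odot> idn I = g \<odot> idn I" "f \<in> Arr M" "g \<in> Arr M"
    "Dom M f = Dom M g" "Cod M f = Cod M g"
  shows "f = g"
proof (rule iso_cancel_right[of _ "run (Dom M f)"])
  have "f \<cdot> run (Dom M f) = run (Cod M f) \<cdot> (f \<odot> idn I)" using assms(2-) by (simp add: run_nat')
  also have "\<dots> = g \<cdot> run (Dom M f)" unfolding assms(1) using assms(2-) by (simp add: run_nat')
  finally show "f \<cdot> run (Dom M f) = g \<cdot> run (Dom M f)" .
qed (use assms in auto)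

subsection \<open>Kelly's unit coherences\<close>

text \<open>Tensored with \<open>I\<close> and precomposed with an isomorphism, the identity becomes
  the boundary of the pentagon for \<open>I\<close>, \<open>I\<close>, \<open>X\<close>,
  \<open>Y\<close>, filled by two triangles and naturality of \<open>asc\<close>.\<close>

lemma lun_asc: assumes [simp]: "X \<in> Ob M" "Y \<in> Ob M"
  shows "lun (X \<boxtimes> Y) \<cdot> asc I X Y = lun X \<odot> idn Y"
proof (rule ten_unit_left_faithful)
  have "(idn I \<odot> (lun (X \<boxtimes> Y) \<cdot> asc I X Y)) \<cdot> (asc I (I \<boxtimes> X) Y \<cdot> (asc I I X \<odot> idn Y))
      = (idn I \<odot> lun (X \<boxtimes> Y)) \<cdot> ((idn I \<odot> asc I X Y) \<cdot> asc I (I \<boxtimes> X) Y \<cdot> (asc I I X \<odot> idn Y))"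
    by simp
  also have "\<dots> = ((idn I \<odot> lun (X \<boxtimes> Y)) \<cdot> asc I I (X \<boxtimes> Y)) \<cdot> asc (I \<boxtimes> I) X Y"
    unfolding pentagon[of I I X Y, OF unt_ob unt_ob assms, symmetric] by simp
  also have "\<dots> = (run I \<odot> (idn X \<odot> idn Y)) \<cdot> asc (I \<boxtimes> I) X Y"
    unfolding triangle[of I "X \<boxtimes> Y", OF unt_ob ten_ob[OF assms]] by simp
  also have "\<dots> = asc I X Y \<cdot> ((run I \<odot> idn X) \<odot> idn Y)"
    by (subst asc_nat') simp_all
  also have "\<dots> = asc I X Y \<cdot> (((idn I \<odot> lun X) \<cdot> asc I I X) \<odot> idn Y)"
    by (simp add: triangle)
  also have "\<dots> = asc I X Y \<cdot> ((idn I \<odot> lun X) \<odot> idn Y) \<cdot> (asc I I X \<odot> idn Y)"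
    by simp
  also have "\<dots> = (idn I \<odot> lun X \<odot> idn Y) \<cdot> (asc I (I \<boxtimes> X) Y \<cdot> (asc I I X \<odot> idn Y))"
    by (subst asc_nat_ext) simp_all
  finally show "idn I \<odot> (lun (X \<boxtimes> Y) \<cdot> asc I X Y) = idn I \<odot> (lun X \<odot> idn Y)"
    by (rule iso_cancel_right) simp_all
qed simp_all

text \<open>Naturality of \<open>lun\<close> at \<open>lun I\<close> itself identifies
  \<open>idn I \<odot> lun I\<close> with \<open>lun (I \<boxtimes> I)\<close>;
  \<open>lun_asc\<close> and the triangle then compare the two constraints after tensoring with
  \<open>I\<close>.\<close>

lemma lun_unit_run_unit: "lun I = run I"
proof (rule ten_unit_right_faithful)
  have "lun I \<cdot> (idn I \<odot> lun I) = lun I \<cdot> lun (I \<boxtimes> I)" by (simp add: lun_nat')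
  then have "idn I \<odot> lun I = lun (I \<boxtimes> I)" by (rule iso_cancel_left) simp_all
  then show "lun I \<odot> idn I = run I \<odot> idn I" using lun_asc[of I I] triangle[of I I] by simp
qed simp_all

text \<open>The hexagon for \<open>X\<close>, \<open>I\<close>, \<open>I\<close>, followed by a left
  unit constraint. With \<open>lun_asc\<close>, naturality of the symmetry and the triangle both
  sides end in \<open>swp X I\<close>, which cancels.\<close>

lemma lun_sym: assumes [simp]: "X \<in> Ob M" shows "lun X \<cdot> swp X I = run X"
proof (rule ten_unit_right_faithful)
  have "swp X I \<cdot> ((lun X \<cdot> swp X I) \<odot> idn I) = lun (I \<boxtimes> X) \<cdot> (idn I \<odot> swp X I) \<cdot> asc I X I \<cdot> (swp X I \<odot> idn I)"
  proof -
    have "lun (I \<boxtimes> X) \<cdot> (idn I \<odot> swp X I) \<cdot> asc I X I \<cdot> (swp X I \<odot> idn I)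
      = (lun (I \<boxtimes> X) \<cdot> (idn I \<odot> swp X I)) \<cdot> asc I X I \<cdot> (swp X I \<odot> idn I)" by simp
    also have "\<dots> = swp X I \<cdot> (lun (X \<boxtimes> I) \<cdot> asc I X I) \<cdot> (swp X I \<odot> idn I)"
      by (subst lun_nat') simp_all
    also have "\<dots> = swp X I \<cdot> ((lun X \<cdot> swp X I) \<odot> idn I)" by (simp add: lun_asc)
    finally show ?thesis by simp
  qed
  also have "\<dots> = lun (I \<boxtimes> X) \<cdot> asc I I X \<cdot> swp X (I \<boxtimes> I) \<cdot> asc X I I"
    by (simp add: hexagon)
  also have "\<dots> = (lun (I \<boxtimes> X) \<cdot> asc I I X) \<cdot> swp X (I \<boxtimes> I) \<cdot> asc X I I" by simp
  also have "\<dots> = (lun I \<odot> idn X) \<cdot> swp X (I \<boxtimes> I) \<cdot> asc X I I" by (simp add: lun_asc)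
  also have "\<dots> = swp X I \<cdot> (idn X \<odot> lun I) \<cdot> asc X I I"
    using sym_nat'[of "idn X" "lun I" X I] by (intro cmp_ext2[symmetric]) simp_all
  also have "\<dots> = swp X I \<cdot> (run X \<odot> idn I)" by (simp add: triangle)
  finally show "(lun X \<cdot> swp X I) \<odot> idn I = run X \<odot> idn I" by (rule iso_cancel_left) simp_all
qed simp_all

lemma run_sym: "X \<in> Ob M \<Longrightarrow> run X \<cdot> swp I X = lun X"
  using lun_sym[of X] by (simp flip: lun_sym add: sym_sym)

lemma sym_unit: "swp I I = idn (I \<boxtimes> I)"
proof (rule iso_cancel_left[of "lun I"])
  show "lun I \<cdot> swp I I = lun I \<cdot> idn (I \<boxtimes> I)" using lun_sym[of I] by (simp add: lun_unit_run_unit)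
qed simp_all

subsection \<open>Exchanging neighbours in right-nested tensor products\<close>

text \<open>Exchanges the two leading factors of a right-nested product. Up to associativity
  \<open>mid_swap\<close> is an identity tensored with \<open>tau\<close>, so its coherence reduces
  to a few laws of \<open>tau\<close>.\<close>

definition tau :: "'o \<Rightarrow> 'o \<Rightarrow> 'o \<Rightarrow> 'm" where
  "tau X Y Z = asc Y X Z \<cdot> (swp X Y \<odot> idn Z) \<cdot> asci X Y Z"

lemma tau_hom [simp]: assumes "X \<in> Ob M" "Y \<in> Ob M" "Z \<in> Ob M"
  shows "tau X Y Z \<in> Arr M" "Dom M (tau X Y Z) = X \<boxtimes> Y \<boxtimes> Z" "Cod M (tau X Y Z) = Y \<boxtimes> X \<boxtimes> Z"
  using assms by (simp_all add: tau_def)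

lemma tau_asc: "X \<in> Ob M \<Longrightarrow> Y \<in> Ob M \<Longrightarrow> Z \<in> Ob M \<Longrightarrow>
    tau X Y Z \<cdot> asc X Y Z = asc Y X Z \<cdot> (swp X Y \<odot> idn Z)"
  by (simp add: tau_def)

lemma tau_tau: "X \<in> Ob M \<Longrightarrow> Y \<in> Ob M \<Longrightarrow> Z \<in> Ob M \<Longrightarrow> tau Y X Z \<cdot> tau X Y Z = idn (X \<boxtimes> Y \<boxtimes> Z)"
  by (simp add: tau_def sym_sym)

lemma tau_inverse: "X \<in> Ob M \<Longrightarrow> Y \<in> Ob M \<Longrightarrow> Z \<in> Ob M \<Longrightarrow> are_inverse M (tau X Y Z) (tau Y X Z)"
  by (simp add: are_inverse_def tau_tau)

lemma tau_iso [simp]: "X \<in> Ob M \<Longrightarrow> Y \<in> Ob M \<Longrightarrow> Z \<in> Ob M \<Longrightarrow> is_iso M (tau X Y Z)"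
  using are_inverse_isoI tau_inverse by blast

lemma tau_nat: assumes [simp]: "f \<in> Arr M" "g \<in> Arr M" "h \<in> Arr M" "Cod M f = X" "Cod M g = Y" "Cod M h = Z"
  shows "tau X Y Z \<cdot> (f \<odot> g \<odot> h) = (g \<odot> f \<odot> h) \<cdot> tau (Dom M f) (Dom M g) (Dom M h)"
proof -
  have [simp]: "X \<in> Ob M" "Y \<in> Ob M" "Z \<in> Ob M" using assms cod_ob by blast+
  have "tau X Y Z \<cdot> (f \<odot> g \<odot> h) = asc Y X Z \<cdot> (swp X Y \<odot> idn Z) \<cdot> (asci X Y Z \<cdot> (f \<odot> g \<odot> h))"
    by (simp add: tau_def)
  also have "\<dots> = asc Y X Z \<cdot> ((swp X Y \<cdot> (f \<odot> g)) \<odot> h) \<cdot> asci (Dom M f) (Dom M g) (Dom M h)"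
    by (subst asci_nat) simp_all
  also have "\<dots> = asc Y X Z \<cdot> ((g \<odot> f) \<odot> h) \<cdot> (swp (Dom M f) (Dom M g) \<odot> idn (Dom M h)) \<cdot> asci (Dom M f) (Dom M g) (Dom M h)"
    by (simp add: sym_nat')
  also have "\<dots> = (g \<odot> f \<odot> h) \<cdot> tau (Dom M f) (Dom M g) (Dom M h)"
    by (subst asc_nat_ext) (simp_all add: tau_def)
  finally show ?thesis .
qed

lemma asc_nat_id: "w \<in> Arr M \<Longrightarrow> Cod M w = Z \<Longrightarrow> X \<in> Ob M \<Longrightarrow> Y \<in> Ob M \<Longrightarrow>
    asc X Y Z \<cdot> (idn (X \<boxtimes> Y) \<odot> w) = (idn X \<odot> idn Y \<odot> w) \<cdot> asc X Y (Dom M w)"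
  using asc_nat'[of "idn X" "idn Y" w X Y Z] by simp

text \<open>Both sides move \<open>X\<close> past \<open>B\<close> and \<open>C\<close>, at once or
  one after the other. Precomposing with the isomorphism \<open>?P\<close> from the left-nested
  product turns this into the hexagon glued to pentagons.\<close>

lemma tau_hexagon: assumes [simp]: "X \<in> Ob M" "B \<in> Ob M" "C \<in> Ob M" "Z \<in> Ob M"
  shows "asc B C (X \<boxtimes> Z) \<cdot> tau X (B \<boxtimes> C) Z =
    (idn B \<odot> tau X C Z) \<cdot> tau X B (C \<boxtimes> Z) \<cdot> (idn X \<odot> asc B C Z)"
proof (rule iso_cancel_right)
  let ?n = "(idn B \<odot> (asc C X Z \<cdot> (swp X C \<odot> idn Z))) \<cdot> asc B (X \<boxtimes> C) Z \<cdot> ((asc B X C \<cdot> (swp X B \<odot> idn C)) \<odot> idn Z)"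
  let ?P = "asc X (B \<boxtimes> C) Z \<cdot> (asc X B C \<odot> idn Z)"
  have "(asc B C (X \<boxtimes> Z) \<cdot> tau X (B \<boxtimes> C) Z) \<cdot> ?P
      = (asc B C (X \<boxtimes> Z) \<cdot> asc (B \<boxtimes> C) X Z) \<cdot> ((swp X (B \<boxtimes> C) \<cdot> asc X B C) \<odot> idn Z)"
    by (simp add: tau_def)
  also have "\<dots> = (idn B \<odot> asc C X Z) \<cdot> asc B (C \<boxtimes> X) Z \<cdot> ((asc B C X \<cdot> swp X (B \<boxtimes> C) \<cdot> asc X B C) \<odot> idn Z)"
    by (subst pentagon) simp_all
  also have "\<dots> = (idn B \<odot> asc C X Z) \<cdot> asc B (C \<boxtimes> X) Z \<cdot> ((idn B \<odot> swp X C) \<odot> idn Z) \<cdot> ((asc B X C \<cdot> (swp X B \<odot> idn C)) \<odot> idn Z)"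
    by (subst hexagon) simp_all
  also have "\<dots> = ?n"
    by (subst asc_nat_ext) simp_all
  finally have 1: "(asc B C (X \<boxtimes> Z) \<cdot> tau X (B \<boxtimes> C) Z) \<cdot> ?P = ?n" .
  have "((idn B \<odot> tau X C Z) \<cdot> tau X B (C \<boxtimes> Z) \<cdot> (idn X \<odot> asc B C Z)) \<cdot> ?P
      = (idn B \<odot> tau X C Z) \<cdot> tau X B (C \<boxtimes> Z) \<cdot> ((idn X \<odot> asc B C Z) \<cdot> asc X (B \<boxtimes> C) Z \<cdot> (asc X B C \<odot> idn Z))"
    by simp
  also have "\<dots> = (idn B \<odot> tau X C Z) \<cdot> tau X B (C \<boxtimes> Z) \<cdot> asc X B (C \<boxtimes> Z) \<cdot> asc (X \<boxtimes> B) C Z"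
    by (subst pentagon[symmetric]) simp_all
  also have "\<dots> = (idn B \<odot> tau X C Z) \<cdot> asc B X (C \<boxtimes> Z) \<cdot> ((swp X B \<odot> (idn C \<odot> idn Z)) \<cdot> asc (X \<boxtimes> B) C Z)"
    by (simp add: tau_def)
  also have "(swp X B \<odot> (idn C \<odot> idn Z)) \<cdot> asc (X \<boxtimes> B) C Z = asc (B \<boxtimes> X) C Z \<cdot> ((swp X B \<odot> idn C) \<odot> idn Z)"
    by (subst asc_nat') simp_all
  also have "(idn B \<odot> tau X C Z) \<cdot> asc B X (C \<boxtimes> Z) \<cdot> (asc (B \<boxtimes> X) C Z \<cdot> ((swp X B \<odot> idn C) \<odot> idn Z))
      = (idn B \<odot> tau X C Z) \<cdot> (asc B X (C \<boxtimes> Z) \<cdot> asc (B \<boxtimes> X) C Z) \<cdot> ((swp X B \<odot> idn C) \<odot> idn Z)"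
    by simp
  also have "\<dots> = ?n"
    by (subst pentagon) (simp_all add: tau_asc)
  finally show "(asc B C (X \<boxtimes> Z) \<cdot> tau X (B \<boxtimes> C) Z) \<cdot> ?P =
      ((idn B \<odot> tau X C Z) \<cdot> tau X B (C \<boxtimes> Z) \<cdot> (idn X \<odot> asc B C Z)) \<cdot> ?P" using 1 by simp
qed simp_all

text \<open>The preceding law read backwards, since \<open>tau\<close> is inverted by exchanging its
  first two arguments.\<close>

lemma tau_hexagon': assumes [simp]: "X \<in> Ob M" "B \<in> Ob M" "C \<in> Ob M" "Z \<in> Ob M"
  shows "(idn X \<odot> asc B C Z) \<cdot> tau (B \<boxtimes> C) X Z =
    tau B X (C \<boxtimes> Z) \<cdot> (idn B \<odot> tau C X Z) \<cdot> asc B C (X \<boxtimes> Z)"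
proof -
  let ?u = "tau X (B \<boxtimes> C) Z" and ?v = "(idn B \<odot> tau X C Z) \<cdot> tau X B (C \<boxtimes> Z)"
    and ?w = "tau B X (C \<boxtimes> Z) \<cdot> (idn B \<odot> tau C X Z)"
  have w: "?w \<cdot> ?v = idn (X \<boxtimes> B \<boxtimes> C \<boxtimes> Z)"
    by (simp add: tau_tau)
  have "(idn X \<odot> asc B C Z) \<cdot> tau (B \<boxtimes> C) X Z = (?w \<cdot> ?v) \<cdot> (idn X \<odot> asc B C Z) \<cdot> tau (B \<boxtimes> C) X Z"
    unfolding w by simp
  also have "\<dots> = ?w \<cdot> (?v \<cdot> (idn X \<odot> asc B C Z)) \<cdot> tau (B \<boxtimes> C) X Z" by simp
  also have "?v \<cdot> (idn X \<odot> asc B C Z) = asc B C (X \<boxtimes> Z) \<cdot> ?u" by (simp add: tau_hexagon)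
  also have "?w \<cdot> (asc B C (X \<boxtimes> Z) \<cdot> ?u) \<cdot> tau (B \<boxtimes> C) X Z = ?w \<cdot> asc B C (X \<boxtimes> Z)"
    by (simp add: tau_tau)
  finally show ?thesis by simp
qed

text \<open>The exchange of the leading factors does not see what stands to their right, so a
  further factor \<open>V\<close> is absorbed into \<open>Z\<close>: two pentagons around naturality
  of \<open>asc\<close>.\<close>

lemma tau_tensor: assumes [simp]: "A \<in> Ob M" "B \<in> Ob M" "V \<in> Ob M" "Z \<in> Ob M"
  shows "(idn B \<odot> asc A Z V) \<cdot> asc B (A \<boxtimes> Z) V \<cdot> (tau A B Z \<odot> idn V)
    = tau A B (Z \<boxtimes> V) \<cdot> (idn A \<odot> asc B Z V) \<cdot> asc A (B \<boxtimes> Z) V"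
proof (rule iso_cancel_right)
  let ?P = "asc A B Z \<odot> idn V"
  have "((idn B \<odot> asc A Z V) \<cdot> asc B (A \<boxtimes> Z) V \<cdot> (tau A B Z \<odot> idn V)) \<cdot> ?P
      = ((idn B \<odot> asc A Z V) \<cdot> asc B (A \<boxtimes> Z) V \<cdot> (asc B A Z \<odot> idn V)) \<cdot> ((swp A B \<odot> idn Z) \<odot> idn V)"
    by (simp add: tau_asc)
  also have "\<dots> = asc B A (Z \<boxtimes> V) \<cdot> (asc (B \<boxtimes> A) Z V \<cdot> ((swp A B \<odot> idn Z) \<odot> idn V))"
    by (subst pentagon[symmetric]) simp_all
  also have "\<dots> = (asc B A (Z \<boxtimes> V) \<cdot> (swp A B \<odot> idn (Z \<boxtimes> V))) \<cdot> asc (A \<boxtimes> B) Z V"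
    by (subst asc_nat') simp_all
  also have "\<dots> = tau A B (Z \<boxtimes> V) \<cdot> (asc A B (Z \<boxtimes> V) \<cdot> asc (A \<boxtimes> B) Z V)"
    by (simp add: tau_def)
  also have "\<dots> = (tau A B (Z \<boxtimes> V) \<cdot> (idn A \<odot> asc B Z V) \<cdot> asc A (B \<boxtimes> Z) V) \<cdot> ?P"
    by (subst pentagon) simp_all
  finally show "((idn B \<odot> asc A Z V) \<cdot> asc B (A \<boxtimes> Z) V \<cdot> (tau A B Z \<odot> idn V)) \<cdot> ?P
    = (tau A B (Z \<boxtimes> V) \<cdot> (idn A \<odot> asc B Z V) \<cdot> asc A (B \<boxtimes> Z) V) \<cdot> ?P" .
qed simp_all

subsection \<open>Coherence of the middle-four interchange\<close>

abbreviation \<open>mid \<equiv> mid_swap M\<close>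

lemma mid_tau: "mid W X Y Z = asci W Y (X \<boxtimes> Z) \<cdot> (idn W \<odot> tau X Y Z) \<cdot> asc W X (Y \<boxtimes> Z)"
  by (simp add: mid_swap_def tau_def)

lemma mid_hom [simp]: assumes "W \<in> Ob M" "X \<in> Ob M" "Y \<in> Ob M" "Z \<in> Ob M"
  shows "mid W X Y Z \<in> Arr M" "Dom M (mid W X Y Z) = (W \<boxtimes> X) \<boxtimes> (Y \<boxtimes> Z)"
    "Cod M (mid W X Y Z) = (W \<boxtimes> Y) \<boxtimes> (X \<boxtimes> Z)"
  using assms by (simp_all add: mid_tau)

lemma asc_mid: "W \<in> Ob M \<Longrightarrow> X \<in> Ob M \<Longrightarrow> Y \<in> Ob M \<Longrightarrow> Z \<in> Ob M \<Longrightarrow>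
    asc W Y (X \<boxtimes> Z) \<cdot> mid W X Y Z = (idn W \<odot> tau X Y Z) \<cdot> asc W X (Y \<boxtimes> Z)"
  by (simp add: mid_tau)

lemma mid_mid: "W \<in> Ob M \<Longrightarrow> X \<in> Ob M \<Longrightarrow> Y \<in> Ob M \<Longrightarrow> Z \<in> Ob M \<Longrightarrow>
    mid W Y X Z \<cdot> mid W X Y Z = idn ((W \<boxtimes> X) \<boxtimes> (Y \<boxtimes> Z))"
  by (simp add: mid_tau tau_tau)

lemma mid_nat: assumes [simp]: "f \<in> Arr M" "g \<in> Arr M" "h \<in> Arr M" "k \<in> Arr M"
    "Cod M f = W" "Cod M g = X" "Cod M h = Y" "Cod M k = Z"
  shows "mid W X Y Z \<cdot> ((f \<odot> g) \<odot> (h \<odot> k)) =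
    ((f \<odot> h) \<odot> (g \<odot> k)) \<cdot> mid (Dom M f) (Dom M g) (Dom M h) (Dom M k)"
proof -
  have [simp]: "X \<in> Ob M" "Y \<in> Ob M" "Z \<in> Ob M" "W \<in> Ob M" using assms cod_ob by blast+
  have "mid W X Y Z \<cdot> ((f \<odot> g) \<odot> (h \<odot> k)) = asci W Y (X \<boxtimes> Z) \<cdot> (idn W \<odot> tau X Y Z) \<cdot> (asc W X (Y \<boxtimes> Z) \<cdot> ((f \<odot> g) \<odot> (h \<odot> k)))"
    by (simp add: mid_tau)
  also have "\<dots> = asci W Y (X \<boxtimes> Z) \<cdot> (f \<odot> (tau X Y Z \<cdot> (g \<odot> h \<odot> k))) \<cdot> asc (Dom M f) (Dom M g) (Dom M h \<boxtimes> Dom M k)"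
    by (subst asc_nat') simp_all
  also have "\<dots> = (asci W Y (X \<boxtimes> Z) \<cdot> (f \<odot> h \<odot> g \<odot> k)) \<cdot> (idn (Dom M f) \<odot> tau (Dom M g) (Dom M h) (Dom M k)) \<cdot> asc (Dom M f) (Dom M g) (Dom M h \<boxtimes> Dom M k)"
    by (subst tau_nat) simp_all
  also have "\<dots> = ((f \<odot> h) \<odot> (g \<odot> k)) \<cdot> mid (Dom M f) (Dom M g) (Dom M h) (Dom M k)"
    by (subst asci_nat) (simp_all add: mid_tau)
  finally show ?thesis .
qed

text \<open>Rewrites \<open>mid\<close>, standing next to a further factor \<open>Z\<close>, as a
  single transposition inside a right-nested product. In this form \<open>mid_asc\<close> compares
  its two sides.\<close>

lemma asc_mid_tensor: assumes [simp]: "P \<in> Ob M" "Q \<in> Ob M" "S \<in> Ob M" "T \<in> Ob M" "Z \<in> Ob M"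
  shows "asc P S (Q \<boxtimes> T \<boxtimes> Z) \<cdot> (idn (P \<boxtimes> S) \<odot> asc Q T Z) \<cdot> asc (P \<boxtimes> S) (Q \<boxtimes> T) Z \<cdot> (mid P Q S T \<odot> idn Z)
    = (idn P \<odot> tau Q S (T \<boxtimes> Z)) \<cdot> asc P Q (S \<boxtimes> T \<boxtimes> Z) \<cdot> (idn (P \<boxtimes> Q) \<odot> asc S T Z) \<cdot> asc (P \<boxtimes> Q) (S \<boxtimes> T) Z"
proof -
  have "asc P S (Q \<boxtimes> T \<boxtimes> Z) \<cdot> (idn (P \<boxtimes> S) \<odot> asc Q T Z) \<cdot> asc (P \<boxtimes> S) (Q \<boxtimes> T) Z \<cdot> (mid P Q S T \<odot> idn Z)
    = (asc P S (Q \<boxtimes> T \<boxtimes> Z) \<cdot> (idn (P \<boxtimes> S) \<odot> asc Q T Z)) \<cdot> asc (P \<boxtimes> S) (Q \<boxtimes> T) Z \<cdot> (mid P Q S T \<odot> idn Z)"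
    by simp
  also have "\<dots> = (idn P \<odot> idn S \<odot> asc Q T Z) \<cdot> (asc P S ((Q \<boxtimes> T) \<boxtimes> Z) \<cdot> asc (P \<boxtimes> S) (Q \<boxtimes> T) Z) \<cdot> (mid P Q S T \<odot> idn Z)"
    by (subst asc_nat_id) simp_all
  also have "\<dots> = (idn P \<odot> ((idn S \<odot> asc Q T Z) \<cdot> asc S (Q \<boxtimes> T) Z)) \<cdot> asc P (S \<boxtimes> Q \<boxtimes> T) Z \<cdot> ((asc P S (Q \<boxtimes> T) \<cdot> mid P Q S T) \<odot> idn Z)"
    by (subst pentagon) simp_all
  also have "\<dots> = (idn P \<odot> ((idn S \<odot> asc Q T Z) \<cdot> asc S (Q \<boxtimes> T) Z)) \<cdot> asc P (S \<boxtimes> Q \<boxtimes> T) Z \<cdot> ((idn P \<odot> tau Q S T) \<odot> idn Z) \<cdot> (asc P Q (S \<boxtimes> T) \<odot> idn Z)"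
    by (subst asc_mid) simp_all
  also have "\<dots> = (idn P \<odot> ((idn S \<odot> asc Q T Z) \<cdot> asc S (Q \<boxtimes> T) Z \<cdot> (tau Q S T \<odot> idn Z))) \<cdot> asc P (Q \<boxtimes> S \<boxtimes> T) Z \<cdot> (asc P Q (S \<boxtimes> T) \<odot> idn Z)"
    by (subst asc_nat_ext) simp_all
  also have "\<dots> = (idn P \<odot> tau Q S (T \<boxtimes> Z)) \<cdot> (idn P \<odot> idn Q \<odot> asc S T Z) \<cdot> ((idn P \<odot> asc Q (S \<boxtimes> T) Z) \<cdot> asc P (Q \<boxtimes> S \<boxtimes> T) Z \<cdot> (asc P Q (S \<boxtimes> T) \<odot> idn Z))"
    by (subst tau_tensor) simp_all
  also have "\<dots> = (idn P \<odot> tau Q S (T \<boxtimes> Z)) \<cdot> ((idn P \<odot> idn Q \<odot> asc S T Z) \<cdot> asc P Q ((S \<boxtimes> T) \<boxtimes> Z)) \<cdot> asc (P \<boxtimes> Q) (S \<boxtimes> T) Z"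
    by (subst pentagon[symmetric]) simp_all
  also have "(idn P \<odot> idn Q \<odot> asc S T Z) \<cdot> asc P Q ((S \<boxtimes> T) \<boxtimes> Z) = asc P Q (S \<boxtimes> T \<boxtimes> Z) \<cdot> (idn (P \<boxtimes> Q) \<odot> asc S T Z)"
    by (subst asc_nat_id) simp_all
  finally show ?thesis by simp
qed

text \<open>Coassociativity of a tensor product of comonoids rests on this. Both sides deal two
  triples into the pairs \<open>P S\<close>, \<open>Q T\<close>, \<open>R U\<close>. Followed by the
  isomorphism \<open>?N\<close> to the right-nested product, both become \<open>?n\<close>, a
  reassociation followed by the three transpositions in \<open>?t\<close>.\<close>

lemma mid_asc: assumes [simp]: "P \<in> Ob M" "Q \<in> Ob M" "R \<in> Ob M" "S \<in> Ob M" "T \<in> Ob M" "U \<in> Ob M"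
  shows "asc (P \<boxtimes> S) (Q \<boxtimes> T) (R \<boxtimes> U) \<cdot> (mid P Q S T \<odot> idn (R \<boxtimes> U)) \<cdot> mid (P \<boxtimes> Q) R (S \<boxtimes> T) U
    = (idn (P \<boxtimes> S) \<odot> mid Q R T U) \<cdot> mid P (Q \<boxtimes> R) S (T \<boxtimes> U) \<cdot> (asc P Q R \<odot> asc S T U)"
proof (rule iso_cancel_left)
  let ?N = "asc P S (Q \<boxtimes> T \<boxtimes> R \<boxtimes> U) \<cdot> (idn (P \<boxtimes> S) \<odot> asc Q T (R \<boxtimes> U))"
  let ?Y = "S \<boxtimes> T \<boxtimes> U"
  let ?t = "idn P \<odot> (tau Q S (T \<boxtimes> R \<boxtimes> U) \<cdot> (idn Q \<odot> ((idn S \<odot> tau R T U) \<cdot> tau R S (T \<boxtimes> U))))"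
  let ?n = "?t \<cdot> (idn P \<odot> idn Q \<odot> idn R \<odot> asc S T U) \<cdot> asc P Q (R \<boxtimes> (S \<boxtimes> T) \<boxtimes> U) \<cdot> asc (P \<boxtimes> Q) R ((S \<boxtimes> T) \<boxtimes> U)"
  have "?N \<cdot> asc (P \<boxtimes> S) (Q \<boxtimes> T) (R \<boxtimes> U) \<cdot> (mid P Q S T \<odot> idn (R \<boxtimes> U)) \<cdot> mid (P \<boxtimes> Q) R (S \<boxtimes> T) U
    = (asc P S (Q \<boxtimes> T \<boxtimes> R \<boxtimes> U) \<cdot> (idn (P \<boxtimes> S) \<odot> asc Q T (R \<boxtimes> U)) \<cdot> asc (P \<boxtimes> S) (Q \<boxtimes> T) (R \<boxtimes> U) \<cdot> (mid P Q S T \<odot> idn (R \<boxtimes> U)))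
      \<cdot> mid (P \<boxtimes> Q) R (S \<boxtimes> T) U" by simp
  also have "\<dots> = (idn P \<odot> tau Q S (T \<boxtimes> R \<boxtimes> U)) \<cdot> asc P Q (S \<boxtimes> T \<boxtimes> R \<boxtimes> U) \<cdot> (idn (P \<boxtimes> Q) \<odot> asc S T (R \<boxtimes> U)) \<cdot> (asc (P \<boxtimes> Q) (S \<boxtimes> T) (R \<boxtimes> U) \<cdot> mid (P \<boxtimes> Q) R (S \<boxtimes> T) U)"
    by (subst asc_mid_tensor) simp_all
  also have "\<dots> = (idn P \<odot> tau Q S (T \<boxtimes> R \<boxtimes> U)) \<cdot> asc P Q (S \<boxtimes> T \<boxtimes> R \<boxtimes> U) \<cdot> (idn (P \<boxtimes> Q) \<odot> (asc S T (R \<boxtimes> U) \<cdot> tau R (S \<boxtimes> T) U)) \<cdot> asc (P \<boxtimes> Q) R ((S \<boxtimes> T) \<boxtimes> U)"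
    by (subst asc_mid) simp_all
  also have "\<dots> = (idn P \<odot> tau Q S (T \<boxtimes> R \<boxtimes> U)) \<cdot> (asc P Q (S \<boxtimes> T \<boxtimes> R \<boxtimes> U) \<cdot> (idn (P \<boxtimes> Q) \<odot> ((idn S \<odot> tau R T U) \<cdot> tau R S (T \<boxtimes> U) \<cdot> (idn R \<odot> asc S T U)))) \<cdot> asc (P \<boxtimes> Q) R ((S \<boxtimes> T) \<boxtimes> U)"
    by (subst tau_hexagon) simp_all
  also have "\<dots> = ?n"
    by (subst asc_nat_id) simp_all
  finally have 1: "?N \<cdot> asc (P \<boxtimes> S) (Q \<boxtimes> T) (R \<boxtimes> U) \<cdot> (mid P Q S T \<odot> idn (R \<boxtimes> U)) \<cdot> mid (P \<boxtimes> Q) R (S \<boxtimes> T) U = ?n" .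
  have "?N \<cdot> (idn (P \<boxtimes> S) \<odot> mid Q R T U) \<cdot> mid P (Q \<boxtimes> R) S (T \<boxtimes> U) \<cdot> (asc P Q R \<odot> asc S T U)
    = asc P S (Q \<boxtimes> T \<boxtimes> R \<boxtimes> U) \<cdot> (idn (P \<boxtimes> S) \<odot> (asc Q T (R \<boxtimes> U) \<cdot> mid Q R T U)) \<cdot> mid P (Q \<boxtimes> R) S (T \<boxtimes> U) \<cdot> (asc P Q R \<odot> asc S T U)"
    by simp
  also have "\<dots> = (asc P S (Q \<boxtimes> T \<boxtimes> R \<boxtimes> U) \<cdot> (idn (P \<boxtimes> S) \<odot> ((idn Q \<odot> tau R T U) \<cdot> asc Q R (T \<boxtimes> U)))) \<cdot> mid P (Q \<boxtimes> R) S (T \<boxtimes> U) \<cdot> (asc P Q R \<odot> asc S T U)"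
    by (subst asc_mid) simp_all
  also have "\<dots> = (idn P \<odot> idn S \<odot> ((idn Q \<odot> tau R T U) \<cdot> asc Q R (T \<boxtimes> U))) \<cdot> (asc P S ((Q \<boxtimes> R) \<boxtimes> T \<boxtimes> U) \<cdot> mid P (Q \<boxtimes> R) S (T \<boxtimes> U)) \<cdot> (asc P Q R \<odot> asc S T U)"
    by (subst asc_nat_id) simp_all
  also have "\<dots> = (idn P \<odot> ((idn S \<odot> idn Q \<odot> tau R T U) \<cdot> ((idn S \<odot> asc Q R (T \<boxtimes> U)) \<cdot> tau (Q \<boxtimes> R) S (T \<boxtimes> U)))) \<cdot> asc P (Q \<boxtimes> R) ?Y \<cdot> (asc P Q R \<odot> asc S T U)"
    by (subst asc_mid) simp_all
  also have "\<dots> = (idn P \<odot> (((idn S \<odot> idn Q \<odot> tau R T U) \<cdot> tau Q S (R \<boxtimes> T \<boxtimes> U)) \<cdot> (idn Q \<odot> tau R S (T \<boxtimes> U)) \<cdot> asc Q R ?Y)) \<cdot> asc P (Q \<boxtimes> R) ?Y \<cdot> (asc P Q R \<odot> asc S T U)"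
    by (subst tau_hexagon') simp_all
  also have "(idn S \<odot> idn Q \<odot> tau R T U) \<cdot> tau Q S (R \<boxtimes> T \<boxtimes> U) = tau Q S (T \<boxtimes> R \<boxtimes> U) \<cdot> (idn Q \<odot> idn S \<odot> tau R T U)"
    by (subst tau_nat) simp_all
  also have "(idn P \<odot> ((tau Q S (T \<boxtimes> R \<boxtimes> U) \<cdot> (idn Q \<odot> idn S \<odot> tau R T U)) \<cdot> (idn Q \<odot> tau R S (T \<boxtimes> U)) \<cdot> asc Q R ?Y)) \<cdot> asc P (Q \<boxtimes> R) ?Y \<cdot> (asc P Q R \<odot> asc S T U)
    = ?t \<cdot> ((idn P \<odot> asc Q R ?Y) \<cdot> asc P (Q \<boxtimes> R) ?Y \<cdot> (asc P Q R \<odot> idn ?Y)) \<cdot> (idn ((P \<boxtimes> Q) \<boxtimes> R) \<odot> asc S T U)"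
    by simp
  also have "\<dots> = ?t \<cdot> asc P Q (R \<boxtimes> ?Y) \<cdot> (asc (P \<boxtimes> Q) R ?Y \<cdot> (idn ((P \<boxtimes> Q) \<boxtimes> R) \<odot> asc S T U))"
    by (subst pentagon[symmetric]) simp_all
  also have "\<dots> = ?t \<cdot> (asc P Q (R \<boxtimes> ?Y) \<cdot> (idn (P \<boxtimes> Q) \<odot> idn R \<odot> asc S T U)) \<cdot> asc (P \<boxtimes> Q) R ((S \<boxtimes> T) \<boxtimes> U)"
    by (subst asc_nat_id) simp_all
  also have "\<dots> = ?n"
    by (subst asc_nat_id) simp_all
  finally show "?N \<cdot> asc (P \<boxtimes> S) (Q \<boxtimes> T) (R \<boxtimes> U) \<cdot> (mid P Q S T \<odot> idn (R \<boxtimes> U)) \<cdot> mid (P \<boxtimes> Q) R (S \<boxtimes> T) U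
    = ?N \<cdot> (idn (P \<boxtimes> S) \<odot> mid Q R T U) \<cdot> mid P (Q \<boxtimes> R) S (T \<boxtimes> U) \<cdot> (asc P Q R \<odot> asc S T U)"
    using 1 by simp
qed simp_all

text \<open>Cocommutativity of a tensor product of comonoids rests on this. \<open>hex\<close> is
  the hexagon in terms of \<open>tau\<close> and \<open>swp_eq\<close> its inverse form; they expand
  the symmetry of two pairs into transpositions of single factors.\<close>

lemma mid_sym: assumes [simp]: "W \<in> Ob M" "X \<in> Ob M" "Y \<in> Ob M" "Z \<in> Ob M"
  shows "swp (W \<boxtimes> Y) (X \<boxtimes> Z) \<cdot> mid W X Y Z = mid X W Z Y \<cdot> (swp W X \<odot> swp Y Z)"
proof (rule iso_cancel_left)
  have hex: "asc B C A \<cdot> swp A (B \<boxtimes> C) = (idn B \<odot> swp A C) \<cdot> tau A B C"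
    if [simp]: "A \<in> Ob M" "B \<in> Ob M" "C \<in> Ob M" for A B C
    by (rule iso_cancel_right[of _ "asc A B C"]) (simp_all add: tau_asc hexagon)
  have swp_eq: "swp (W \<boxtimes> Y) Z = tau W Z Y \<cdot> (idn W \<odot> swp Y Z) \<cdot> asc W Y Z"
  proof -
    have "tau W Z Y \<cdot> (idn W \<odot> swp Y Z) \<cdot> asc W Y Z
      = tau W Z Y \<cdot> (idn W \<odot> swp Y Z) \<cdot> (asc W Y Z \<cdot> swp Z (W \<boxtimes> Y)) \<cdot> swp (W \<boxtimes> Y) Z"
      by (simp add: sym_sym)
    also have "\<dots> = swp (W \<boxtimes> Y) Z"
      by (subst hex) (simp_all add: sym_sym tau_tau sym_sym[THEN cmp_ext] tau_tau[THEN cmp_ext])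
    finally show ?thesis by simp
  qed
  have "asc X Z (W \<boxtimes> Y) \<cdot> swp (W \<boxtimes> Y) (X \<boxtimes> Z) \<cdot> mid W X Y Z = (asc X Z (W \<boxtimes> Y) \<cdot> swp (W \<boxtimes> Y) (X \<boxtimes> Z)) \<cdot> mid W X Y Z"
    by simp
  also have "\<dots> = (idn X \<odot> (tau W Z Y \<cdot> (idn W \<odot> swp Y Z))) \<cdot> ((idn X \<odot> asc W Y Z) \<cdot> tau (W \<boxtimes> Y) X Z) \<cdot> mid W X Y Z"
    by (simp add: hex swp_eq)
  also have "\<dots> = (idn X \<odot> (tau W Z Y \<cdot> (idn W \<odot> swp Y Z))) \<cdot> tau W X (Y \<boxtimes> Z) \<cdot> (idn W \<odot> tau Y X Z) \<cdot> (asc W Y (X \<boxtimes> Z) \<cdot> mid W X Y Z)"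
    by (subst tau_hexagon') simp_all
  also have "\<dots> = (idn X \<odot> (tau W Z Y \<cdot> (idn W \<odot> swp Y Z))) \<cdot> tau W X (Y \<boxtimes> Z) \<cdot> asc W X (Y \<boxtimes> Z)"
    by (subst asc_mid) (simp_all add: tau_tau)
  also have "\<dots> = (idn X \<odot> tau W Z Y) \<cdot> (idn X \<odot> idn W \<odot> swp Y Z) \<cdot> (asc X W (Y \<boxtimes> Z) \<cdot> (swp W X \<odot> idn (Y \<boxtimes> Z)))"
    by (simp add: tau_asc)
  also have "\<dots> = (idn X \<odot> tau W Z Y) \<cdot> ((idn X \<odot> idn W \<odot> swp Y Z) \<cdot> asc X W (Y \<boxtimes> Z)) \<cdot> (swp W X \<odot> idn (Y \<boxtimes> Z))"
    by simp
  also have "(idn X \<odot> idn W \<odot> swp Y Z) \<cdot> asc X W (Y \<boxtimes> Z) = asc X W (Z \<boxtimes> Y) \<cdot> (idn (X \<boxtimes> W) \<odot> swp Y Z)"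
    by (subst asc_nat_id) simp_all
  also have "(idn X \<odot> tau W Z Y) \<cdot> (asc X W (Z \<boxtimes> Y) \<cdot> (idn (X \<boxtimes> W) \<odot> swp Y Z)) \<cdot> (swp W X \<odot> idn (Y \<boxtimes> Z))
      = ((idn X \<odot> tau W Z Y) \<cdot> asc X W (Z \<boxtimes> Y)) \<cdot> (swp W X \<odot> swp Y Z)"
    by simp
  also have "\<dots> = asc X Z (W \<boxtimes> Y) \<cdot> mid X W Z Y \<cdot> (swp W X \<odot> swp Y Z)"
    by (subst asc_mid[symmetric]) simp_all
  finally show "asc X Z (W \<boxtimes> Y) \<cdot> swp (W \<boxtimes> Y) (X \<boxtimes> Z) \<cdot> mid W X Y Z
    = asc X Z (W \<boxtimes> Y) \<cdot> mid X W Z Y \<cdot> (swp W X \<odot> swp Y Z)" .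
qed simp_all

lemma mid_sym': assumes [simp]: "W \<in> Ob M" "X \<in> Ob M" "Y \<in> Ob M" "Z \<in> Ob M"
  shows "mid X Z W Y \<cdot> swp (W \<boxtimes> Y) (X \<boxtimes> Z) = (swp W X \<odot> swp Y Z) \<cdot> mid W Y X Z"
proof -
  have "mid X Z W Y \<cdot> swp (W \<boxtimes> Y) (X \<boxtimes> Z) = mid X Z W Y \<cdot> (swp (W \<boxtimes> Y) (X \<boxtimes> Z) \<cdot> mid W X Y Z) \<cdot> mid W Y X Z"
    by (simp add: mid_mid)
  also have "\<dots> = (mid X Z W Y \<cdot> mid X W Z Y) \<cdot> (swp W X \<odot> swp Y Z) \<cdot> mid W Y X Z"
    by (subst mid_sym) simp_all
  also have "\<dots> = (swp W X \<odot> swp Y Z) \<cdot> mid W Y X Z" by (subst mid_mid) simp_all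
  finally show ?thesis .
qed

lemma lun_tau: assumes [simp]: "A \<in> Ob M" "B \<in> Ob M"
  shows "lun (A \<boxtimes> B) \<cdot> tau A I B = idn A \<odot> lun B"
proof (rule iso_cancel_right)
  have "(lun (A \<boxtimes> B) \<cdot> tau A I B) \<cdot> asc A I B = (lun (A \<boxtimes> B) \<cdot> asc I A B) \<cdot> (swp A I \<odot> idn B)"
    by (simp add: tau_asc)
  also have "\<dots> = (lun A \<cdot> swp A I) \<odot> idn B" by (simp add: lun_asc)
  also have "\<dots> = (idn A \<odot> lun B) \<cdot> asc A I B" by (simp add: lun_sym triangle)
  finally show "(lun (A \<boxtimes> B) \<cdot> tau A I B) \<cdot> asc A I B = (idn A \<odot> lun B) \<cdot> asc A I B" .
qed simp_all

text \<open>The left counit law of a tensor product of comonoids at the level of constraints, after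
  the counits have turned one leg of each factor into \<open>I\<close>.\<close>

lemma lun_mid: assumes [simp]: "A \<in> Ob M" "B \<in> Ob M"
  shows "lun (A \<boxtimes> B) \<cdot> (lun I \<odot> idn (A \<boxtimes> B)) \<cdot> mid I A I B = lun A \<odot> lun B"
proof -
  have "lun (A \<boxtimes> B) \<cdot> (lun I \<odot> idn (A \<boxtimes> B)) \<cdot> mid I A I B
    = lun (A \<boxtimes> B) \<cdot> ((idn I \<odot> lun (A \<boxtimes> B)) \<cdot> asc I I (A \<boxtimes> B)) \<cdot> mid I A I B"
    by (simp add: triangle lun_unit_run_unit)
  also have "\<dots> = lun (A \<boxtimes> B) \<cdot> (idn I \<odot> lun (A \<boxtimes> B)) \<cdot> (asc I I (A \<boxtimes> B) \<cdot> mid I A I B)" by simp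
  also have "\<dots> = lun (A \<boxtimes> B) \<cdot> (idn I \<odot> (lun (A \<boxtimes> B) \<cdot> tau A I B)) \<cdot> asc I A (I \<boxtimes> B)"
    by (subst asc_mid) simp_all
  also have "\<dots> = lun (A \<boxtimes> B) \<cdot> ((idn I \<odot> idn A \<odot> lun B) \<cdot> asc I A (I \<boxtimes> B))"
    by (simp add: lun_tau)
  also have "(idn I \<odot> idn A \<odot> lun B) \<cdot> asc I A (I \<boxtimes> B) = asc I A B \<cdot> (idn (I \<boxtimes> A) \<odot> lun B)"
    by (subst asc_nat_id) simp_all
  also have "lun (A \<boxtimes> B) \<cdot> (asc I A B \<cdot> (idn (I \<boxtimes> A) \<odot> lun B)) = (lun (A \<boxtimes> B) \<cdot> asc I A B) \<cdot> (idn (I \<boxtimes> A) \<odot> lun B)"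
    by simp
  also have "\<dots> = lun A \<odot> lun B" by (simp add: lun_asc)
  finally show ?thesis .
qed

lemma lun_lun_mid: assumes [simp]: "A \<in> Ob M" "B \<in> Ob M"
  shows "(lun A \<odot> lun B) \<cdot> mid I I A B = lun (A \<boxtimes> B) \<cdot> (lun I \<odot> idn (A \<boxtimes> B))"
  unfolding lun_mid[OF assms, symmetric] by (simp add: mid_mid)

lemma mid_unit: assumes [simp]: "A \<in> Ob M" "B \<in> Ob M"
  shows "mid A I I B = idn ((A \<boxtimes> I) \<boxtimes> (I \<boxtimes> B))"
  by (simp add: mid_tau tau_def sym_unit)

subsection \<open>Exactness of the tensor product\<close>

lemma ten_left_short_exact:
  "X \<in> Ob M \<Longrightarrow> is_kernel M i p \<Longrightarrow> is_cokernel M p i \<Longrightarrow> is_kernel M (idn X \<odot> i) (idn X \<odot> p)"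
  "X \<in> Ob M \<Longrightarrow> is_kernel M i p \<Longrightarrow> is_cokernel M p i \<Longrightarrow> is_cokernel M (idn X \<odot> p) (idn X \<odot> i)"
  using ten_left_exact unfolding exact_on_def is_short_exact_def by blast+

lemma ten_right_short_exact:
  "X \<in> Ob M \<Longrightarrow> is_kernel M i p \<Longrightarrow> is_cokernel M p i \<Longrightarrow> is_kernel M (i \<odot> idn X) (p \<odot> idn X)"
  "X \<in> Ob M \<Longrightarrow> is_kernel M i p \<Longrightarrow> is_cokernel M p i \<Longrightarrow> is_cokernel M (p \<odot> idn X) (i \<odot> idn X)"
  using ten_right_exact unfolding exact_on_def is_short_exact_def by blast+

text \<open>A mono together with its cokernel forms a short exact sequence, and tensoring preserves
  it.\<close>

lemma ten_id_mono: assumes "is_mono M i" "X \<in> Ob M"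
  shows "is_mono M (idn X \<odot> i)" "is_mono M (i \<odot> idn X)"
proof -
  obtain p where p: "is_cokernel M p i" using ex_cokernel mono_arr[OF assms(1)] by blast
  note k = mono_kernel_of_cokernel[OF assms(1) p]
  show "is_mono M (idn X \<odot> i)" using kernel_mono[OF ten_left_short_exact(1)[OF assms(2) k p]] .
  show "is_mono M (i \<odot> idn X)" using kernel_mono[OF ten_right_short_exact(1)[OF assms(2) k p]] .
qed

lemma ten_id_epi: assumes "is_epi M p" "X \<in> Ob M"
  shows "is_epi M (idn X \<odot> p)" "is_epi M (p \<odot> idn X)"
proof -
  obtain i where i: "is_kernel M i p" using ex_kernel epi_arr[OF assms(1)] by blast
  note k = epi_cokernel_of_kernel[OF assms(1) i]
  show "is_epi M (idn X \<odot> p)" using cokernel_epi[OF ten_left_short_exact(2)[OF assms(2) i k]] .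
  show "is_epi M (p \<odot> idn X)" using cokernel_epi[OF ten_right_short_exact(2)[OF assms(2) i k]] .
qed

lemma ten_mono: assumes i: "is_mono M i" and j: "is_mono M j" shows "is_mono M (i \<odot> j)"
proof -
  note [simp] = mono_arr[OF i] mono_arr[OF j]
  have "is_mono M ((i \<odot> idn (Cod M j)) \<cdot> (idn (Dom M i) \<odot> j))"
    by (intro mono_comp ten_id_mono i j) simp_all
  then show ?thesis by simp
qed

lemma ten_epi: assumes i: "is_epi M i" and j: "is_epi M j" shows "is_epi M (i \<odot> j)"
proof -
  note [simp] = epi_arr[OF i] epi_arr[OF j]
  have "is_epi M ((i \<odot> idn (Cod M j)) \<cdot> (idn (Dom M i) \<odot> j))"
    by (intro epi_comp ten_id_epi i j) simp_all
  then show ?thesis by simp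
qed

text \<open>The axiom covers only short exact sequences. A general \<open>g\<close> is split into
  the cokernel of \<open>k\<close> followed by a mono; the sequence at \<open>k\<close> is short
  exact, and tensoring keeps the second factor mono.\<close>

lemma ten_id_kernel: assumes k: "is_kernel M k g" and X: "X \<in> Ob M"
  shows "is_kernel M (idn X \<odot> k) (idn X \<odot> g)" "is_kernel M (k \<odot> idn X) (g \<odot> idn X)"
proof -
  obtain q where q: "is_cokernel M q k" using ex_cokernel kernelD(2)[OF k] by blast
  obtain i where i: "is_mono M i" "Dom M i = Cod M q" and g: "i \<cdot> q = g"
    using mono_epi_factorization[OF k q] by metis
  note kq = mono_kernel_of_cokernel[OF kernel_mono[OF k] q]
  note [simp] = mono_arr[OF i(1)] i(2) cokernelD(2)[OF q] X
  have "is_kernel M (idn X \<odot> k) ((idn X \<odot> i) \<cdot> (idn X \<odot> q))"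
    by (intro kernel_cmp_mono ten_left_short_exact kq q ten_id_mono i X) simp
  then show "is_kernel M (idn X \<odot> k) (idn X \<odot> g)" by (simp add: g)
  have "is_kernel M (k \<odot> idn X) ((i \<odot> idn X) \<cdot> (q \<odot> idn X))"
    by (intro kernel_cmp_mono ten_right_short_exact kq q ten_id_mono i X) simp
  then show "is_kernel M (k \<odot> idn X) (g \<odot> idn X)" by (simp add: g)
qed

lemma ten_id_dif: assumes f: "f \<in> Arr M" "g \<in> Arr M" "Dom M g = Dom M f" "Cod M g = Cod M f" and X: "X \<in> Ob M"
  shows "idn X \<odot> dif f g = dif (idn X \<odot> f) (idn X \<odot> g)" "dif f g \<odot> idn X = dif (f \<odot> idn X) (g \<odot> idn X)"
proof -
  have "idn X \<odot> Add M (dif f g) g = Add M (idn X \<odot> dif f g) (idn X \<odot> g)"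
    by (rule ten_left_additive[OF X, unfolded additive_on_def, rule_format]) (use f in simp_all)
  then show "idn X \<odot> dif f g = dif (idn X \<odot> f) (idn X \<odot> g)"
    using f X by (subst dif_iff) (simp_all add: dif_add)
  have "Add M (dif f g) g \<odot> idn X = Add M (dif f g \<odot> idn X) (g \<odot> idn X)"
    by (rule ten_right_additive[OF X, unfolded additive_on_def, rule_format]) (use f in simp_all)
  then show "dif f g \<odot> idn X = dif (f \<odot> idn X) (g \<odot> idn X)"
    using f X by (subst dif_iff) (simp_all add: dif_add)
qed

lemma ten_id_equalizer: assumes e: "is_equalizer M e f g" and X: "X \<in> Ob M"
  shows "is_equalizer M (idn X \<odot> e) (idn X \<odot> f) (idn X \<odot> g)"
proof -
  note [simp] = equalizerD(1-4)[OF e] X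
  have "is_kernel M e (dif f g)" using e by (subst kernel_dif_iff) simp_all
  then have "is_kernel M (idn X \<odot> e) (dif (idn X \<odot> f) (idn X \<odot> g))"
    using ten_id_kernel(1) by (simp flip: ten_id_dif)
  then show ?thesis by (subst (asm) kernel_dif_iff) simp_all
qed

subsection \<open>Cocommutative comonoids and their generalized elements\<close>

definition coc :: "('o, 'm, 'y) comon_scheme \<Rightarrow> bool" where
  "coc X \<longleftrightarrow> comonoid M X \<and> cocommutative M X"

abbreviation \<open>chom \<equiv> comonoid_hom M\<close>

lemma comonoid_ops [simp]: assumes "comonoid M X"
  shows "cob X \<in> Ob M" "comul X \<in> Arr M" "Dom M (comul X) = cob X" "Cod M (comul X) = cob X \<boxtimes> cob X"
    "counit X \<in> Arr M" "Dom M (counit X) = cob X" "Cod M (counit X) = I"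
  using assms by (auto simp: comonoid_def)

lemma comonoid_laws: assumes "comonoid M X"
  shows "asc (cob X) (cob X) (cob X) \<cdot> (comul X \<odot> idn (cob X)) \<cdot> comul X = (idn (cob X) \<odot> comul X) \<cdot> comul X"
    "lun (cob X) \<cdot> (counit X \<odot> idn (cob X)) \<cdot> comul X = idn (cob X)"
    "run (cob X) \<cdot> (idn (cob X) \<odot> counit X) \<cdot> comul X = idn (cob X)"
  using assms by (simp_all only: comonoid_def)

lemma coc_comonoid [simp]: "coc X \<Longrightarrow> comonoid M X"
  by (simp add: coc_def)

text \<open>The right counit law is the left one carried over by the symmetry, as \<open>run\<close>
  after \<open>swp\<close> is \<open>lun\<close>.\<close>

lemma cocI: assumes "cob X \<in> Ob M" "comul X \<in> Arr M" "Dom M (comul X) = cob X" "Cod M (comul X) = cob X \<boxtimes> cob X"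
    "counit X \<in> Arr M" "Dom M (counit X) = cob X" "Cod M (counit X) = I"
    "asc (cob X) (cob X) (cob X) \<cdot> (comul X \<odot> idn (cob X)) \<cdot> comul X = (idn (cob X) \<odot> comul X) \<cdot> comul X"
    "lun (cob X) \<cdot> (counit X \<odot> idn (cob X)) \<cdot> comul X = idn (cob X)"
    and s: "swp (cob X) (cob X) \<cdot> comul X = comul X"
  shows "coc X"
proof -
  note [simp] = assms(1-7)
  have "run (cob X) \<cdot> (idn (cob X) \<odot> counit X) \<cdot> comul X = run (cob X) \<cdot> ((idn (cob X) \<odot> counit X) \<cdot> swp (cob X) (cob X)) \<cdot> comul X"
    by (simp add: s)
  also have "(idn (cob X) \<odot> counit X) \<cdot> swp (cob X) (cob X) = swp I (cob X) \<cdot> (counit X \<odot> idn (cob X))"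
    by (subst sym_nat') simp_all
  also have "run (cob X) \<cdot> (swp I (cob X) \<cdot> (counit X \<odot> idn (cob X))) \<cdot> comul X
    = (run (cob X) \<cdot> swp I (cob X)) \<cdot> (counit X \<odot> idn (cob X)) \<cdot> comul X" by simp
  also have "\<dots> = idn (cob X)" by (simp add: run_sym assms(9))
  finally show ?thesis using assms by (simp add: coc_def comonoid_def cocommutative_def)
qed

lemma chomD: assumes "chom X Y h"
  shows "h \<in> Arr M" "Dom M h = cob X" "Cod M h = cob Y"
    "comul Y \<cdot> h = (h \<odot> h) \<cdot> comul X" "counit Y \<cdot> h = counit X"
  using assms by (auto simp: comonoid_hom_def)

lemma chomI: "h \<in> Arr M \<Longrightarrow> Dom M h = cob X \<Longrightarrow> Cod M h = cob Y \<Longrightarrow>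
    comul Y \<cdot> h = (h \<odot> h) \<cdot> comul X \<Longrightarrow> counit Y \<cdot> h = counit X \<Longrightarrow> chom X Y h"
  by (auto simp: comonoid_hom_def)

lemma chom_comp: assumes "chom X Y h" "chom Y Z k" "comonoid M X" "comonoid M Y" "comonoid M Z"
  shows "chom X Z (k \<cdot> h)"
proof (rule chomI)
  note [simp] = chomD(1-3)[OF assms(1)] chomD(1-3)[OF assms(2)] assms(3-5)
  have "comul Z \<cdot> k \<cdot> h = (comul Z \<cdot> k) \<cdot> h" by simp
  also have "\<dots> = (k \<odot> k) \<cdot> (comul Y \<cdot> h)" by (subst chomD(4)[OF assms(2)]) simp
  also have "\<dots> = ((k \<cdot> h) \<odot> (k \<cdot> h)) \<cdot> comul X" by (subst chomD(4)[OF assms(1)]) simp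
  finally show "comul Z \<cdot> k \<cdot> h = ((k \<cdot> h) \<odot> (k \<cdot> h)) \<cdot> comul X" .
  have "counit Z \<cdot> k \<cdot> h = (counit Z \<cdot> k) \<cdot> h" by simp
  then show "counit Z \<cdot> k \<cdot> h = counit X" by (simp add: chomD(5)[OF assms(2)] chomD(5)[OF assms(1)])
qed (use chomD(1-3)[OF assms(1)] chomD(1-3)[OF assms(2)] in simp_all)

lemma chom_id: "comonoid M X \<Longrightarrow> chom X X (idn (cob X))"
  by (rule chomI) simp_all

text \<open>Arrows out of a cocommutative comonoid \<open>X\<close> are treated as elements: \<open>pr X a b\<close> is the pair of the
  elements \<open>a\<close> and \<open>b\<close>, on which associativity and symmetry constraints act as on tuples, although
  \<open>a\<close> and \<open>b\<close> need not be comonoid morphisms.\<close>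

definition pr :: "('o, 'm, 'y) comon_scheme \<Rightarrow> 'm \<Rightarrow> 'm \<Rightarrow> 'm" where
  "pr X a b = (a \<odot> b) \<cdot> comul X"

lemma pr_hom [simp]: assumes "comonoid M X" "a \<in> Arr M" "b \<in> Arr M" "Dom M a = cob X" "Dom M b = cob X"
  shows "pr X a b \<in> Arr M" "Dom M (pr X a b) = cob X" "Cod M (pr X a b) = Cod M a \<boxtimes> Cod M b"
  using assms by (simp_all add: pr_def)

lemma ten_pr [simp]: "comonoid M X \<Longrightarrow> a \<in> Arr M \<Longrightarrow> b \<in> Arr M \<Longrightarrow> Dom M a = cob X \<Longrightarrow> Dom M b = cob X \<Longrightarrow>
    u \<in> Arr M \<Longrightarrow> v \<in> Arr M \<Longrightarrow> Dom M u = Cod M a \<Longrightarrow> Dom M v = Cod M b \<Longrightarrow>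
    (u \<odot> v) \<cdot> pr X a b = pr X (u \<cdot> a) (v \<cdot> b)"
  by (simp add: pr_def)

lemma comul_pr: "comonoid M X \<Longrightarrow> comul X = pr X (idn (cob X)) (idn (cob X))"
  by (simp add: pr_def)

lemma asc_pr [simp]:
  assumes "comonoid M X" and [simp]: "a \<in> Arr M" "b \<in> Arr M" "c \<in> Arr M" "Dom M a = cob X" "Dom M b = cob X" "Dom M c = cob X"
    and [simp]: "Cod M a = A" "Cod M b = B" "Cod M c = C"
  shows "asc A B C \<cdot> pr X (pr X a b) c = pr X a (pr X b c)"
proof -
  note [simp] = assms(1)
  have [simp]: "A \<in> Ob M" "B \<in> Ob M" "C \<in> Ob M" using assms cod_ob[of a] cod_ob[of b] cod_ob[of c] by auto
  have "asc A B C \<cdot> pr X (pr X a b) c = (asc A B C \<cdot> ((a \<odot> b) \<odot> c)) \<cdot> (comul X \<odot> idn (cob X)) \<cdot> comul X"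
    by (simp add: pr_def)
  also have "\<dots> = (a \<odot> b \<odot> c) \<cdot> (asc (cob X) (cob X) (cob X) \<cdot> (comul X \<odot> idn (cob X)) \<cdot> comul X)"
    by (subst asc_nat') simp_all
  also have "\<dots> = (a \<odot> b \<odot> c) \<cdot> (idn (cob X) \<odot> comul X) \<cdot> comul X"
    by (simp add: comonoid_laws)
  finally show ?thesis by (simp add: pr_def)
qed

lemma asci_pr [simp]:
  assumes "comonoid M X" "a \<in> Arr M" "b \<in> Arr M" "c \<in> Arr M" "Dom M a = cob X" "Dom M b = cob X" "Dom M c = cob X"
    and "Cod M a = A" "Cod M b = B" "Cod M c = C"
  shows "asci A B C \<cdot> pr X a (pr X b c) = pr X (pr X a b) c"
proof -
  have [simp]: "A \<in> Ob M" "B \<in> Ob M" "C \<in> Ob M" using assms cod_ob[of a] cod_ob[of b] cod_ob[of c] by auto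
  have "asci A B C \<cdot> asc A B C \<cdot> pr X (pr X a b) c = pr X (pr X a b) c"
    using assms by (simp del: asc_pr)
  then show ?thesis using assms by simp
qed

text \<open>This is the place where cocommutativity of \<open>X\<close> enters the calculus of
  elements.\<close>

lemma sym_pr [simp]:
  assumes X: "coc X" and [simp]: "a \<in> Arr M" "b \<in> Arr M" "Dom M a = cob X" "Dom M b = cob X"
    and [simp]: "Cod M a = A" "Cod M b = B"
  shows "swp A B \<cdot> pr X a b = pr X b a"
proof -
  note [simp] = coc_comonoid[OF X]
  have [simp]: "A \<in> Ob M" "B \<in> Ob M" using cod_ob[of a] cod_ob[of b] by auto
  have "swp A B \<cdot> pr X a b = (swp A B \<cdot> (a \<odot> b)) \<cdot> comul X" by (simp add: pr_def)
  also have "\<dots> = (b \<odot> a) \<cdot> (swp (cob X) (cob X) \<cdot> comul X)" by (subst sym_nat') simp_all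
  also have "\<dots> = pr X b a" using X by (simp add: pr_def coc_def cocommutative_def)
  finally show ?thesis .
qed

lemma lun_pr [simp]:
  assumes X: "comonoid M X" and [simp]: "a \<in> Arr M" "Dom M a = cob X" "Cod M a = A"
  shows "lun A \<cdot> pr X (counit X) a = a"
proof -
  note [simp] = X
  have [simp]: "A \<in> Ob M" using cod_ob[of a] by auto
  have "lun A \<cdot> pr X (counit X) a = (lun A \<cdot> (idn I \<odot> a)) \<cdot> (counit X \<odot> idn (cob X)) \<cdot> comul X" by (simp add: pr_def)
  also have "\<dots> = a \<cdot> (lun (cob X) \<cdot> (counit X \<odot> idn (cob X)) \<cdot> comul X)" by (subst lun_nat') simp_all
  also have "\<dots> = a" by (simp add: comonoid_laws)
  finally show ?thesis .
qed

lemma run_pr [simp]: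
  assumes X: "comonoid M X" and [simp]: "a \<in> Arr M" "Dom M a = cob X" "Cod M a = A"
  shows "run A \<cdot> pr X a (counit X) = a"
proof -
  note [simp] = X
  have [simp]: "A \<in> Ob M" using cod_ob[of a] by auto
  have "run A \<cdot> pr X a (counit X) = (run A \<cdot> (a \<odot> idn I)) \<cdot> (idn (cob X) \<odot> counit X) \<cdot> comul X" by (simp add: pr_def)
  also have "\<dots> = a \<cdot> (run (cob X) \<cdot> (idn (cob X) \<odot> counit X) \<cdot> comul X)" by (subst run_nat') simp_all
  also have "\<dots> = a" by (simp add: comonoid_laws)
  finally show ?thesis .
qed

text \<open>Substituting \<open>h\<close> into a pair duplicates it, which is legitimate along a
  comonoid morphism. The components \<open>a\<close> and \<open>b\<close> remain arbitrary arrows,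
  so differences may be substituted into.\<close>

lemma pr_cmp:
  assumes h: "chom X Y h" and [simp]: "comonoid M X" "comonoid M Y" "a \<in> Arr M" "b \<in> Arr M" "Dom M a = cob Y" "Dom M b = cob Y"
  shows "pr Y a b \<cdot> h = pr X (a \<cdot> h) (b \<cdot> h)"
proof -
  note [simp] = chomD(1-3)[OF h]
  have "pr Y a b \<cdot> h = (a \<odot> b) \<cdot> (comul Y \<cdot> h)" by (simp add: pr_def)
  also have "\<dots> = pr X (a \<cdot> h) (b \<cdot> h)" by (subst chomD(4)[OF h]) (simp add: pr_def)
  finally show ?thesis .
qed

lemma comul_cmp: "chom X Y h \<Longrightarrow> comul Y \<cdot> h = pr X h h"
  by (simp add: chomD pr_def)

lemma mid_pr [simp]:
  assumes X: "coc X" and [simp]: "a \<in> Arr M" "b \<in> Arr M" "c \<in> Arr M" "d \<in> Arr M"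
    "Dom M a = cob X" "Dom M b = cob X" "Dom M c = cob X" "Dom M d = cob X"
    and [simp]: "Cod M a = A" "Cod M b = B" "Cod M c = C" "Cod M d = D"
  shows "mid A B C D \<cdot> pr X (pr X a b) (pr X c d) = pr X (pr X a c) (pr X b d)"
proof -
  note [simp] = X coc_comonoid[OF X]
  have [simp]: "A \<in> Ob M" "B \<in> Ob M" "C \<in> Ob M" "D \<in> Ob M" using cod_ob[of a] cod_ob[of b] cod_ob[of c] cod_ob[of d] by auto
  show ?thesis by (simp add: mid_swap_def)
qed

subsection \<open>The tensor product of cocommutative comonoids is their product\<close>

definition tc :: "('o, 'm, 'x) comon_scheme \<Rightarrow> ('o, 'm, 'y) comon_scheme \<Rightarrow> ('o, 'm) comon" where
  "tc X Y = \<lparr>cob = cob X \<boxtimes> cob Y,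
    comul = mid (cob X) (cob X) (cob Y) (cob Y) \<cdot> (comul X \<odot> comul Y),
    counit = lun I \<cdot> (counit X \<odot> counit Y)\<rparr>"

lemma tc_sel [simp]: "cob (tc X Y) = cob X \<boxtimes> cob Y"
  "comul (tc X Y) = mid (cob X) (cob X) (cob Y) (cob Y) \<cdot> (comul X \<odot> comul Y)"
  "counit (tc X Y) = lun I \<cdot> (counit X \<odot> counit Y)"
  by (simp_all add: tc_def)

text \<open>Each law is the coherence law of \<open>mid\<close> of the same shape
  (\<open>mid_asc\<close>, \<open>lun_mid\<close>, \<open>mid_sym\<close>), once naturality has
  brought the structure maps of each factor together so that its own law applies.\<close>

lemma coc_tc [simp]: assumes X: "coc X" and Y: "coc Y" shows "coc (tc X Y)"
proof (rule cocI)
  let ?x = "cob X" and ?y = "cob Y" and ?d = "comul X" and ?e = "comul Y"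
  note [simp] = coc_comonoid[OF X] coc_comonoid[OF Y]
  note cX = X[unfolded coc_def comonoid_def cocommutative_def] and cY = Y[unfolded coc_def comonoid_def cocommutative_def]
  show "cob (tc X Y) \<in> Ob M" "comul (tc X Y) \<in> Arr M" "Dom M (comul (tc X Y)) = cob (tc X Y)"
    "Cod M (comul (tc X Y)) = cob (tc X Y) \<boxtimes> cob (tc X Y)" "counit (tc X Y) \<in> Arr M" "Dom M (counit (tc X Y)) = cob (tc X Y)"
    "Cod M (counit (tc X Y)) = I" by simp_all
  have "asc (?x \<boxtimes> ?y) (?x \<boxtimes> ?y) (?x \<boxtimes> ?y) \<cdot> ((mid ?x ?x ?y ?y \<cdot> (?d \<odot> ?e)) \<odot> idn (?x \<boxtimes> ?y)) \<cdot> mid ?x ?x ?y ?y \<cdot> (?d \<odot> ?e)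
    = asc (?x \<boxtimes> ?y) (?x \<boxtimes> ?y) (?x \<boxtimes> ?y) \<cdot> (mid ?x ?x ?y ?y \<odot> idn (?x \<boxtimes> ?y)) \<cdot> (((?d \<odot> ?e) \<odot> (idn ?x \<odot> idn ?y)) \<cdot> mid ?x ?x ?y ?y) \<cdot> (?d \<odot> ?e)"
    by simp
  also have "((?d \<odot> ?e) \<odot> (idn ?x \<odot> idn ?y)) \<cdot> mid ?x ?x ?y ?y = mid (?x \<boxtimes> ?x) ?x (?y \<boxtimes> ?y) ?y \<cdot> ((?d \<odot> idn ?x) \<odot> (?e \<odot> idn ?y))"
    by (subst mid_nat) simp_all
  also have "asc (?x \<boxtimes> ?y) (?x \<boxtimes> ?y) (?x \<boxtimes> ?y) \<cdot> (mid ?x ?x ?y ?y \<odot> idn (?x \<boxtimes> ?y)) \<cdot> (mid (?x \<boxtimes> ?x) ?x (?y \<boxtimes> ?y) ?y \<cdot> ((?d \<odot> idn ?x) \<odot> (?e \<odot> idn ?y))) \<cdot> (?d \<odot> ?e)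
    = (asc (?x \<boxtimes> ?y) (?x \<boxtimes> ?y) (?x \<boxtimes> ?y) \<cdot> (mid ?x ?x ?y ?y \<odot> idn (?x \<boxtimes> ?y)) \<cdot> mid (?x \<boxtimes> ?x) ?x (?y \<boxtimes> ?y) ?y) \<cdot> (((?d \<odot> idn ?x) \<cdot> ?d) \<odot> ((?e \<odot> idn ?y) \<cdot> ?e))"
    by simp
  also have "\<dots> = (idn (?x \<boxtimes> ?y) \<odot> mid ?x ?x ?y ?y) \<cdot> mid ?x (?x \<boxtimes> ?x) ?y (?y \<boxtimes> ?y) \<cdot> ((asc ?x ?x ?x \<cdot> (?d \<odot> idn ?x) \<cdot> ?d) \<odot> (asc ?y ?y ?y \<cdot> (?e \<odot> idn ?y) \<cdot> ?e))"
    by (subst mid_asc) simp_all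
  also have "\<dots> = (idn (?x \<boxtimes> ?y) \<odot> mid ?x ?x ?y ?y) \<cdot> (mid ?x (?x \<boxtimes> ?x) ?y (?y \<boxtimes> ?y) \<cdot> ((idn ?x \<odot> ?d) \<odot> (idn ?y \<odot> ?e))) \<cdot> (?d \<odot> ?e)"
    using cX cY by simp
  also have "mid ?x (?x \<boxtimes> ?x) ?y (?y \<boxtimes> ?y) \<cdot> ((idn ?x \<odot> ?d) \<odot> (idn ?y \<odot> ?e)) = ((idn ?x \<odot> idn ?y) \<odot> (?d \<odot> ?e)) \<cdot> mid ?x ?x ?y ?y"
    by (subst mid_nat) simp_all
  also have "(idn (?x \<boxtimes> ?y) \<odot> mid ?x ?x ?y ?y) \<cdot> (((idn ?x \<odot> idn ?y) \<odot> (?d \<odot> ?e)) \<cdot> mid ?x ?x ?y ?y) \<cdot> (?d \<odot> ?e)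
    = (idn (?x \<boxtimes> ?y) \<odot> (mid ?x ?x ?y ?y \<cdot> (?d \<odot> ?e))) \<cdot> mid ?x ?x ?y ?y \<cdot> (?d \<odot> ?e)" by simp
  finally show "asc (cob (tc X Y)) (cob (tc X Y)) (cob (tc X Y)) \<cdot> (comul (tc X Y) \<odot> idn (cob (tc X Y))) \<cdot> comul (tc X Y)
     = (idn (cob (tc X Y)) \<odot> comul (tc X Y)) \<cdot> comul (tc X Y)" by (simp only: tc_sel)
  have "lun (?x \<boxtimes> ?y) \<cdot> ((lun I \<cdot> (counit X \<odot> counit Y)) \<odot> idn (?x \<boxtimes> ?y)) \<cdot> mid ?x ?x ?y ?y \<cdot> (?d \<odot> ?e)
    = lun (?x \<boxtimes> ?y) \<cdot> (lun I \<odot> idn (?x \<boxtimes> ?y)) \<cdot> (((counit X \<odot> counit Y) \<odot> (idn ?x \<odot> idn ?y)) \<cdot> mid ?x ?x ?y ?y) \<cdot> (?d \<odot> ?e)"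
    by simp
  also have "((counit X \<odot> counit Y) \<odot> (idn ?x \<odot> idn ?y)) \<cdot> mid ?x ?x ?y ?y = mid I ?x I ?y \<cdot> ((counit X \<odot> idn ?x) \<odot> (counit Y \<odot> idn ?y))"
    by (subst mid_nat) simp_all
  also have "lun (?x \<boxtimes> ?y) \<cdot> (lun I \<odot> idn (?x \<boxtimes> ?y)) \<cdot> (mid I ?x I ?y \<cdot> ((counit X \<odot> idn ?x) \<odot> (counit Y \<odot> idn ?y))) \<cdot> (?d \<odot> ?e)
    = (lun (?x \<boxtimes> ?y) \<cdot> (lun I \<odot> idn (?x \<boxtimes> ?y)) \<cdot> mid I ?x I ?y) \<cdot> (((counit X \<odot> idn ?x) \<cdot> ?d) \<odot> ((counit Y \<odot> idn ?y) \<cdot> ?e))"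
    by simp
  also have "\<dots> = idn (?x \<boxtimes> ?y)"
    by (subst lun_mid) (use cX cY in simp_all)
  finally show "lun (cob (tc X Y)) \<cdot> (counit (tc X Y) \<odot> idn (cob (tc X Y))) \<cdot> comul (tc X Y) = idn (cob (tc X Y))"
    by (simp only: tc_sel)
  have "(swp (?x \<boxtimes> ?y) (?x \<boxtimes> ?y) \<cdot> mid ?x ?x ?y ?y) \<cdot> (?d \<odot> ?e) = mid ?x ?x ?y ?y \<cdot> ((swp ?x ?x \<cdot> ?d) \<odot> (swp ?y ?y \<cdot> ?e))"
    by (subst mid_sym) simp_all
  also have "\<dots> = mid ?x ?x ?y ?y \<cdot> (?d \<odot> ?e)" using cX cY by simp
  finally show "swp (cob (tc X Y)) (cob (tc X Y)) \<cdot> comul (tc X Y) = comul (tc X Y)" by simp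
qed

definition snd_ten :: "('o, 'm, 'x) comon_scheme \<Rightarrow> ('o, 'm, 'y) comon_scheme \<Rightarrow> 'm" where
  "snd_ten X Y = lun (cob Y) \<cdot> (counit X \<odot> idn (cob Y))"

definition fst_ten :: "('o, 'm, 'x) comon_scheme \<Rightarrow> ('o, 'm, 'y) comon_scheme \<Rightarrow> 'm" where
  "fst_ten X Y = run (cob X) \<cdot> (idn (cob X) \<odot> counit Y)"

lemma proj_hom [simp]: assumes "comonoid M X" "comonoid M Y"
  shows "snd_ten X Y \<in> Arr M" "Dom M (snd_ten X Y) = cob X \<boxtimes> cob Y" "Cod M (snd_ten X Y) = cob Y"
    "fst_ten X Y \<in> Arr M" "Dom M (fst_ten X Y) = cob X \<boxtimes> cob Y" "Cod M (fst_ten X Y) = cob X"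
  using assms by (simp_all add: snd_ten_def fst_ten_def)

text \<open>Discarding a component is legitimate as soon as it preserves the counit; the component
  that is kept may be any arrow.\<close>

lemma snd_ten_pr: "comonoid M X \<Longrightarrow> comonoid M Y \<Longrightarrow> comonoid M Z \<Longrightarrow> a \<in> Arr M \<Longrightarrow> b \<in> Arr M \<Longrightarrow> Dom M a = cob X \<Longrightarrow> Dom M b = cob X \<Longrightarrow>
    Cod M a = cob Y \<Longrightarrow> Cod M b = cob Z \<Longrightarrow> counit Y \<cdot> a = counit X \<Longrightarrow> snd_ten Y Z \<cdot> pr X a b = b"
  by (simp add: snd_ten_def)

lemma fst_ten_pr: "comonoid M X \<Longrightarrow> comonoid M Y \<Longrightarrow> comonoid M Z \<Longrightarrow> a \<in> Arr M \<Longrightarrow> b \<in> Arr M \<Longrightarrow> Dom M a = cob X \<Longrightarrow> Dom M b = cob X \<Longrightarrow>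
    Cod M a = cob Y \<Longrightarrow> Cod M b = cob Z \<Longrightarrow> counit Z \<cdot> b = counit X \<Longrightarrow> fst_ten Y Z \<cdot> pr X a b = a"
  by (simp add: fst_ten_def)

lemma counit_counit: assumes X: "comonoid M X" shows "lun I \<cdot> (counit X \<odot> counit X) \<cdot> comul X = counit X"
  using lun_pr[OF X, of "counit X" I] X by (simp add: pr_def)

lemma snd_ten_chom: assumes X: "coc X" and Y: "coc Y" shows "chom (tc X Y) Y (snd_ten X Y)"
proof (rule chomI)
  note [simp] = coc_comonoid[OF X] coc_comonoid[OF Y]
  let ?x = "cob X" and ?y = "cob Y" and ?d = "comul X" and ?e = "comul Y"
  have "comul Y \<cdot> snd_ten X Y = (?e \<cdot> lun ?y) \<cdot> (counit X \<odot> idn ?y)" by (simp add: snd_ten_def)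
  also have "?e \<cdot> lun ?y = lun (?y \<boxtimes> ?y) \<cdot> (idn I \<odot> ?e)" by (subst lun_nat') simp_all
  also have "(lun (?y \<boxtimes> ?y) \<cdot> (idn I \<odot> ?e)) \<cdot> (counit X \<odot> idn ?y) = lun (?y \<boxtimes> ?y) \<cdot> ((lun I \<cdot> (counit X \<odot> counit X) \<cdot> ?d) \<odot> ?e)"
    by (simp add: counit_counit)
  also have "\<dots> = (lun (?y \<boxtimes> ?y) \<cdot> (lun I \<odot> idn (?y \<boxtimes> ?y))) \<cdot> (((counit X \<odot> counit X) \<cdot> ?d) \<odot> ?e)"
    by simp
  also have "\<dots> = (lun ?y \<odot> lun ?y) \<cdot> (mid I I ?y ?y \<cdot> ((counit X \<odot> counit X) \<odot> (idn ?y \<odot> idn ?y))) \<cdot> (?d \<odot> ?e)"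
    by (subst lun_lun_mid[symmetric]) simp_all
  also have "mid I I ?y ?y \<cdot> ((counit X \<odot> counit X) \<odot> (idn ?y \<odot> idn ?y)) = ((counit X \<odot> idn ?y) \<odot> (counit X \<odot> idn ?y)) \<cdot> mid ?x ?x ?y ?y"
    by (subst mid_nat) simp_all
  finally show "comul Y \<cdot> snd_ten X Y = (snd_ten X Y \<odot> snd_ten X Y) \<cdot> comul (tc X Y)"
    by (simp add: snd_ten_def)
  have "counit Y \<cdot> snd_ten X Y = (counit Y \<cdot> lun ?y) \<cdot> (counit X \<odot> idn ?y)" by (simp add: snd_ten_def)
  also have "counit Y \<cdot> lun ?y = lun I \<cdot> (idn I \<odot> counit Y)" by (subst lun_nat') simp_all
  finally show "counit Y \<cdot> snd_ten X Y = counit (tc X Y)" by simp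
qed (use X Y in simp_all)

lemma sym_chom: assumes X: "coc X" and Y: "coc Y" shows "chom (tc X Y) (tc Y X) (swp (cob X) (cob Y))"
proof (rule chomI)
  note [simp] = coc_comonoid[OF X] coc_comonoid[OF Y]
  let ?x = "cob X" and ?y = "cob Y" and ?d = "comul X" and ?e = "comul Y"
  have "mid ?y ?y ?x ?x \<cdot> ((?e \<odot> ?d) \<cdot> swp ?x ?y) = mid ?y ?y ?x ?x \<cdot> (swp (?x \<boxtimes> ?x) (?y \<boxtimes> ?y) \<cdot> (?d \<odot> ?e))"
    by (subst sym_nat') simp_all
  also have "\<dots> = (mid ?y ?y ?x ?x \<cdot> swp (?x \<boxtimes> ?x) (?y \<boxtimes> ?y)) \<cdot> (?d \<odot> ?e)" by simp
  also have "\<dots> = (swp ?x ?y \<odot> swp ?x ?y) \<cdot> mid ?x ?x ?y ?y \<cdot> (?d \<odot> ?e)" by (subst mid_sym') simp_all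
  finally show "comul (tc Y X) \<cdot> swp (cob X) (cob Y) = (swp (cob X) (cob Y) \<odot> swp (cob X) (cob Y)) \<cdot> comul (tc X Y)"
    by simp
  have "(counit Y \<odot> counit X) \<cdot> swp ?x ?y = swp I I \<cdot> (counit X \<odot> counit Y)" by (subst sym_nat') simp_all
  then show "counit (tc Y X) \<cdot> swp (cob X) (cob Y) = counit (tc X Y)" by (simp add: sym_unit)
qed (use X Y in simp_all)

text \<open>The first projection is the second one after the symmetry, which is a comonoid morphism
  by \<open>mid_sym'\<close>.\<close>

lemma fst_ten_chom: assumes X: "coc X" and Y: "coc Y" shows "chom (tc X Y) X (fst_ten X Y)"
proof -
  note [simp] = coc_comonoid[OF X] coc_comonoid[OF Y]
  have "snd_ten Y X \<cdot> swp (cob X) (cob Y) = lun (cob X) \<cdot> ((counit Y \<odot> idn (cob X)) \<cdot> swp (cob X) (cob Y))"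
    by (simp add: snd_ten_def)
  also have "\<dots> = (lun (cob X) \<cdot> swp (cob X) I) \<cdot> (idn (cob X) \<odot> counit Y)"
    using sym_nat'[of "idn (cob X)" "counit Y" "cob X" I] by simp
  also have "\<dots> = fst_ten X Y" by (simp add: lun_sym fst_ten_def)
  finally have "fst_ten X Y = snd_ten Y X \<cdot> swp (cob X) (cob Y)" by simp
  then show ?thesis
    using chom_comp[OF sym_chom[OF X Y] snd_ten_chom[OF Y X]] X Y by simp
qed

text \<open>The counits hit the two middle factors, where \<open>mid\<close> becomes the identity.
  This makes elements available on a tensor product: an arrow out of it may be precomposed with this
  pair and then computed on components.\<close>

lemma pr_fst_snd: assumes X: "coc X" and Y: "coc Y" shows "pr (tc X Y) (fst_ten X Y) (snd_ten X Y) = idn (cob X \<boxtimes> cob Y)"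
proof -
  note [simp] = coc_comonoid[OF X] coc_comonoid[OF Y]
  note cX = X[unfolded coc_def comonoid_def] and cY = Y[unfolded coc_def comonoid_def]
  let ?x = "cob X" and ?y = "cob Y" and ?d = "comul X" and ?e = "comul Y"
  have "pr (tc X Y) (fst_ten X Y) (snd_ten X Y) = (run ?x \<odot> lun ?y) \<cdot> (((idn ?x \<odot> counit Y) \<odot> (counit X \<odot> idn ?y)) \<cdot> mid ?x ?x ?y ?y) \<cdot> (?d \<odot> ?e)"
    by (simp add: pr_def fst_ten_def snd_ten_def)
  also have "((idn ?x \<odot> counit Y) \<odot> (counit X \<odot> idn ?y)) \<cdot> mid ?x ?x ?y ?y = mid ?x I I ?y \<cdot> ((idn ?x \<odot> counit X) \<odot> (counit Y \<odot> idn ?y))"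
    by (subst mid_nat) simp_all
  also have "(run ?x \<odot> lun ?y) \<cdot> (mid ?x I I ?y \<cdot> ((idn ?x \<odot> counit X) \<odot> (counit Y \<odot> idn ?y))) \<cdot> (?d \<odot> ?e)
     = (run ?x \<cdot> (idn ?x \<odot> counit X) \<cdot> ?d) \<odot> (lun ?y \<cdot> (counit Y \<odot> idn ?y) \<cdot> ?e)"
    by (simp add: mid_unit)
  also have "\<dots> = idn (?x \<boxtimes> ?y)" using cX cY by simp
  finally show ?thesis .
qed

text \<open>Comultiplying both components of the pair gives \<open>((a, a), (b, b))\<close>, which
  \<open>mid\<close> regroups to \<open>((a, b), (a, b))\<close>; cocommutativity of
  \<open>X\<close> permits the regrouping.\<close>

lemma pr_chom: assumes X: "coc X" and A: "comonoid M A" and B: "comonoid M B" and a: "chom X A a" and b: "chom X B b"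
  shows "chom X (tc A B) (pr X a b)"
proof (rule chomI)
  note [simp] = X coc_comonoid[OF X] A B chomD(1-3)[OF a] chomD(1-3)[OF b] chomD(5)[OF a] chomD(5)[OF b] comul_cmp[OF a] comul_cmp[OF b]
  show "comul (tc A B) \<cdot> pr X a b = (pr X a b \<odot> pr X a b) \<cdot> comul X"
    unfolding pr_def[of X "pr X a b" "pr X a b", symmetric] by simp
qed (use X A B chomD(1-3)[OF a] chomD(1-3)[OF b] chomD(5)[OF a] chomD(5)[OF b] in simp_all)

declare tc_sel(2,3) [simp del]

lemma ten_pr_ext [simp]: "comonoid M X \<Longrightarrow> a \<in> Arr M \<Longrightarrow> b \<in> Arr M \<Longrightarrow> Dom M a = cob X \<Longrightarrow> Dom M b = cob X \<Longrightarrow>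
    u \<in> Arr M \<Longrightarrow> v \<in> Arr M \<Longrightarrow> Dom M u = Cod M a \<Longrightarrow> Dom M v = Cod M b \<Longrightarrow> r \<in> Arr M \<Longrightarrow> Cod M r = cob X \<Longrightarrow>
    (u \<odot> v) \<cdot> pr X a b \<cdot> r = pr X (u \<cdot> a) (v \<cdot> b) \<cdot> r"
  by (rule cmp_ext) simp_all

lemma chom_inverse: assumes h: "chom X Y h" and X: "comonoid M X" and Y: "comonoid M Y"
    and g: "g \<in> Arr M" "Dom M g = cob Y" "Cod M g = cob X" "g \<cdot> h = idn (cob X)" "h \<cdot> g = idn (cob Y)"
  shows "chom Y X g"
proof (rule chomI)
  note [simp] = chomD(1-3)[OF h] X Y g(1-3)
  have "(g \<odot> g) \<cdot> comul Y = (g \<odot> g) \<cdot> comul Y \<cdot> (h \<cdot> g)" by (simp add: g(5))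
  also have "\<dots> = (g \<odot> g) \<cdot> (comul Y \<cdot> h) \<cdot> g" by simp
  also have "\<dots> = (g \<odot> g) \<cdot> (h \<odot> h) \<cdot> comul X \<cdot> g" by (subst chomD(4)[OF h]) simp
  also have "\<dots> = comul X \<cdot> g" by (simp add: g(4))
  finally show "comul X \<cdot> g = (g \<odot> g) \<cdot> comul Y" by simp
  have "counit X \<cdot> g = (counit Y \<cdot> h) \<cdot> g" by (simp only: chomD(5)[OF h])
  also have "\<dots> = counit Y" by (simp add: g(5))
  finally show "counit X \<cdot> g = counit Y" .
qed (use g in simp_all)

subsection \<open>Equalizers of cocommutative comonoids\<close>

text \<open>A subobject \<open>j\<close> of a cocommutative comonoid that is a left coideal is a subcomonoid: by cocommutativity
  it is a right coideal as well, and \<open>K \<otimes> K\<close> is the intersection of \<open>X \<otimes> K\<close> and \<open>K \<otimes> X\<close>.\<close>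

lemma coideal_subcomonoid:
  assumes X: "coc X" and j: "is_mono M j" "Cod M j = cob X"
    and x: "x \<in> Arr M" "Dom M x = Dom M j" "Cod M x = cob X \<boxtimes> Dom M j" "(idn (cob X) \<odot> j) \<cdot> x = comul X \<cdot> j"
  obtains K :: "('o, 'm) comon" where "coc K" "cob K = Dom M j" "chom K X j"
proof -
  let ?x = "cob X" and ?k = "Dom M j"
  note cX = X[unfolded coc_def comonoid_def cocommutative_def]
  note [simp] = coc_comonoid[OF X] mono_arr[OF j(1)] j(2) x(1-3)
  obtain q where q: "is_cokernel M q j" using ex_cokernel mono_arr[OF j(1)] by blast
  note jq = mono_kernel_of_cokernel[OF j(1) q]
  note [simp] = cokernelD(2)[OF q] and [simp] = cokernelD(3)[OF q, simplified]
  let ?q = "Cod M q"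
  have [simp]: "?k \<in> Ob M" "?q \<in> Ob M" by simp_all
  \<comment> \<open>The aim is that the first leg of \<open>x\<close> lies in \<open>j\<close> too,
    i.e. that \<open>q \<odot> idn ?k\<close> annihilates \<open>x\<close>. After embedding the
    second leg, the symmetry exchanges the legs of the comultiplication, and \<open>q\<close> meets
    \<open>j\<close>.\<close>
  have "(idn ?q \<odot> j) \<cdot> (q \<odot> idn ?k) \<cdot> x = (q \<odot> idn ?x) \<cdot> ((idn ?x \<odot> j) \<cdot> x)" by simp
  also have "\<dots> = (q \<odot> idn ?x) \<cdot> comul X \<cdot> j" by (simp add: x(4))
  also have "\<dots> = (q \<odot> idn ?x) \<cdot> (swp ?x ?x \<cdot> comul X) \<cdot> j" using cX by simp
  also have "\<dots> = ((q \<odot> idn ?x) \<cdot> swp ?x ?x) \<cdot> comul X \<cdot> j" by simp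
  also have "(q \<odot> idn ?x) \<cdot> swp ?x ?x = swp ?x ?q \<cdot> (idn ?x \<odot> q)" by (subst sym_nat') simp_all
  also have "(swp ?x ?q \<cdot> (idn ?x \<odot> q)) \<cdot> comul X \<cdot> j = swp ?x ?q \<cdot> (idn ?x \<odot> q) \<cdot> comul X \<cdot> j" by simp
  also have "\<dots> = swp ?x ?q \<cdot> (idn ?x \<odot> (q \<cdot> j)) \<cdot> x" by (simp flip: x(4))
  also have "idn ?x \<odot> (q \<cdot> j) = Zer M (?x \<boxtimes> ?k) (?x \<boxtimes> ?q)"
    using kernel_zero[OF ten_id_kernel(1)[OF jq, of ?x]] by simp
  finally have "(idn ?q \<odot> j) \<cdot> (q \<odot> idn ?k) \<cdot> x = (idn ?q \<odot> j) \<cdot> Zer M ?k (?q \<boxtimes> ?k)" by simp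
  then have "(q \<odot> idn ?k) \<cdot> x = Zer M ?k (?q \<boxtimes> ?k)"
    using mono_cancel[OF ten_id_mono(1)[OF j(1), of ?q], of "(q \<odot> idn ?k) \<cdot> x" "Zer M ?k (?q \<boxtimes> ?k)"] by simp
  \<comment> \<open>By exactness \<open>j \<odot> idn ?k\<close> is a kernel of
    \<open>q \<odot> idn ?k\<close>. The lift \<open>d\<close> of \<open>x\<close> is the restricted
    comultiplication.\<close>
  then obtain d where d [simp]: "d \<in> Arr M" "Dom M d = ?k" "Cod M d = ?k \<boxtimes> ?k" and dx: "(j \<odot> idn ?k) \<cdot> d = x"
    using kernel_factor[OF ten_id_kernel(2)[OF jq, of ?k], of x] by auto
  have "(j \<odot> j) \<cdot> d = (idn ?x \<odot> j) \<cdot> (j \<odot> idn ?k) \<cdot> d" by simp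
  then have jd: "(j \<odot> j) \<cdot> d = comul X \<cdot> j" by (simp only: dx x(4))
  define K :: "('o, 'm) comon" where "K = \<lparr>cob = ?k, comul = d, counit = counit X \<cdot> j\<rparr>"
  have [simp]: "cob K = ?k" "comul K = d" "counit K = counit X \<cdot> j" by (simp_all add: K_def)
  have jjj: "is_mono M (j \<odot> j \<odot> j)" by (intro ten_mono j)
  have "coc K"
  proof (rule cocI)
    have "(j \<odot> j \<odot> j) \<cdot> asc ?k ?k ?k \<cdot> (d \<odot> idn ?k) \<cdot> d = ((j \<odot> j \<odot> j) \<cdot> asc ?k ?k ?k) \<cdot> (d \<odot> idn ?k) \<cdot> d" by simp
    also have "(j \<odot> j \<odot> j) \<cdot> asc ?k ?k ?k = asc ?x ?x ?x \<cdot> ((j \<odot> j) \<odot> j)" by (subst asc_nat') simp_all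
    also have "(asc ?x ?x ?x \<cdot> ((j \<odot> j) \<odot> j)) \<cdot> (d \<odot> idn ?k) \<cdot> d = asc ?x ?x ?x \<cdot> (((j \<odot> j) \<cdot> d) \<odot> j) \<cdot> d" by simp
    also have "\<dots> = asc ?x ?x ?x \<cdot> ((comul X \<cdot> j) \<odot> j) \<cdot> d" unfolding jd ..
    also have "\<dots> = asc ?x ?x ?x \<cdot> (comul X \<odot> idn ?x) \<cdot> ((j \<odot> j) \<cdot> d)" by simp
    also have "\<dots> = (asc ?x ?x ?x \<cdot> (comul X \<odot> idn ?x) \<cdot> comul X) \<cdot> j" unfolding jd by simp
    also have "\<dots> = (idn ?x \<odot> comul X) \<cdot> comul X \<cdot> j" using cX by simp
    also have "\<dots> = (j \<odot> ((j \<odot> j) \<cdot> d)) \<cdot> d" by (simp flip: jd)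
    also have "\<dots> = (j \<odot> j \<odot> j) \<cdot> (idn ?k \<odot> d) \<cdot> d" by simp
    finally show "asc (cob K) (cob K) (cob K) \<cdot> (comul K \<odot> idn (cob K)) \<cdot> comul K = (idn (cob K) \<odot> comul K) \<cdot> comul K"
      using mono_cancel[OF jjj, of "asc ?k ?k ?k \<cdot> (d \<odot> idn ?k) \<cdot> d" "(idn ?k \<odot> d) \<cdot> d"] by simp
    have "j \<cdot> lun ?k \<cdot> ((counit X \<cdot> j) \<odot> idn ?k) \<cdot> d = (j \<cdot> lun ?k) \<cdot> ((counit X \<cdot> j) \<odot> idn ?k) \<cdot> d" by simp
    also have "j \<cdot> lun ?k = lun ?x \<cdot> (idn I \<odot> j)" by (subst lun_nat') simp_all
    also have "(lun ?x \<cdot> (idn I \<odot> j)) \<cdot> ((counit X \<cdot> j) \<odot> idn ?k) \<cdot> d = lun ?x \<cdot> (counit X \<odot> idn ?x) \<cdot> ((j \<odot> j) \<cdot> d)"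
      by simp
    also have "\<dots> = (lun ?x \<cdot> (counit X \<odot> idn ?x) \<cdot> comul X) \<cdot> j" unfolding jd by simp
    also have "\<dots> = j" using cX by simp
    finally show "lun (cob K) \<cdot> (counit K \<odot> idn (cob K)) \<cdot> comul K = idn (cob K)"
      using mono_cancel[OF j(1), of "lun ?k \<cdot> ((counit X \<cdot> j) \<odot> idn ?k) \<cdot> d" "idn ?k"] by simp
    have "(j \<odot> j) \<cdot> swp ?k ?k \<cdot> d = ((j \<odot> j) \<cdot> swp ?k ?k) \<cdot> d" by simp
    also have "(j \<odot> j) \<cdot> swp ?k ?k = swp ?x ?x \<cdot> (j \<odot> j)" by (subst sym_nat') simp_all
    also have "(swp ?x ?x \<cdot> (j \<odot> j)) \<cdot> d = swp ?x ?x \<cdot> ((j \<odot> j) \<cdot> d)" by simp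
    also have "\<dots> = (swp ?x ?x \<cdot> comul X) \<cdot> j" unfolding jd by simp
    also have "\<dots> = (j \<odot> j) \<cdot> d" using cX by (simp add: jd)
    finally show "swp (cob K) (cob K) \<cdot> comul K = comul K"
      using mono_cancel[OF ten_mono[OF j(1) j(1)], of "swp ?k ?k \<cdot> d" d] by simp
  qed simp_all
  moreover have "chom K X j" by (rule chomI) (simp_all add: jd)
  ultimately show thesis by (intro that) simp_all
qed

text \<open>Compatibility with the comultiplications is tested after \<open>j \<odot> j\<close>,
  which is mono by exactness of the tensor product.\<close>

lemma mono_chom_factor: assumes j: "is_mono M j" "chom K X j" and w: "chom Z X w" and v: "v \<in> Arr M" "Dom M v = cob Z" "Cod M v = cob K" "j \<cdot> v = w"
    and [simp]: "comonoid M X" "comonoid M K" "comonoid M Z"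
  shows "chom Z K v"
proof (rule chomI)
  note [simp] = chomD(1-3)[OF j(2)] chomD(1-3)[OF w] v(1-3)
  have "(j \<odot> j) \<cdot> comul K \<cdot> v = ((j \<odot> j) \<cdot> comul K) \<cdot> v" by simp
  also have "\<dots> = comul X \<cdot> w" by (simp add: v(4) flip: chomD(4)[OF j(2)])
  also have "\<dots> = (j \<odot> j) \<cdot> (v \<odot> v) \<cdot> comul Z" by (simp add: chomD(4)[OF w] v(4))
  finally show "comul K \<cdot> v = (v \<odot> v) \<cdot> comul Z"
    using mono_cancel[OF ten_mono[OF j(1) j(1)], of "comul K \<cdot> v" "(v \<odot> v) \<cdot> comul Z"] by simp
  have "counit K \<cdot> v = counit X \<cdot> j \<cdot> v" by (simp flip: chomD(5)[OF j(2)])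
  then show "counit K \<cdot> v = counit Z" by (simp add: v(4) chomD(5)[OF w])
qed (use v in simp_all)

text \<open>The equalizer of \<open>u\<close> and \<open>v\<close> in \<open>M\<close> need not be a
  subcomonoid. The equalizer of their graphs is a left coideal, to which
  \<open>coideal_subcomonoid\<close> applies; the counit on the first component then recovers
  \<open>u \<cdot> e = v \<cdot> e\<close>.\<close>

lemma comonoid_equalizer:
  assumes X: "coc X" and Y: "coc Y" and u: "chom X Y u" and v: "chom X Y v"
    and e: "is_equalizer M e (pr X (idn (cob X)) u) (pr X (idn (cob X)) v)"
  shows "\<exists>K :: ('o, 'm) comon. coc K \<and> cob K = Dom M e \<and> chom K X e \<and> u \<cdot> e = v \<cdot> e \<and>
    (\<forall>(Z :: ('o, 'm) comon) w. coc Z \<longrightarrow> chom Z X w \<longrightarrow> u \<cdot> w = v \<cdot> w \<longrightarrow> (\<exists>w'. chom Z K w' \<and> e \<cdot> w' = w))"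
proof -
  let ?x = "cob X" and ?y = "cob Y"
  let ?u = "pr X (idn ?x) u" and ?v = "pr X (idn ?x) v"
  note [simp] = X Y coc_comonoid[OF X] coc_comonoid[OF Y] chomD(1-3)[OF u] chomD(1-3)[OF v] chomD(5)[OF u] chomD(5)[OF v]
  note [simp] = equalizerD(5)[OF e] equalizerD(6)[OF e, simplified]
  note ee = equalizerD(7)[OF e]
  \<comment> \<open>By coassociativity, comultiplying before forming the graph agrees with
    comultiplying the first component afterwards. Hence \<open>comul X \<cdot> e\<close> equalizes
    the pair tensored with \<open>idn ?x\<close> and factors through
    \<open>idn ?x \<odot> e\<close>: the coideal property.\<close>
  have co: "(idn ?x \<odot> pr X (idn ?x) u) \<cdot> comul X = asc ?x ?x ?y \<cdot> (comul X \<odot> idn ?y) \<cdot> pr X (idn ?x) u"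
    if [simp]: "u \<in> Arr M" "Dom M u = ?x" "Cod M u = ?y" for u
  proof -
    have "asc ?x ?x ?y \<cdot> (comul X \<odot> idn ?y) \<cdot> pr X (idn ?x) u = asc ?x ?x ?y \<cdot> pr X (pr X (idn ?x) (idn ?x)) u"
      by (simp add: comul_pr)
    also have "\<dots> = (idn ?x \<odot> pr X (idn ?x) u) \<cdot> pr X (idn ?x) (idn ?x)" by simp
    finally show ?thesis by (simp add: comul_pr)
  qed
  have "(idn ?x \<odot> ?u) \<cdot> comul X \<cdot> e = ((idn ?x \<odot> ?u) \<cdot> comul X) \<cdot> e" by simp
  also have "\<dots> = asc ?x ?x ?y \<cdot> (comul X \<odot> idn ?y) \<cdot> (?u \<cdot> e)" by (subst co) simp_all
  also have "\<dots> = ((idn ?x \<odot> ?v) \<cdot> comul X) \<cdot> e" unfolding ee by (subst co) simp_all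
  also have "\<dots> = (idn ?x \<odot> ?v) \<cdot> comul X \<cdot> e" by simp
  finally obtain x where x: "x \<in> Arr M" "Dom M x = Dom M e" "Cod M x = ?x \<boxtimes> Dom M e" "(idn ?x \<odot> e) \<cdot> x = comul X \<cdot> e"
    using equalizer_factor[OF ten_id_equalizer[OF e, of ?x], of "comul X \<cdot> e"] by auto
  obtain K :: "('o, 'm) comon" where K: "coc K" "cob K = Dom M e" "chom K X e"
    using coideal_subcomonoid[OF X equalizer_mono[OF e] _ x] by auto
  have "lun ?y \<cdot> (counit X \<odot> idn ?y) \<cdot> (?u \<cdot> e) = lun ?y \<cdot> (counit X \<odot> idn ?y) \<cdot> (?v \<cdot> e)" unfolding ee ..
  then have "(lun ?y \<cdot> (counit X \<odot> idn ?y) \<cdot> ?u) \<cdot> e = (lun ?y \<cdot> (counit X \<odot> idn ?y) \<cdot> ?v) \<cdot> e"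
    by (simp del: ten_pr ten_pr_ext)
  then have uv: "u \<cdot> e = v \<cdot> e" by simp
  have "\<exists>w'. chom Z K w' \<and> e \<cdot> w' = w" if Z: "coc Z" and w: "chom Z X w" and uw: "u \<cdot> w = v \<cdot> w"
    for Z :: "('o, 'm) comon" and w
  proof -
    note [simp] = chomD(1-3)[OF w] coc_comonoid[OF Z]
    have "?u \<cdot> w = ?v \<cdot> w" by (simp add: pr_cmp[OF w] uw)
    then obtain w' where w': "w' \<in> Arr M" "Dom M w' = cob Z" "Cod M w' = Dom M e" "e \<cdot> w' = w"
      using equalizer_factor[OF e, of w] by auto
    then have "chom Z K w'" using mono_chom_factor[OF equalizer_mono[OF e] K(3) w] K Z X by simp
    with w' show ?thesis by blast
  qed
  with K uv show ?thesis by blast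
qed

subsection \<open>Convolution\<close>

definition cv :: "('o, 'm) hopf \<Rightarrow> ('o, 'm, 'y) comon_scheme \<Rightarrow> 'm \<Rightarrow> 'm \<Rightarrow> 'm" where
  "cv A X a b = mul A \<cdot> pr X a b"

lemma hopf_comonoid [simp]: "hopf_monoid M A \<Longrightarrow> comonoid M A"
  unfolding hopf_monoid_def by blast

lemma hopf_ops [simp]: assumes "hopf_monoid M A"
  shows "mul A \<in> Arr M" "Dom M (mul A) = cob A \<boxtimes> cob A" "Cod M (mul A) = cob A"
    "unit A \<in> Arr M" "Dom M (unit A) = I" "Cod M (unit A) = cob A"
    "antipode A \<in> Arr M" "Dom M (antipode A) = cob A" "Cod M (antipode A) = cob A"
  using assms unfolding hopf_monoid_def Hom_iff by blast+

lemma hopf_laws: assumes "hopf_monoid M A"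
  shows mul_assoc: "mul A \<cdot> (mul A \<odot> idn (cob A)) = mul A \<cdot> (idn (cob A) \<odot> mul A) \<cdot> asc (cob A) (cob A) (cob A)"
    and mul_unit_left: "mul A \<cdot> (unit A \<odot> idn (cob A)) = lun (cob A)"
    and mul_unit_right: "mul A \<cdot> (idn (cob A) \<odot> unit A) = run (cob A)"
    and comul_mul: "comul A \<cdot> mul A = (mul A \<odot> mul A) \<cdot> mid (cob A) (cob A) (cob A) (cob A) \<cdot> (comul A \<odot> comul A)"
    and comul_unit: "comul A \<cdot> unit A = (unit A \<odot> unit A) \<cdot> inv_arr M (lun I)"
    and counit_mul: "counit A \<cdot> mul A = lun I \<cdot> (counit A \<odot> counit A)"
    and counit_unit: "counit A \<cdot> unit A = idn I"
    and antipode_left: "mul A \<cdot> (antipode A \<odot> idn (cob A)) \<cdot> comul A = unit A \<cdot> counit A"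
    and antipode_right: "mul A \<cdot> (idn (cob A) \<odot> antipode A) \<cdot> comul A = unit A \<cdot> counit A"
  using assms unfolding hopf_monoid_def by blast+

lemma mul_chom: "hopf_monoid M A \<Longrightarrow> chom (tc A A) A (mul A)"
  by (rule chomI) (simp_all add: comul_mul counit_mul tc_sel)

context
  fixes A :: "('o, 'm) hopf" and X :: "('o, 'm, 'y) comon_scheme"
  assumes A: "hopf_monoid M A" and X: "comonoid M X"
begin

lemmas [simp] = A X

lemma cv_hom [simp]: assumes "a \<in> Arr M" "b \<in> Arr M" "Dom M a = cob X" "Dom M b = cob X" "Cod M a = cob A" "Cod M b = cob A"
  shows "cv A X a b \<in> Arr M" "Dom M (cv A X a b) = cob X" "Cod M (cv A X a b) = cob A"
  using assms by (simp_all add: cv_def)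

lemma cv_assoc:
  assumes [simp]: "a \<in> Arr M" "b \<in> Arr M" "c \<in> Arr M" "Dom M a = cob X" "Dom M b = cob X" "Dom M c = cob X"
    "Cod M a = cob A" "Cod M b = cob A" "Cod M c = cob A"
  shows "cv A X (cv A X a b) c = cv A X a (cv A X b c)"
proof -
  have "cv A X (cv A X a b) c = (mul A \<cdot> (mul A \<odot> idn (cob A))) \<cdot> pr X (pr X a b) c" by (simp add: cv_def)
  also have "\<dots> = cv A X a (cv A X b c)" by (subst mul_assoc) (simp_all add: cv_def)
  finally show ?thesis .
qed

lemma cv_unit_left:
  assumes [simp]: "a \<in> Arr M" "Dom M a = cob X" "Cod M a = cob A"
  shows "cv A X (unit A \<cdot> counit X) a = a"
proof -
  have "cv A X (unit A \<cdot> counit X) a = (mul A \<cdot> (unit A \<odot> idn (cob A))) \<cdot> pr X (counit X) a" by (simp add: cv_def)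
  also have "\<dots> = a" by (subst mul_unit_left) simp_all
  finally show ?thesis .
qed

lemma cv_unit_right:
  assumes [simp]: "a \<in> Arr M" "Dom M a = cob X" "Cod M a = cob A"
  shows "cv A X a (unit A \<cdot> counit X) = a"
proof -
  have "cv A X a (unit A \<cdot> counit X) = (mul A \<cdot> (idn (cob A) \<odot> unit A)) \<cdot> pr X a (counit X)" by (simp add: cv_def)
  also have "\<dots> = a" by (subst mul_unit_right) simp_all
  finally show ?thesis .
qed

lemma cv_antipode:
  assumes a: "chom X A a"
  shows "cv A X (antipode A \<cdot> a) a = unit A \<cdot> counit X" "cv A X a (antipode A \<cdot> a) = unit A \<cdot> counit X"
proof -
  note [simp] = chomD(1-3)[OF a]
  have "cv A X (antipode A \<cdot> a) a = mul A \<cdot> (antipode A \<odot> idn (cob A)) \<cdot> pr X a a" by (simp add: cv_def)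
  also have "\<dots> = (mul A \<cdot> (antipode A \<odot> idn (cob A)) \<cdot> comul A) \<cdot> a" by (simp flip: comul_cmp[OF a] del: ten_pr)
  also have "\<dots> = (unit A \<cdot> counit A) \<cdot> a" by (simp only: antipode_left[OF A])
  finally show "cv A X (antipode A \<cdot> a) a = unit A \<cdot> counit X" by (simp add: chomD(5)[OF a])
  have "cv A X a (antipode A \<cdot> a) = mul A \<cdot> (idn (cob A) \<odot> antipode A) \<cdot> pr X a a" by (simp add: cv_def)
  also have "\<dots> = (mul A \<cdot> (idn (cob A) \<odot> antipode A) \<cdot> comul A) \<cdot> a" by (simp flip: comul_cmp[OF a] del: ten_pr)
  also have "\<dots> = (unit A \<cdot> counit A) \<cdot> a" by (simp only: antipode_right[OF A])
  finally show "cv A X a (antipode A \<cdot> a) = unit A \<cdot> counit X" by (simp add: chomD(5)[OF a])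
qed

text \<open>A left and a right inverse of \<open>b\<close> are both equal to the product of all
  three arrows.\<close>

lemma cv_inverse_unique:
  assumes [simp]: "a \<in> Arr M" "b \<in> Arr M" "c \<in> Arr M" "Dom M a = cob X" "Dom M b = cob X" "Dom M c = cob X"
    "Cod M a = cob A" "Cod M b = cob A" "Cod M c = cob A"
    and "cv A X a b = unit A \<cdot> counit X" "cv A X b c = unit A \<cdot> counit X"
  shows "a = c"
  using cv_assoc[of a b c] assms(10-) by (simp add: cv_unit_left cv_unit_right)

lemma hopf_hom_cv:
  assumes f: "hopf_hom M A B f" and B: "hopf_monoid M B"
    and [simp]: "a \<in> Arr M" "b \<in> Arr M" "Dom M a = cob X" "Dom M b = cob X" "Cod M a = cob A" "Cod M b = cob A"
  shows "f \<cdot> cv A X a b = cv B X (f \<cdot> a) (f \<cdot> b)"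
proof -
  have c: "chom A B f" and m: "f \<cdot> mul A = mul B \<cdot> (f \<odot> f)" using f by (auto simp: hopf_hom_def)
  note [simp] = chomD(1-3)[OF c] B
  have "f \<cdot> cv A X a b = (f \<cdot> mul A) \<cdot> pr X a b" by (simp add: cv_def)
  then show ?thesis by (simp add: m cv_def)
qed

lemma hopf_hom_unit_counit:
  assumes f: "hopf_hom M A B f" shows "f \<cdot> unit A \<cdot> counit X = unit B \<cdot> counit X"
proof -
  have c: "chom A B f" and m: "f \<cdot> unit A = unit B" using f by (auto simp: hopf_hom_def)
  note [simp] = chomD(1-3)[OF c]
  have "f \<cdot> unit A \<cdot> counit X = (f \<cdot> unit A) \<cdot> counit X" by simp
  then show ?thesis by (simp only: m)
qed

end

lemma unit_counit_chom: assumes A: "hopf_monoid M A" and X: "comonoid M X"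
  shows "chom X A (unit A \<cdot> counit X)"
proof (rule chomI)
  note [simp] = A X
  have "(counit X \<odot> counit X) \<cdot> comul X = inv_arr M (lun I) \<cdot> (lun I \<cdot> (counit X \<odot> counit X) \<cdot> comul X)"
    by simp
  also have "\<dots> = inv_arr M (lun I) \<cdot> counit X" by (simp only: counit_counit[OF X])
  finally have "(counit X \<odot> counit X) \<cdot> comul X = inv_arr M (lun I) \<cdot> counit X" .
  note ee = this
  have "comul A \<cdot> unit A \<cdot> counit X = (comul A \<cdot> unit A) \<cdot> counit X" by simp
  also have "\<dots> = (unit A \<odot> unit A) \<cdot> (inv_arr M (lun I) \<cdot> counit X)" unfolding comul_unit[OF A] by simp
  also have "\<dots> = (unit A \<odot> unit A) \<cdot> ((counit X \<odot> counit X) \<cdot> comul X)" unfolding ee ..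
  also have "\<dots> = ((unit A \<cdot> counit X) \<odot> (unit A \<cdot> counit X)) \<cdot> comul X" by simp
  finally show "comul A \<cdot> unit A \<cdot> counit X = ((unit A \<cdot> counit X) \<odot> (unit A \<cdot> counit X)) \<cdot> comul X" .
  have "counit A \<cdot> unit A \<cdot> counit X = (counit A \<cdot> unit A) \<cdot> counit X" by simp
  also have "\<dots> = counit X" unfolding counit_unit[OF A] by simp
  finally show "counit A \<cdot> unit A \<cdot> counit X = counit X" .
  show "unit A \<cdot> counit X \<in> Arr M" "Dom M (unit A \<cdot> counit X) = cob X" "Cod M (unit A \<cdot> counit X) = cob A" by simp_all
qed

lemma cv_chom: assumes A: "hopf_monoid M A" and X: "coc X" and a: "chom X A a" and b: "chom X A b" "coc A"
  shows "chom X A (cv A X a b)"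
  unfolding cv_def
  by (rule chom_comp[OF pr_chom[OF X _ _ a b(1)] mul_chom[OF A]]) (simp_all add: A X b)

text \<open>The left side is a left and the right side a right convolution inverse of
  \<open>f\<close>. Morphisms are defined by their monoid and comonoid conditions, so this has to be
  derived.\<close>

lemma hopf_hom_antipode: assumes A: "hopf_monoid M A" and B: "hopf_monoid M B" and f: "hopf_hom M A B f"
  shows "f \<cdot> antipode A = antipode B \<cdot> f"
proof -
  have c: "chom A B f" using f by (simp add: hopf_hom_def)
  note [simp] = A B chomD(1-3)[OF c]
  show ?thesis
  proof (rule cv_inverse_unique[of B A _ f])
    have "cv B A (f \<cdot> antipode A) (f \<cdot> idn (cob A)) = f \<cdot> cv A A (antipode A \<cdot> idn (cob A)) (idn (cob A))"
      by (subst hopf_hom_cv[of A A B f]) (simp_all add: f)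
    also have "\<dots> = unit B \<cdot> counit A"
      by (subst cv_antipode[OF A _ chom_id]) (simp_all add: hopf_hom_unit_counit[OF A _ f])
    finally show "cv B A (f \<cdot> antipode A) f = unit B \<cdot> counit A" by simp
    show "cv B A f (antipode B \<cdot> f) = unit B \<cdot> counit A" by (simp add: cv_antipode c)
  qed simp_all
qed

text \<open>The antipode of a cocommutative Hopf monoid is a comonoid morphism: it is read off from the inverse
  \<open>(a, b) \<mapsto> (a, S a b)\<close> of the comonoid morphism \<open>(a, b) \<mapsto> (a, a b)\<close>.\<close>

lemma antipode_chom: assumes A: "hopf_monoid M A" and cA: "coc A" shows "chom A A (antipode A)"
proof -
  let ?a = "cob A" and ?X = "tc A A" and ?p = "fst_ten A A" and ?q = "snd_ten A A"
  note [simp] = A cA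
  have X: "coc ?X" by simp
  note p = fst_ten_chom[OF cA cA] and q = snd_ten_chom[OF cA cA]
  have [simp]: "comonoid M ?X" using X by (rule coc_comonoid)
  define h where "h = pr ?X ?p (mul A)"
  define g where "g = (idn ?a \<odot> mul A) \<cdot> asc ?a ?a ?a \<cdot> (((idn ?a \<odot> antipode A) \<cdot> comul A) \<odot> idn ?a)"
  \<comment> \<open>\<open>h'\<close> is \<open>h\<close> written with structure maps. In this form
    it can be evaluated on a pair whose second component is not known to be a comonoid morphism, as
    needed for \<open>h \<cdot> g\<close>, where \<open>pr_cmp\<close> is not yet available.\<close>
  define h' where "h' = (idn ?a \<odot> mul A) \<cdot> asc ?a ?a ?a \<cdot> (comul A \<odot> idn ?a)"
  have hh: "chom ?X ?X h" unfolding h_def by (intro pr_chom X p mul_chom A) simp_all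
  have [simp]: "h \<in> Arr M" "Dom M h = cob ?X" "Cod M h = ?a \<boxtimes> ?a" by (simp_all add: h_def)
  have mulpr: "mul A = cv A ?X ?p ?q" by (simp add: cv_def pr_fst_snd)
  have g: "g \<cdot> pr X a b = pr X a (cv A X (antipode A \<cdot> a) b)"
    if [simp]: "comonoid M X" "b \<in> Arr M" "Dom M b = cob X" "Cod M b = ?a" and a: "chom X A a" for X :: "('o, 'm) comon" and a b
  proof -
    note [simp] = chomD(1-3)[OF a] comul_cmp[OF a]
    show ?thesis by (simp add: g_def cv_def)
  qed
  \<comment> \<open>At \<open>(a, 1)\<close> the inverse yields \<open>(a, S a)\<close>, from which
    the second projection extracts the antipode.\<close>
  have gA: "g \<cdot> pr A (idn ?a) (unit A \<cdot> counit A) = pr A (idn ?a) (antipode A)"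
    using cv_unit_right[of A A "antipode A"] by (simp add: g_def comul_pr cv_def)
  have h': "h' \<cdot> pr ?X a b = pr ?X a (cv A ?X a b)"
    if [simp]: "b \<in> Arr M" "Dom M b = ?a \<boxtimes> ?a" "Cod M b = ?a" and a: "chom ?X A a" for a b
  proof -
    note [simp] = chomD(1-3)[OF a] comul_cmp[OF a]
    show ?thesis by (simp add: h'_def cv_def)
  qed
  have [simp]: "g \<in> Arr M" "Dom M g = cob ?X" "Cod M g = ?a \<boxtimes> ?a" "h' \<in> Arr M" "Dom M h' = cob ?X" "Cod M h' = ?a \<boxtimes> ?a"
    by (simp_all add: g_def h'_def)
  have pq: "pr ?X ?p ?q = idn (cob ?X)" by (simp add: pr_fst_snd)
  have "h' = h' \<cdot> pr ?X ?p ?q" by (simp add: pq)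
  also have "\<dots> = h" by (simp add: h' p h_def mulpr)
  finally have h'h: "h' = h" .
  have "g = g \<cdot> pr ?X ?p ?q" by (simp add: pq)
  also have "\<dots> = pr ?X ?p (cv A ?X (antipode A \<cdot> ?p) ?q)" by (simp add: g p)
  finally have gp: "g = pr ?X ?p (cv A ?X (antipode A \<cdot> ?p) ?q)" .
  have "h \<cdot> g = h' \<cdot> pr ?X ?p (cv A ?X (antipode A \<cdot> ?p) ?q)" by (simp only: h'h flip: gp)
  also have "\<dots> = pr ?X ?p (cv A ?X ?p (cv A ?X (antipode A \<cdot> ?p) ?q))" by (simp add: h' p)
  also have "\<dots> = pr ?X ?p ?q" by (subst cv_assoc[symmetric]) (simp_all add: cv_antipode p cv_unit_left)
  finally have hg: "h \<cdot> g = idn (cob ?X)" by (simp add: pq)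
  have "g \<cdot> h = g \<cdot> pr ?X ?p (cv A ?X ?p ?q)" by (simp only: h_def mulpr)
  also have "\<dots> = pr ?X ?p (cv A ?X (antipode A \<cdot> ?p) (cv A ?X ?p ?q))" by (simp add: g p)
  also have "\<dots> = pr ?X ?p ?q" by (subst cv_assoc[symmetric]) (simp_all add: cv_antipode p cv_unit_left)
  finally have gh: "g \<cdot> h = idn (cob ?X)" by (simp add: pq)
  have gc: "chom ?X ?X g" by (rule chom_inverse[OF hh]) (simp_all add: hg gh)
  have uc: "chom A A (unit A \<cdot> counit A)" by (rule unit_counit_chom) simp_all
  have "snd_ten A A \<cdot> g \<cdot> pr A (idn ?a) (unit A \<cdot> counit A) = antipode A"
    by (simp add: gA snd_ten_pr)
  moreover have "chom A A (snd_ten A A \<cdot> g \<cdot> pr A (idn ?a) (unit A \<cdot> counit A))"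
  proof -
    have "chom A ?X (pr A (idn ?a) (unit A \<cdot> counit A))" by (intro pr_chom cA uc chom_id) simp_all
    then have "chom A ?X (g \<cdot> pr A (idn ?a) (unit A \<cdot> counit A))" by (rule chom_comp[OF _ gc]) simp_all
    then show ?thesis by (rule chom_comp[OF _ q]) simp_all
  qed
  ultimately show ?thesis by simp
qed

subsection \<open>Morphisms of Hopf monoids\<close>

lemma hopf_homD: assumes "hopf_hom M A B f"
  shows "chom A B f" "f \<in> Arr M" "Dom M f = cob A" "Cod M f = cob B"
    "comul B \<cdot> f = (f \<odot> f) \<cdot> comul A" "counit B \<cdot> f = counit A" "f \<cdot> mul A = mul B \<cdot> (f \<odot> f)" "f \<cdot> unit A = unit B"
proof -
  show c: "chom A B f" and "f \<cdot> mul A = mul B \<cdot> (f \<odot> f)" "f \<cdot> unit A = unit B"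
    using assms unfolding hopf_hom_def by blast+
  show "f \<in> Arr M" "Dom M f = cob A" "Cod M f = cob B" "comul B \<cdot> f = (f \<odot> f) \<cdot> comul A" "counit B \<cdot> f = counit A"
    using chomD[OF c] .
qed

lemma hopf_homI: "chom A B f \<Longrightarrow> f \<cdot> mul A = mul B \<cdot> (f \<odot> f) \<Longrightarrow> f \<cdot> unit A = unit B \<Longrightarrow> hopf_hom M A B f"
  by (simp add: hopf_hom_def)

lemma hopf_hom_id: assumes A: "hopf_monoid M A" shows "hopf_hom M A A (idn (cob A))"
proof -
  note [simp] = A
  show ?thesis by (rule hopf_homI) (simp_all add: chom_id A)
qed

lemma hopf_hom_comp: assumes f: "hopf_hom M A B f" and g: "hopf_hom M B D g"
    and A: "hopf_monoid M A" and B: "hopf_monoid M B" and D: "hopf_monoid M D"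
  shows "hopf_hom M A D (g \<cdot> f)"
proof (rule hopf_homI)
  note [simp] = A B D hopf_homD(2-4)[OF f] hopf_homD(2-4)[OF g]
  show "chom A D (g \<cdot> f)" by (rule chom_comp[OF hopf_homD(1)[OF f] hopf_homD(1)[OF g]]) simp_all
  have "(g \<cdot> f) \<cdot> mul A = g \<cdot> (f \<cdot> mul A)" by simp
  also have "\<dots> = (g \<cdot> mul B) \<cdot> (f \<odot> f)" unfolding hopf_homD(7)[OF f] by simp
  also have "\<dots> = mul D \<cdot> ((g \<cdot> f) \<odot> (g \<cdot> f))" unfolding hopf_homD(7)[OF g] by simp
  finally show "(g \<cdot> f) \<cdot> mul A = mul D \<cdot> ((g \<cdot> f) \<odot> (g \<cdot> f))" .
  have "(g \<cdot> f) \<cdot> unit A = g \<cdot> (f \<cdot> unit A)" by simp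
  then show "(g \<cdot> f) \<cdot> unit A = unit D" by (simp only: hopf_homD(8)[OF f] hopf_homD(8)[OF g])
qed

lemma mono_hopf_factor: assumes j: "is_mono M j" "hopf_hom M K A j" and w: "hopf_hom M Z A w"
    and v: "v \<in> Arr M" "Dom M v = cob Z" "Cod M v = cob K" and jv: "j \<cdot> v = w"
    and A: "hopf_monoid M A" and K: "hopf_monoid M K" and Z: "hopf_monoid M Z"
  shows "hopf_hom M Z K v"
proof (rule hopf_homI)
  note [simp] = A K Z hopf_homD(2-4)[OF j(2)] hopf_homD(2-4)[OF w] v
  show "chom Z K v" by (rule mono_chom_factor[OF j(1) hopf_homD(1)[OF j(2)] hopf_homD(1)[OF w] v jv]) simp_all
  have "j \<cdot> v \<cdot> mul Z = (j \<cdot> v) \<cdot> mul Z" by simp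
  also have "\<dots> = mul A \<cdot> ((j \<cdot> v) \<odot> (j \<cdot> v))" unfolding jv by (rule hopf_homD(7)[OF w])
  also have "\<dots> = (mul A \<cdot> (j \<odot> j)) \<cdot> (v \<odot> v)" by simp
  also have "\<dots> = j \<cdot> mul K \<cdot> (v \<odot> v)" unfolding hopf_homD(7)[OF j(2), symmetric] by simp
  finally show "v \<cdot> mul Z = mul K \<cdot> (v \<odot> v)"
    using mono_cancel[OF j(1), of "v \<cdot> mul Z" "mul K \<cdot> (v \<odot> v)"] by simp
  have "j \<cdot> v \<cdot> unit Z = (j \<cdot> v) \<cdot> unit Z" by simp
  also have "\<dots> = j \<cdot> unit K" unfolding jv by (simp only: hopf_homD(8)[OF w] hopf_homD(8)[OF j(2)])
  finally show "v \<cdot> unit Z = unit K"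
    using mono_cancel[OF j(1), of "v \<cdot> unit Z" "unit K"] by simp
qed

text \<open>All compatibilities are tested after precomposing with \<open>q\<close> or with
  \<open>q \<odot> q\<close>, which is epi because tensoring is exact.\<close>

lemma epi_hopf_factor: assumes q: "is_epi M q" "hopf_hom M A Q q" and w: "hopf_hom M A Z w"
    and v: "v \<in> Arr M" "Dom M v = cob Q" "Cod M v = cob Z" and vq: "v \<cdot> q = w"
    and A: "hopf_monoid M A" and Q: "hopf_monoid M Q" and Z: "hopf_monoid M Z"
  shows "hopf_hom M Q Z v"
proof (rule hopf_homI)
  note [simp] = A Q Z hopf_homD(2-4)[OF q(2)] hopf_homD(2-4)[OF w] v
  show "chom Q Z v"
  proof (rule chomI)
    have "(comul Z \<cdot> v) \<cdot> q = comul Z \<cdot> (v \<cdot> q)" by simp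
    also have "\<dots> = ((v \<cdot> q) \<odot> (v \<cdot> q)) \<cdot> comul A" unfolding vq by (rule hopf_homD(5)[OF w])
    also have "\<dots> = (v \<odot> v) \<cdot> ((q \<odot> q) \<cdot> comul A)" by simp
    also have "\<dots> = ((v \<odot> v) \<cdot> comul Q) \<cdot> q" unfolding hopf_homD(5)[OF q(2), symmetric] by simp
    finally show "comul Z \<cdot> v = (v \<odot> v) \<cdot> comul Q"
      using epi_cancel[OF q(1), of "comul Z \<cdot> v" "(v \<odot> v) \<cdot> comul Q"] by simp
    have "(counit Z \<cdot> v) \<cdot> q = counit Z \<cdot> (v \<cdot> q)" by simp
    also have "\<dots> = counit Q \<cdot> q" unfolding vq by (simp only: hopf_homD(6)[OF w] hopf_homD(6)[OF q(2)])
    finally show "counit Z \<cdot> v = counit Q" using epi_cancel[OF q(1), of "counit Z \<cdot> v" "counit Q"] by simp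
  qed simp_all
  have "(v \<cdot> mul Q) \<cdot> (q \<odot> q) = v \<cdot> (mul Q \<cdot> (q \<odot> q))" by simp
  also have "\<dots> = (v \<cdot> q) \<cdot> mul A" unfolding hopf_homD(7)[OF q(2), symmetric] by simp
  also have "\<dots> = mul Z \<cdot> ((v \<cdot> q) \<odot> (v \<cdot> q))" unfolding vq by (rule hopf_homD(7)[OF w])
  also have "\<dots> = (mul Z \<cdot> (v \<odot> v)) \<cdot> (q \<odot> q)" by simp
  finally show "v \<cdot> mul Q = mul Z \<cdot> (v \<odot> v)"
    using epi_cancel[OF ten_epi[OF q(1) q(1)], of "v \<cdot> mul Q" "mul Z \<cdot> (v \<odot> v)"] by simp
  have "v \<cdot> unit Q = v \<cdot> q \<cdot> unit A" unfolding hopf_homD(8)[OF q(2)] ..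
  also have "\<dots> = (v \<cdot> q) \<cdot> unit A" by simp
  finally show "v \<cdot> unit Q = unit Z" by (simp only: vq hopf_homD(8)[OF w])
qed

lemma ten_chom: assumes f: "chom X X' f" and g: "chom Y Y' g" and X: "comonoid M X" "comonoid M X'" "comonoid M Y" "comonoid M Y'"
  shows "chom (tc X Y) (tc X' Y') (f \<odot> g)"
proof (rule chomI)
  note [simp] = chomD(1-3)[OF f] chomD(1-3)[OF g] X
  show "f \<odot> g \<in> Arr M" "Dom M (f \<odot> g) = cob (tc X Y)" "Cod M (f \<odot> g) = cob (tc X' Y')" by simp_all
  have "comul (tc X' Y') \<cdot> (f \<odot> g) = mid (cob X') (cob X') (cob Y') (cob Y') \<cdot> ((comul X' \<cdot> f) \<odot> (comul Y' \<cdot> g))"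
    by (simp add: tc_sel)
  also have "\<dots> = (mid (cob X') (cob X') (cob Y') (cob Y') \<cdot> ((f \<odot> f) \<odot> (g \<odot> g))) \<cdot> (comul X \<odot> comul Y)"
    by (simp add: chomD(4)[OF f] chomD(4)[OF g])
  also have "\<dots> = ((f \<odot> g) \<odot> (f \<odot> g)) \<cdot> comul (tc X Y)"
    by (subst mid_nat) (simp_all add: tc_sel)
  finally show "comul (tc X' Y') \<cdot> (f \<odot> g) = ((f \<odot> g) \<odot> (f \<odot> g)) \<cdot> comul (tc X Y)" .
  show "counit (tc X' Y') \<cdot> (f \<odot> g) = counit (tc X Y)" by (simp add: tc_sel chomD(5)[OF f] chomD(5)[OF g])
qed

text \<open>The laws of \<open>K\<close> are inherited from \<open>A\<close>, since \<open>j\<close>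
  and \<open>j \<odot> j\<close> cancel on the left. Kernels and images both receive their Hopf
  structure here; what has to be supplied is closure under the operations.\<close>

lemma hopf_submonoid:
  assumes A: "hopf_monoid M A" and cA: "coc A" and cK: "coc K" and jm: "is_mono M j" and j: "chom K A j"
    and m: "mul K \<in> Arr M" "Dom M (mul K) = cob K \<boxtimes> cob K" "Cod M (mul K) = cob K" "j \<cdot> mul K = mul A \<cdot> (j \<odot> j)"
    and u: "unit K \<in> Arr M" "Dom M (unit K) = I" "Cod M (unit K) = cob K" "j \<cdot> unit K = unit A"
    and s: "antipode K \<in> Arr M" "Dom M (antipode K) = cob K" "Cod M (antipode K) = cob K" "j \<cdot> antipode K = antipode A \<cdot> j"
  shows "hopf_monoid M K" "hopf_hom M K A j"
proof -
  have K: "comonoid M K" using cK by simp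
  note [simp] = A K cA cK chomD(1-3)[OF j] m(1-3) u(1-3) s(1-3)
  have mj: "mul A \<cdot> (j \<odot> j) \<cdot> r = j \<cdot> mul K \<cdot> r" if "r \<in> Arr M" "Cod M r = cob K \<boxtimes> cob K" for r
    using m(4) that by (intro cmp_ext2[of _ _ j "mul K"]) simp_all
  let ?a = "cob A" and ?k = "cob K"
  have cancel: "x = y" if "j \<cdot> x = j \<cdot> y" "x \<in> Arr M" "y \<in> Arr M" "Cod M x = ?k" "Cod M y = ?k" "Dom M x = Dom M y" for x y
    using mono_cancel[OF jm that(1)] that by simp
  have "j \<cdot> mul K \<cdot> (mul K \<odot> idn ?k) = mul A \<cdot> (j \<odot> j) \<cdot> (mul K \<odot> idn ?k)" by (rule mj[symmetric]) simp_all
  also have "\<dots> = mul A \<cdot> ((mul A \<cdot> (j \<odot> j)) \<odot> j)" by (simp add: m(4))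
  also have "\<dots> = (mul A \<cdot> (mul A \<odot> idn ?a)) \<cdot> ((j \<odot> j) \<odot> j)" by simp
  also have "\<dots> = mul A \<cdot> (idn ?a \<odot> mul A) \<cdot> (asc ?a ?a ?a \<cdot> ((j \<odot> j) \<odot> j))" unfolding mul_assoc[OF A] by simp
  also have "\<dots> = mul A \<cdot> (j \<odot> (mul A \<cdot> (j \<odot> j))) \<cdot> asc ?k ?k ?k" by (subst asc_nat') simp_all
  also have "\<dots> = mul A \<cdot> (j \<odot> j) \<cdot> (idn ?k \<odot> mul K) \<cdot> asc ?k ?k ?k" by (simp flip: m(4))
  also have "\<dots> = j \<cdot> mul K \<cdot> (idn ?k \<odot> mul K) \<cdot> asc ?k ?k ?k" by (rule mj) simp_all
  finally have 1: "mul K \<cdot> (mul K \<odot> idn ?k) = mul K \<cdot> (idn ?k \<odot> mul K) \<cdot> asc ?k ?k ?k"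
    by (rule cancel) simp_all
  have "j \<cdot> mul K \<cdot> (unit K \<odot> idn ?k) = mul A \<cdot> (j \<odot> j) \<cdot> (unit K \<odot> idn ?k)" by (rule mj[symmetric]) simp_all
  also have "\<dots> = (mul A \<cdot> (unit A \<odot> idn ?a)) \<cdot> (idn I \<odot> j)" by (simp add: u(4))
  also have "\<dots> = j \<cdot> lun ?k" unfolding mul_unit_left[OF A] by (subst lun_nat') simp_all
  finally have 2: "mul K \<cdot> (unit K \<odot> idn ?k) = lun ?k" by (rule cancel) simp_all
  have "j \<cdot> mul K \<cdot> (idn ?k \<odot> unit K) = mul A \<cdot> (j \<odot> j) \<cdot> (idn ?k \<odot> unit K)" by (rule mj[symmetric]) simp_all
  also have "\<dots> = (mul A \<cdot> (idn ?a \<odot> unit A)) \<cdot> (j \<odot> idn I)" by (simp add: u(4))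
  also have "\<dots> = j \<cdot> run ?k" unfolding mul_unit_right[OF A] by (subst run_nat') simp_all
  finally have 3: "mul K \<cdot> (idn ?k \<odot> unit K) = run ?k" by (rule cancel) simp_all
  have "chom (tc K K) A (mul A \<cdot> (j \<odot> j))" by (rule chom_comp[OF ten_chom[OF j j] mul_chom[OF A]]) simp_all
  then have mK: "chom (tc K K) K (mul K)" by (rule mono_chom_factor[OF jm j _ m(1) _ m(3,4)]) simp_all
  have "(j \<odot> j) \<cdot> comul K \<cdot> unit K = ((j \<odot> j) \<cdot> comul K) \<cdot> unit K" by simp
  also have "\<dots> = comul A \<cdot> j \<cdot> unit K" unfolding chomD(4)[OF j, symmetric] by simp
  also have "\<dots> = (unit A \<odot> unit A) \<cdot> inv_arr M (lun I)" unfolding u(4) by (rule comul_unit[OF A])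
  also have "\<dots> = (j \<odot> j) \<cdot> (unit K \<odot> unit K) \<cdot> inv_arr M (lun I)" by (simp add: u(4))
  finally have 4: "comul K \<cdot> unit K = (unit K \<odot> unit K) \<cdot> inv_arr M (lun I)"
    using mono_cancel[OF ten_mono[OF jm jm], of "comul K \<cdot> unit K" "(unit K \<odot> unit K) \<cdot> inv_arr M (lun I)"] by simp
  have "counit K \<cdot> unit K = counit A \<cdot> j \<cdot> unit K" unfolding chomD(5)[OF j, symmetric] by simp
  also have "\<dots> = idn I" unfolding u(4) by (rule counit_unit[OF A])
  finally have 5: "counit K \<cdot> unit K = idn I" .
  have uc: "unit A \<cdot> counit A \<cdot> j = j \<cdot> unit K \<cdot> counit K"
    unfolding chomD(5)[OF j] u(4)[symmetric] by simp
  have "j \<cdot> mul K \<cdot> (antipode K \<odot> idn ?k) \<cdot> comul K = mul A \<cdot> (j \<odot> j) \<cdot> (antipode K \<odot> idn ?k) \<cdot> comul K" by (rule mj[symmetric]) simp_all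
  also have "\<dots> = mul A \<cdot> (antipode A \<odot> idn ?a) \<cdot> ((j \<odot> j) \<cdot> comul K)" by (simp add: s(4))
  also have "\<dots> = (mul A \<cdot> (antipode A \<odot> idn ?a) \<cdot> comul A) \<cdot> j" unfolding chomD(4)[OF j, symmetric] by simp
  also have "\<dots> = j \<cdot> unit K \<cdot> counit K" unfolding antipode_left[OF A] by (simp add: uc)
  finally have 6: "mul K \<cdot> (antipode K \<odot> idn ?k) \<cdot> comul K = unit K \<cdot> counit K" by (rule cancel) simp_all
  have "j \<cdot> mul K \<cdot> (idn ?k \<odot> antipode K) \<cdot> comul K = mul A \<cdot> (j \<odot> j) \<cdot> (idn ?k \<odot> antipode K) \<cdot> comul K" by (rule mj[symmetric]) simp_all
  also have "\<dots> = mul A \<cdot> (idn ?a \<odot> antipode A) \<cdot> ((j \<odot> j) \<cdot> comul K)" by (simp add: s(4))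
  also have "\<dots> = (mul A \<cdot> (idn ?a \<odot> antipode A) \<cdot> comul A) \<cdot> j" unfolding chomD(4)[OF j, symmetric] by simp
  also have "\<dots> = j \<cdot> unit K \<cdot> counit K" unfolding antipode_right[OF A] by (simp add: uc)
  finally have 7: "mul K \<cdot> (idn ?k \<odot> antipode K) \<cdot> comul K = unit K \<cdot> counit K" by (rule cancel) simp_all
  show "hopf_monoid M K" unfolding hopf_monoid_def Hom_iff
    by (intro conjI K 1 2 3 4 5 6 7 chomD(4,5)[OF mK, unfolded tc_sel] m(1-3) u(1-3) s(1-3))
  show "hopf_hom M K A j" by (rule hopf_homI[OF j m(4) u(4)])
qed

subsection \<open>The category of cocommutative Hopf monoids\<close>

abbreviation \<open>H \<equiv> HopfCoc M\<close>

definition hopf_coc :: "('o, 'm) hopf \<Rightarrow> bool" where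
  "hopf_coc A \<longleftrightarrow> hopf_monoid M A \<and> coc A"

lemma hopf_cocD: "hopf_coc A \<Longrightarrow> hopf_monoid M A" "hopf_coc A \<Longrightarrow> coc A"
  by (simp_all add: hopf_coc_def)

lemma H_simps [simp]: "Ob H = {A. hopf_coc A}"
  "(A, f, B) \<in> Arr H \<longleftrightarrow> hopf_coc A \<and> hopf_coc B \<and> hopf_hom M A B f"
  "Dom H (A, f, B) = A" "Cod H (A, f, B) = B" "Idn H A = (A, idn (cob A), A)"
  "Cmp H (B', g, D) (A, f, B) = (A, g \<cdot> f, D)"
proof -
  have *: "hopf_monoid M A \<and> cocommutative M A \<longleftrightarrow> hopf_coc A" for A
    unfolding hopf_coc_def coc_def using hopf_comonoid by blast
  show "Ob H = {A. hopf_coc A}" by (simp add: HopfCoc_def structured_cat_def *)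
  have "hopf_hom M A B f \<Longrightarrow> f \<in> Hom M (cob A) (cob B)" using hopf_homD[of A B f] by simp
  then show "(A, f, B) \<in> Arr H \<longleftrightarrow> hopf_coc A \<and> hopf_coc B \<and> hopf_hom M A B f"
    by (auto simp add: HopfCoc_def structured_cat_def *)
qed (simp_all add: HopfCoc_def structured_cat_def)

lemma H_Hom_iff: "(X, h, Y) \<in> Hom H X' Y' \<longleftrightarrow> X = X' \<and> Y = Y' \<and> hopf_coc X \<and> hopf_coc Y \<and> hopf_hom M X Y h"
  unfolding Hom_def by auto

lemma H_HomE: assumes "f \<in> Hom H X Y"
  obtains h where "f = (X, h, Y)" "hopf_coc X" "hopf_coc Y" "hopf_hom M X Y h"
  using assms by (cases f) (simp only: H_Hom_iff, blast)

lemma H_category: "category H"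
proof
  fix f g h X Y Z W
  { assume "f \<in> Arr H"
    then show "Dom H f \<in> Ob H" "Cod H f \<in> Ob H" by (cases f; simp)+ }
  { assume "X \<in> Ob H"
    then show "Idn H X \<in> Hom H X X" by (simp add: H_Hom_iff hopf_hom_id hopf_cocD) }
  { assume "f \<in> Hom H X Y"
    then obtain f' where f: "f = (X, f', Y)" and X: "hopf_coc X" "hopf_coc Y" and f': "hopf_hom M X Y f'" by (rule H_HomE)
    show "Cmp H (Idn H Y) f = f" "Cmp H f (Idn H X) = f" using hopf_homD(2-4)[OF f'] by (simp_all add: f)
    { assume "g \<in> Hom H Y Z"
      then obtain g' where g: "g = (Y, g', Z)" and Z: "hopf_coc Z" and g': "hopf_hom M Y Z g'" by (rule H_HomE)
      show "Cmp H g f \<in> Hom H X Z"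
        using hopf_hom_comp[OF f' g' hopf_cocD(1)[OF X(1)] hopf_cocD(1)[OF X(2)] hopf_cocD(1)[OF Z]] X Z
        unfolding f g H_Hom_iff H_simps by blast } }
  { assume "f \<in> Hom H W X" "g \<in> Hom H X Y" "h \<in> Hom H Y Z"
    note fgh = this
    obtain f' where f: "f = (W, f', X)" and mf: "hopf_hom M W X f'" using fgh(1) by (rule H_HomE)
    obtain g' where g: "g = (X, g', Y)" and mg: "hopf_hom M X Y g'" using fgh(2) by (rule H_HomE)
    obtain h' where h: "h = (Y, h', Z)" and mh: "hopf_hom M Y Z h'" using fgh(3) by (rule H_HomE)
    show "Cmp H (Cmp H h g) f = Cmp H h (Cmp H g f)"
      using hopf_homD(2-4)[OF mf] hopf_homD(2-4)[OF mg] hopf_homD(2-4)[OF mh] by (simp add: f g h) }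
qed

interpretation H: category H by (rule H_category)

section \<open>Zero object and zero morphisms of cocommutative Hopf monoids\<close>

lemma mul_units: assumes B: "hopf_monoid M B" shows "mul B \<cdot> (unit B \<odot> unit B) = unit B \<cdot> lun I"
proof -
  note [simp] = B
  have "mul B \<cdot> (unit B \<odot> unit B) = (mul B \<cdot> (unit B \<odot> idn (cob B))) \<cdot> (idn I \<odot> unit B)" by simp
  also have "\<dots> = unit B \<cdot> lun I" unfolding mul_unit_left[OF B] by (subst lun_nat') simp_all
  finally show ?thesis .
qed

lemma trivial_hopf_hom: assumes A: "hopf_monoid M A" and B: "hopf_monoid M B"
  shows "hopf_hom M A B (unit B \<cdot> counit A)"
proof (rule hopf_homI)
  note [simp] = A B
  show "chom A B (unit B \<cdot> counit A)" by (rule unit_counit_chom) simp_all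
  have "(unit B \<cdot> counit A) \<cdot> mul A = (unit B \<cdot> lun I) \<cdot> (counit A \<odot> counit A)" by (simp add: counit_mul)
  also have "\<dots> = mul B \<cdot> ((unit B \<cdot> counit A) \<odot> (unit B \<cdot> counit A))" unfolding mul_units[OF B, symmetric] by simp
  finally show "(unit B \<cdot> counit A) \<cdot> mul A = mul B \<cdot> ((unit B \<cdot> counit A) \<odot> (unit B \<cdot> counit A))" .
  show "(unit B \<cdot> counit A) \<cdot> unit A = unit B" by (simp add: counit_unit)
qed

definition unit_hopf :: "('o, 'm) hopf" where
  "unit_hopf = \<lparr>cob = I, comul = inv_arr M (lun I), counit = idn I, mul = lun I, unit = idn I, antipode = idn I\<rparr>"

lemma unit_hopf_sel [simp]: "cob unit_hopf = I" "comul unit_hopf = inv_arr M (lun I)" "counit unit_hopf = idn I"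
    "mul unit_hopf = lun I" "unit unit_hopf = idn I" "antipode unit_hopf = idn I"
  by (simp_all add: unit_hopf_def)

lemma hopf_coc_unit [simp]: "hopf_coc unit_hopf"
proof -
  let ?l = "inv_arr M (lun I)"
  have asc: "(idn I \<odot> lun I) \<cdot> asc I I I = lun I \<odot> idn I" using triangle[of I I] by (simp add: lun_unit_run_unit)
  have "asc I I I \<cdot> (?l \<odot> idn I) \<cdot> ?l = (idn I \<odot> ?l) \<cdot> ((idn I \<odot> lun I) \<cdot> asc I I I) \<cdot> (?l \<odot> idn I) \<cdot> ?l"
    by simp
  also have "\<dots> = (idn I \<odot> ?l) \<cdot> ?l" unfolding asc by simp
  finally have c: "coc unit_hopf"
    by (intro cocI) (simp_all add: sym_unit)
  moreover have "lun I \<cdot> (lun I \<odot> idn I) = lun I \<cdot> (idn I \<odot> lun I) \<cdot> asc I I I" by (simp add: asc)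
  ultimately show ?thesis unfolding hopf_coc_def hopf_monoid_def
    by (simp add: mid_unit lun_unit_run_unit)
qed

lemma hopf_hom_into_unit: assumes A: "hopf_coc A" shows "hopf_hom M A unit_hopf h \<longleftrightarrow> h = counit A"
proof
  note [simp] = hopf_cocD[OF A]
  assume h: "hopf_hom M A unit_hopf h"
  then show "h = counit A" using hopf_homD(2-4,6)[OF h] by simp
next
  assume "h = counit A"
  then show "hopf_hom M A unit_hopf h"
    using trivial_hopf_hom[of A unit_hopf] hopf_cocD[OF A] hopf_cocD[OF hopf_coc_unit] by simp
qed

lemma hopf_hom_from_unit: assumes A: "hopf_coc A" shows "hopf_hom M unit_hopf A h \<longleftrightarrow> h = unit A"
proof
  note [simp] = hopf_cocD[OF A]
  assume h: "hopf_hom M unit_hopf A h"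
  then show "h = unit A" using hopf_homD(2-4,8)[OF h] by simp
next
  assume "h = unit A"
  then show "hopf_hom M unit_hopf A h"
    using trivial_hopf_hom[of unit_hopf A] hopf_cocD[OF A] hopf_cocD[OF hopf_coc_unit] by simp
qed

lemma unit_hopf_zero: "is_zero_ob H unit_hopf"
  unfolding is_zero_ob_def
proof (intro conjI ballI)
  fix X assume X: "X \<in> Ob H"
  show "\<exists>!f. f \<in> Hom H X unit_hopf"
    by (rule ex1I[of _ "(X, counit X, unit_hopf)"]) (use X in \<open>auto simp: Hom_def hopf_hom_into_unit\<close>)
  show "\<exists>!f. f \<in> Hom H unit_hopf X"
    by (rule ex1I[of _ "(unit_hopf, unit X, X)"]) (use X in \<open>auto simp: Hom_def hopf_hom_from_unit\<close>)
qed simp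

text \<open>A zero arrow may factor through any zero object \<open>z\<close>. Uniqueness replaces
  its first half by \<open>unit z \<cdot> counit A\<close>, and the second half, being a Hopf monoid
  morphism, carries \<open>unit z\<close> to \<open>unit B\<close>.\<close>

lemma H_zero_iff: "is_zero_arr H (A, h, B) \<longleftrightarrow> hopf_coc A \<and> hopf_coc B \<and> h = unit B \<cdot> counit A"
proof
  assume z: "is_zero_arr H (A, h, B)"
  then have h: "(A, h, B) \<in> Arr H" by (simp only: is_zero_arr_def)
  then have A: "hopf_coc A" and B: "hopf_coc B" by simp_all
  from z obtain z g k where z: "is_zero_ob H z" and g: "g \<in> Hom H A z" and k: "k \<in> Hom H z B" and e: "(A, h, B) = Cmp H k g"
    unfolding is_zero_arr_def by (metis H_simps(3,4))
  have zo: "hopf_coc z" using z by (simp add: is_zero_ob_def)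
  note [simp] = hopf_cocD[OF A] hopf_cocD[OF B] hopf_cocD[OF zo]
  have "(A, unit z \<cdot> counit A, z) \<in> Hom H A z" by (simp add: A zo trivial_hopf_hom)
  moreover have "\<exists>!f. f \<in> Hom H A z" using z A unfolding is_zero_ob_def by auto
  ultimately have g': "g = (A, unit z \<cdot> counit A, z)" using g by blast
  obtain k' where k': "k = (z, k', B)" and kh: "hopf_hom M z B k'" using k by (cases k) auto
  note [simp] = hopf_homD(2-4)[OF kh]
  have "h = (k' \<cdot> unit z) \<cdot> counit A" using e by (simp add: g' k')
  then have "h = unit B \<cdot> counit A" by (simp only: hopf_homD(8)[OF kh])
  with A B show "hopf_coc A \<and> hopf_coc B \<and> h = unit B \<cdot> counit A" by simp
next
  assume "hopf_coc A \<and> hopf_coc B \<and> h = unit B \<cdot> counit A"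
  then have A: "hopf_coc A" and B: "hopf_coc B" and h: "h = unit B \<cdot> counit A" by simp_all
  have "(A, h, B) \<in> Arr H" unfolding h H_simps(2) using A B trivial_hopf_hom hopf_cocD by blast
  moreover have "(A, counit A, unit_hopf) \<in> Hom H (Dom H (A, h, B)) unit_hopf"
    unfolding H_Hom_iff H_simps using A hopf_hom_into_unit hopf_coc_unit by blast
  moreover have "(unit_hopf, unit B, B) \<in> Hom H unit_hopf (Cod H (A, h, B))"
    unfolding H_Hom_iff H_simps using B hopf_hom_from_unit hopf_coc_unit by blast
  moreover have "(A, h, B) = Cmp H (unit_hopf, unit B, B) (A, counit A, unit_hopf)" unfolding h H_simps ..
  ultimately show "is_zero_arr H (A, h, B)" unfolding is_zero_arr_def using unit_hopf_zero by blast
qed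

section \<open>Kernels and images of Hopf monoid morphisms\<close>

lemma antipode_unit: assumes A: "hopf_coc A" shows "antipode A \<cdot> unit A = unit A"
proof -
  \<comment> \<open>The unit is a morphism out of the unit Hopf monoid, whose antipode is the
    identity, and morphisms commute with antipodes.\<close>
  have u: "hopf_hom M unit_hopf A (unit A)" using A by (simp add: hopf_hom_from_unit)
  show ?thesis using hopf_hom_antipode[OF hopf_cocD(1)[OF hopf_coc_unit] hopf_cocD(1)[OF A] u] hopf_cocD(1)[OF A] by simp
qed

text \<open>The universal property of the kernel quantifies over plain \<open>comon\<close> records,
  as a quantifier inside a statement ranges over one type; Hopf monoids are tested against it after
  their extra fields are dropped.\<close>

definition underlying_comon :: "('o, 'm, 'x) comon_scheme \<Rightarrow> ('o, 'm) comon" where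
  "underlying_comon Z = \<lparr>cob = cob Z, comul = comul Z, counit = counit Z\<rparr>"

lemma underlying_comon [simp]: "cob (underlying_comon Z) = cob Z" "comul (underlying_comon Z) = comul Z"
    "counit (underlying_comon Z) = counit Z" "coc (underlying_comon Z) = coc Z"
    "chom (underlying_comon Z) X h = chom Z X h"
proof -
  show *: "cob (underlying_comon Z) = cob Z" "comul (underlying_comon Z) = comul Z" "counit (underlying_comon Z) = counit Z"
    by (simp_all add: underlying_comon_def)
  show "coc (underlying_comon Z) = coc Z" unfolding coc_def comonoid_def cocommutative_def * ..
  show "chom (underlying_comon Z) X h = chom Z X h" unfolding comonoid_hom_def * ..
qed

text \<open>The kernel is the equalizer of \<open>f\<close> and the trivial morphism among
  cocommutative comonoids. Products, the unit and inverses of elements sent to the unit are again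
  sent to the unit, so its universal property restricts the operations of \<open>A\<close>. The last
  conjunct is recorded because the comonoid \<open>A \<box>\<^sub>Q A\<close> will be mapped into
  \<open>K\<close>.\<close>

lemma hopf_kernel:
  assumes f: "(A, f, B) \<in> Arr H"
  shows "\<exists>K j. hopf_coc K \<and> hopf_hom M K A j \<and> is_mono M j \<and> f \<cdot> j = unit B \<cdot> counit K \<and>
    is_kernel H (K, j, A) (A, f, B) \<and>
    (\<forall>(Z :: ('o, 'm) comon) w. coc Z \<longrightarrow> chom Z A w \<longrightarrow> f \<cdot> w = unit B \<cdot> counit Z \<longrightarrow> (\<exists>w'. chom Z K w' \<and> j \<cdot> w' = w))"
proof -
  have A: "hopf_coc A" and B: "hopf_coc B" and ff: "hopf_hom M A B f" using f by simp_all
  note hA = hopf_cocD[OF A] and hB = hopf_cocD[OF B]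
  note [simp] = hA hB hopf_homD(2-4)[OF ff]
  have triv: "chom A B (unit B \<cdot> counit A)" by (rule unit_counit_chom) simp_all
  obtain e where "is_kernel M e (dif (pr A (idn (cob A)) f) (pr A (idn (cob A)) (unit B \<cdot> counit A)))"
    using ex_kernel[of "dif (pr A (idn (cob A)) f) (pr A (idn (cob A)) (unit B \<cdot> counit A))"] by auto
  then have e: "is_equalizer M e (pr A (idn (cob A)) f) (pr A (idn (cob A)) (unit B \<cdot> counit A))"
    by (subst (asm) kernel_dif_iff) simp_all
  note em = equalizer_mono[OF e]
  obtain K0 :: "('o, 'm) comon" where K0: "coc K0" "cob K0 = Dom M e" "chom K0 A e" and fe0: "f \<cdot> e = (unit B \<cdot> counit A) \<cdot> e"
    and fac0: "\<forall>(Z :: ('o, 'm) comon) w. coc Z \<longrightarrow> chom Z A w \<longrightarrow> f \<cdot> w = (unit B \<cdot> counit A) \<cdot> w \<longrightarrow> (\<exists>w'. chom Z K0 w' \<and> e \<cdot> w' = w)"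
    using comonoid_equalizer[OF hA(2) hB(2) hopf_homD(1)[OF ff] triv e] by (elim exE conjE)
  note [simp] = K0(1) chomD(1-3)[OF K0(3)]
  have tr: "(unit B \<cdot> counit A) \<cdot> w = unit B \<cdot> counit Z" if w: "chom Z A w" for Z :: "('o, 'm) comon" and w
  proof -
    note [simp] = chomD(1-3)[OF w]
    show ?thesis by (simp add: chomD(5)[OF w])
  qed
  have fac: "\<exists>w'. chom Z K0 w' \<and> e \<cdot> w' = w" if "coc Z" "chom Z A w" "f \<cdot> w = unit B \<cdot> counit Z" for Z :: "('o, 'm) comon" and w
    using fac0[rule_format, OF that(1,2)] that(3) tr[OF that(2)] by simp
  have fe: "f \<cdot> e = unit B \<cdot> counit K0" using fe0 tr[OF K0(3)] by simp
  have cm: "chom (tc K0 K0) A (mul A \<cdot> (e \<odot> e))"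
    by (rule chom_comp[OF ten_chom[OF K0(3) K0(3)] mul_chom]) simp_all
  have "f \<cdot> mul A \<cdot> (e \<odot> e) = (f \<cdot> mul A) \<cdot> (e \<odot> e)" by simp
  also have "\<dots> = mul B \<cdot> ((f \<cdot> e) \<odot> (f \<cdot> e))" unfolding hopf_homD(7)[OF ff] by simp
  also have "\<dots> = (mul B \<cdot> (unit B \<odot> unit B)) \<cdot> (counit K0 \<odot> counit K0)" unfolding fe by simp
  also have "\<dots> = unit B \<cdot> counit (tc K0 K0)" unfolding mul_units[OF hB(1)] by (simp add: tc_sel)
  finally obtain mk where mk: "chom (tc K0 K0) K0 mk" "e \<cdot> mk = mul A \<cdot> (e \<odot> e)"
    using fac[OF coc_tc[OF K0(1) K0(1)] cm] by blast
  have uA: "chom unit_hopf A (unit A)" using hopf_homD(1)[of unit_hopf A "unit A"] A by (simp add: hopf_hom_from_unit)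
  have "f \<cdot> unit A = unit B \<cdot> counit (underlying_comon unit_hopf)" by (simp add: hopf_homD(8)[OF ff])
  moreover have "coc (underlying_comon unit_hopf)" "chom (underlying_comon unit_hopf) A (unit A)"
    using uA hopf_cocD(2)[OF hopf_coc_unit] by simp_all
  ultimately obtain uk where uk: "chom unit_hopf K0 uk" "e \<cdot> uk = unit A"
    using fac underlying_comon(5) by blast
  have cs: "chom K0 A (antipode A \<cdot> e)" by (rule chom_comp[OF K0(3) antipode_chom]) simp_all
  have "f \<cdot> antipode A \<cdot> e = (f \<cdot> antipode A) \<cdot> e" by simp
  also have "\<dots> = antipode B \<cdot> (f \<cdot> e)" unfolding hopf_hom_antipode[OF hA(1) hB(1) ff] by simp
  also have "\<dots> = (antipode B \<cdot> unit B) \<cdot> counit K0" unfolding fe by simp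
  also have "\<dots> = unit B \<cdot> counit K0" unfolding antipode_unit[OF B] ..
  finally obtain sk where sk: "chom K0 K0 sk" "e \<cdot> sk = antipode A \<cdot> e" using fac[OF K0(1) cs] by blast
  define K :: "('o, 'm) hopf" where
    "K = \<lparr>cob = cob K0, comul = comul K0, counit = counit K0, mul = mk, unit = uk, antipode = sk\<rparr>"
  have Ks [simp]: "cob K = cob K0" "comul K = comul K0" "counit K = counit K0" "mul K = mk" "unit K = uk" "antipode K = sk"
    by (simp_all add: K_def)
  have cK: "coc K" using K0(1) unfolding coc_def comonoid_def cocommutative_def Ks .
  have jK: "chom K A e" using K0(3) unfolding comonoid_hom_def Ks .
  have hK: "hopf_monoid M K" "hopf_hom M K A e"
    using hopf_submonoid[OF hA cK em jK] chomD(1-3)[OF mk(1)] mk(2) chomD(1-3)[OF uk(1)] uk(2) chomD(1-3)[OF sk(1)] sk(2)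
    by simp_all
  have K: "hopf_coc K" using hK cK by (simp add: hopf_coc_def)
  have toK: "chom Z K w \<longleftrightarrow> chom Z K0 w" for Z :: "('o, 'm) comon" and w unfolding comonoid_hom_def Ks ..
  have ker: "is_kernel H (K, e, A) (A, f, B)"
    unfolding is_kernel_def
  proof (intro conjI allI ballI impI)
    show "is_zero_arr H (Cmp H (A, f, B) (K, e, A))" by (simp add: H_zero_iff K B fe)
    fix X x assume x: "x \<in> Hom H X (Dom H (A, f, B))" "is_zero_arr H (Cmp H (A, f, B) x)"
    then obtain w where xw: "x = (X, w, A)" and w: "hopf_coc X" "hopf_hom M X A w" by (cases x) auto
    have fw: "f \<cdot> w = unit B \<cdot> counit X" using x(2) by (simp add: xw H_zero_iff)
    obtain w' where w': "chom X K0 w'" "e \<cdot> w' = w"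
      using fac[of "underlying_comon X" w] fw hopf_homD(1)[OF w(2)] hopf_cocD(2)[OF w(1)]
      unfolding underlying_comon by blast
    have hw': "hopf_hom M X K w'"
      by (rule mono_hopf_factor[OF em hK(2) w(2) _ _ _ w'(2)])
        (use chomD(1-3)[OF w'(1)] hK hA hopf_cocD[OF w(1)] in simp_all)
    show "\<exists>!y. y \<in> Hom H X (Dom H (K, e, A)) \<and> Cmp H (K, e, A) y = x"
    proof (rule ex1I[of _ "(X, w', K)"])
      show "(X, w', K) \<in> Hom H X (Dom H (K, e, A)) \<and> Cmp H (K, e, A) (X, w', K) = x"
        using w K hw' w' by (simp add: xw)
      fix y assume y: "y \<in> Hom H X (Dom H (K, e, A)) \<and> Cmp H (K, e, A) y = x"
      then obtain v where yv: "y = (X, v, K)" and v: "hopf_hom M X K v" by (cases y) auto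
      have "e \<cdot> v = w" using y by (simp add: yv xw)
      then show "y = (X, w', K)"
        using mono_cancel[OF em, of v w'] w'(2) chomD(1-3)[OF w'(1)] hopf_homD(2-4)[OF v] by (simp add: yv)
    qed
  qed (use A B K ff hK in simp_all)
  have "f \<cdot> e = unit B \<cdot> counit K" using fe by simp
  moreover have "\<forall>(Z :: ('o, 'm) comon) w. coc Z \<longrightarrow> chom Z A w \<longrightarrow> f \<cdot> w = unit B \<cdot> counit Z \<longrightarrow> (\<exists>w'. chom Z K w' \<and> e \<cdot> w' = w)"
    unfolding toK by (intro allI impI) (rule fac)
  ultimately show ?thesis
    by (intro exI[of _ K] exI[of _ e] conjI K hK(2) em ker)
qed

text \<open>The operations of \<open>B\<close> restrict to the image by diagonals between the epi
  \<open>\<pi>\<close>, or \<open>\<pi> \<odot> \<pi>\<close>, and the mono \<open>i\<close>. The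
  comultiplication needs the coideal criterion: a diagonal against \<open>idn ?b \<odot> i\<close>
  shows that the image is a left coideal of \<open>B\<close>.\<close>

lemma hopf_image:
  assumes f: "(A, f, B) \<in> Arr H" and k: "is_kernel M k f" and \<pi>: "is_cokernel M \<pi> k"
  shows "\<exists>Q i. hopf_coc Q \<and> cob Q = Cod M \<pi> \<and> hopf_hom M A Q \<pi> \<and> hopf_hom M Q B i \<and> is_mono M i \<and> i \<cdot> \<pi> = f"
proof -
  have A: "hopf_coc A" and B: "hopf_coc B" and ff: "hopf_hom M A B f" using f by simp_all
  note hA = hopf_cocD[OF A] and hB = hopf_cocD[OF B]
  note fD = hopf_homD[OF ff]
  obtain i where i: "is_mono M i" "Dom M i = Cod M \<pi>" "Cod M i = Cod M f" "i \<cdot> \<pi> = f"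
    using mono_epi_factorization[OF k \<pi>] by blast
  note e = cokernel_epi[OF \<pi>]
  note [simp] = hA hB fD(2-4) mono_arr[OF i(1)] i(2,3) epi_arr[OF e]
  have [simp]: "Dom M \<pi> = cob A" using cokernelD(3)[OF \<pi>] kernelD(3)[OF k] by simp
  let ?a = "cob A" and ?b = "cob B" and ?q = "Cod M \<pi>"
  have bo: "?b \<in> Ob M" by simp
  have "(idn ?b \<odot> i) \<cdot> (f \<odot> \<pi>) \<cdot> comul A = (f \<odot> (i \<cdot> \<pi>)) \<cdot> comul A" by simp
  also have "\<dots> = comul B \<cdot> (i \<cdot> \<pi>)" unfolding i(4) fD(5) ..
  also have "\<dots> = (comul B \<cdot> i) \<cdot> \<pi>" by simp
  finally obtain x where x: "x \<in> Arr M" "Dom M x = ?q" "Cod M x = ?b \<boxtimes> ?q" "(idn ?b \<odot> i) \<cdot> x = comul B \<cdot> i"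
    by (rule diagonal_fill_in[OF e ten_id_mono(1)[OF i(1) bo]]) simp_all
  obtain Q0 :: "('o, 'm) comon" where Q0: "coc Q0" "cob Q0 = ?q" "chom Q0 B i"
    using coideal_subcomonoid[OF hB(2) i(1), of x] x by auto
  have "i \<cdot> \<pi> \<cdot> mul A = (i \<cdot> \<pi>) \<cdot> mul A" by simp
  also have "\<dots> = mul B \<cdot> ((i \<cdot> \<pi>) \<odot> (i \<cdot> \<pi>))" unfolding i(4) by (rule fD(7))
  also have "\<dots> = (mul B \<cdot> (i \<odot> i)) \<cdot> (\<pi> \<odot> \<pi>)" by simp
  finally obtain m where m: "m \<in> Arr M" "Dom M m = ?q \<boxtimes> ?q" "Cod M m = ?q" "i \<cdot> m = mul B \<cdot> (i \<odot> i)" "m \<cdot> (\<pi> \<odot> \<pi>) = \<pi> \<cdot> mul A"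
    by (rule diagonal_fill_in[OF ten_epi[OF e e] i(1)]) simp_all
  have "i \<cdot> \<pi> \<cdot> antipode A = (i \<cdot> \<pi>) \<cdot> antipode A" by simp
  also have "\<dots> = antipode B \<cdot> (i \<cdot> \<pi>)" unfolding i(4) by (rule hopf_hom_antipode[OF hA(1) hB(1) ff])
  also have "\<dots> = (antipode B \<cdot> i) \<cdot> \<pi>" by simp
  finally obtain s where s: "s \<in> Arr M" "Dom M s = ?q" "Cod M s = ?q" "i \<cdot> s = antipode B \<cdot> i"
    by (rule diagonal_fill_in[OF e i(1)]) simp_all
  have "i \<cdot> \<pi> \<cdot> unit A = (i \<cdot> \<pi>) \<cdot> unit A" by simp
  then have u: "i \<cdot> \<pi> \<cdot> unit A = unit B" unfolding i(4) by (simp only: fD(8))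
  define Q :: "('o, 'm) hopf" where
    "Q = \<lparr>cob = cob Q0, comul = comul Q0, counit = counit Q0, mul = m, unit = \<pi> \<cdot> unit A, antipode = s\<rparr>"
  have Qs: "cob Q = cob Q0" "comul Q = comul Q0" "counit Q = counit Q0" "mul Q = m" "unit Q = \<pi> \<cdot> unit A" "antipode Q = s"
    by (simp_all add: Q_def)
  have cQ: "coc Q" using Q0(1) unfolding coc_def comonoid_def cocommutative_def Qs .
  have iQ: "chom Q B i" using Q0(3) unfolding comonoid_hom_def Qs .
  have hQ: "hopf_monoid M Q" "hopf_hom M Q B i"
    using hopf_submonoid[OF hB cQ i(1) iQ] m s u unfolding Qs Q0(2) by simp_all
  then have Q: "hopf_coc Q" using cQ by (simp add: hopf_coc_def)
  have "hopf_hom M A Q \<pi>"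
    by (rule mono_hopf_factor[OF i(1) hQ(2) ff _ _ _ i(4) hB(1) hQ(1) hA(1)]) (simp_all add: Qs Q0)
  then show ?thesis using Q hQ(2) i(1,4) Qs(1) Q0(2) by auto
qed

text \<open>Every operation of the quotient is determined by cancelling \<open>\<pi>\<close> or
  \<open>\<pi> \<odot> \<pi>\<close>. The carrier is the codomain of \<open>\<pi>\<close>, so the
  records are equal and not just isomorphic.\<close>

lemma quotient_hopf_unique:
  assumes e: "is_epi M \<pi>" and Q: "hopf_coc Q" "hopf_hom M A Q \<pi>" and Q': "hopf_coc Q'" "hopf_hom M A Q' \<pi>" and A: "hopf_coc A"
  shows "Q = Q'"
proof -
  note hA = hopf_cocD[OF A] and hQ = hopf_cocD[OF Q(1)] and hQ' = hopf_cocD[OF Q'(1)]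
  note D = hopf_homD[OF Q(2)] and D' = hopf_homD[OF Q'(2)]
  note [simp] = hA hQ hQ' D(2-3)
  have c: "cob Q = cob Q'" "Cod M \<pi> = cob Q" using D(4) D'(4) by simp_all
  note [simp] = c(2)
  have [simp]: "cob Q' = cob Q" using c by simp
  have canc: "x = y" if "x \<cdot> \<pi> = y \<cdot> \<pi>" "x \<in> Arr M" "y \<in> Arr M" "Dom M x = cob Q" "Dom M y = cob Q" "Cod M x = Cod M y" for x y
    using epi_cancel[OF e that(1)] that by simp
  have "comul Q = comul Q'" by (rule canc) (simp_all add: D(5) D'(5))
  moreover have "counit Q = counit Q'" by (rule canc) (simp_all add: D(6) D'(6))
  moreover have "mul Q = mul Q'"
    using epi_cancel[OF ten_epi[OF e e], of "mul Q" "mul Q'"] by (simp flip: D(7) D'(7))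
  moreover have "unit Q = unit Q'" using D(8) D'(8) by simp
  moreover have "antipode Q = antipode Q'"
    by (rule canc) (simp_all flip: hopf_hom_antipode[OF hA(1) hQ(1) Q(2)] hopf_hom_antipode[OF hA(1) hQ'(1) Q'(2)])
  ultimately show ?thesis using c(1) by simp
qed

subsection \<open>Comodules and cotensor products\<close>

lemma right_comoduleI: "cmob V \<in> Ob M \<Longrightarrow> coact V \<in> Arr M \<Longrightarrow> Dom M (coact V) = cmob V \<Longrightarrow> Cod M (coact V) = cmob V \<boxtimes> cob Q \<Longrightarrow>
    asc (cmob V) (cob Q) (cob Q) \<cdot> (coact V \<odot> idn (cob Q)) \<cdot> coact V = (idn (cmob V) \<odot> comul Q) \<cdot> coact V \<Longrightarrow>
    run (cmob V) \<cdot> (idn (cmob V) \<odot> counit Q) \<cdot> coact V = idn (cmob V) \<Longrightarrow> right_comodule M Q V"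
  unfolding right_comodule_def Hom_iff by blast

lemma right_comoduleD: assumes "right_comodule M Q V"
  shows "cmob V \<in> Ob M" "coact V \<in> Arr M" "Dom M (coact V) = cmob V" "Cod M (coact V) = cmob V \<boxtimes> cob Q"
    "asc (cmob V) (cob Q) (cob Q) \<cdot> (coact V \<odot> idn (cob Q)) \<cdot> coact V = (idn (cmob V) \<odot> comul Q) \<cdot> coact V"
    "run (cmob V) \<cdot> (idn (cmob V) \<odot> counit Q) \<cdot> coact V = idn (cmob V)"
  using assms unfolding right_comodule_def Hom_iff by blast+

lemma RComod_arr: "(V, g, W) \<in> Arr (RComod M Q) \<longleftrightarrow> right_comodule M Q V \<and> right_comodule M Q W \<and> right_comodule_hom M Q V W g"
  unfolding RComod_def structured_cat_def right_comodule_hom_def by auto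

lemma RComod_simps: "Dom (RComod M Q) (V, g, W) = V" "Cod (RComod M Q) (V, g, W) = W"
    "Cmp (RComod M Q) (V', h, W) (V, g, V') = (V, h \<cdot> g, W)"
  by (simp_all add: RComod_def structured_cat_def)

text \<open>The coaction is \<open>x \<mapsto> (x, h x)\<close>, and its two laws are equalities of
  tuples.\<close>

lemma right_comodule_of_chom:
  assumes X: "comonoid M X" and Q: "comonoid M Q" and h: "chom X Q h"
  shows "right_comodule M Q \<lparr>cmob = cob X, coact = pr X (idn (cob X)) h\<rparr>"
proof -
  note [simp] = X Q chomD(1-3)[OF h] comul_cmp[OF h] chomD(5)[OF h]
  show ?thesis by (rule right_comoduleI) simp_all
qed

text \<open>Both laws hold after embedding into \<open>V\<close>: \<open>n\<close>, tensored with an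
  identity or not, cancels by exactness.\<close>

lemma subcomodule:
  assumes V: "right_comodule M Q V" and Q: "comonoid M Q" and n: "is_mono M n" "Cod M n = cmob V"
    and r: "r \<in> Arr M" "Dom M r = Dom M n" "Cod M r = Dom M n \<boxtimes> cob Q" "(n \<odot> idn (cob Q)) \<cdot> r = coact V \<cdot> n"
  shows "right_comodule M Q \<lparr>cmob = Dom M n, coact = r\<rparr>"
proof -
  note VD = right_comoduleD[OF V]
  note [simp] = Q mono_arr[OF n(1)] n(2) r(1-3) VD(1-4)
  let ?q = "cob Q" and ?v = "cmob V" and ?n = "Dom M n"
  have "(n \<odot> idn (?q \<boxtimes> ?q)) \<cdot> asc ?n ?q ?q \<cdot> (r \<odot> idn ?q) \<cdot> r = ((n \<odot> idn ?q \<odot> idn ?q) \<cdot> asc ?n ?q ?q) \<cdot> (r \<odot> idn ?q) \<cdot> r" by simp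
  also have "(n \<odot> idn ?q \<odot> idn ?q) \<cdot> asc ?n ?q ?q = asc ?v ?q ?q \<cdot> ((n \<odot> idn ?q) \<odot> idn ?q)" by (subst asc_nat') simp_all
  also have "(asc ?v ?q ?q \<cdot> ((n \<odot> idn ?q) \<odot> idn ?q)) \<cdot> (r \<odot> idn ?q) \<cdot> r = asc ?v ?q ?q \<cdot> (((n \<odot> idn ?q) \<cdot> r) \<odot> idn ?q) \<cdot> r" by simp
  also have "\<dots> = asc ?v ?q ?q \<cdot> ((coact V \<cdot> n) \<odot> idn ?q) \<cdot> r" unfolding r(4) ..
  also have "\<dots> = asc ?v ?q ?q \<cdot> (coact V \<odot> idn ?q) \<cdot> ((n \<odot> idn ?q) \<cdot> r)" by simp
  also have "\<dots> = (asc ?v ?q ?q \<cdot> (coact V \<odot> idn ?q) \<cdot> coact V) \<cdot> n" unfolding r(4) by simp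
  also have "\<dots> = (idn ?v \<odot> comul Q) \<cdot> (coact V \<cdot> n)" unfolding VD(5) by simp
  also have "\<dots> = (n \<odot> idn (?q \<boxtimes> ?q)) \<cdot> (idn ?n \<odot> comul Q) \<cdot> r" unfolding r(4)[symmetric] by simp
  finally have 1: "asc ?n ?q ?q \<cdot> (r \<odot> idn ?q) \<cdot> r = (idn ?n \<odot> comul Q) \<cdot> r"
    using mono_cancel[OF ten_id_mono(2)[OF n(1), of "?q \<boxtimes> ?q"], of "asc ?n ?q ?q \<cdot> (r \<odot> idn ?q) \<cdot> r" "(idn ?n \<odot> comul Q) \<cdot> r"] by simp
  have "n \<cdot> run ?n \<cdot> (idn ?n \<odot> counit Q) \<cdot> r = (n \<cdot> run ?n) \<cdot> (idn ?n \<odot> counit Q) \<cdot> r" by simp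
  also have "n \<cdot> run ?n = run ?v \<cdot> (n \<odot> idn I)" by (subst run_nat') simp_all
  also have "(run ?v \<cdot> (n \<odot> idn I)) \<cdot> (idn ?n \<odot> counit Q) \<cdot> r = run ?v \<cdot> (idn ?v \<odot> counit Q) \<cdot> ((n \<odot> idn ?q) \<cdot> r)" by simp
  also have "\<dots> = (run ?v \<cdot> (idn ?v \<odot> counit Q) \<cdot> coact V) \<cdot> n" unfolding r(4) by simp
  also have "\<dots> = n" unfolding VD(6) by simp
  finally have 2: "run ?n \<cdot> (idn ?n \<odot> counit Q) \<cdot> r = idn ?n"
    using mono_cancel[OF n(1), of "run ?n \<cdot> (idn ?n \<odot> counit Q) \<cdot> r" "idn ?n"] by simp
  show ?thesis by (rule right_comoduleI) (use 1 2 in simp_all)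
qed

lemma quotient_comodule:
  assumes V: "right_comodule M Q V" and Q: "comonoid M Q" and c: "is_epi M c" "Dom M c = cmob V"
    and r: "r \<in> Arr M" "Dom M r = Cod M c" "Cod M r = Cod M c \<boxtimes> cob Q" "(c \<odot> idn (cob Q)) \<cdot> coact V = r \<cdot> c"
  shows "right_comodule M Q \<lparr>cmob = Cod M c, coact = r\<rparr>"
proof -
  note VD = right_comoduleD[OF V]
  note [simp] = Q epi_arr[OF c(1)] c(2) r(1-3) VD(1-4)
  let ?q = "cob Q" and ?v = "cmob V" and ?t = "Cod M c"
  have "(asc ?t ?q ?q \<cdot> (r \<odot> idn ?q) \<cdot> r) \<cdot> c = asc ?t ?q ?q \<cdot> (r \<odot> idn ?q) \<cdot> (r \<cdot> c)" by simp
  also have "\<dots> = asc ?t ?q ?q \<cdot> (r \<odot> idn ?q) \<cdot> ((c \<odot> idn ?q) \<cdot> coact V)" unfolding r(4) ..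
  also have "\<dots> = asc ?t ?q ?q \<cdot> ((r \<cdot> c) \<odot> idn ?q) \<cdot> coact V" by simp
  also have "\<dots> = (asc ?t ?q ?q \<cdot> ((c \<odot> idn ?q) \<odot> idn ?q)) \<cdot> (coact V \<odot> idn ?q) \<cdot> coact V" unfolding r(4)[symmetric] by simp
  also have "asc ?t ?q ?q \<cdot> ((c \<odot> idn ?q) \<odot> idn ?q) = (c \<odot> idn ?q \<odot> idn ?q) \<cdot> asc ?v ?q ?q" by (subst asc_nat') simp_all
  also have "((c \<odot> idn ?q \<odot> idn ?q) \<cdot> asc ?v ?q ?q) \<cdot> (coact V \<odot> idn ?q) \<cdot> coact V
     = (c \<odot> idn (?q \<boxtimes> ?q)) \<cdot> (asc ?v ?q ?q \<cdot> (coact V \<odot> idn ?q) \<cdot> coact V)" by simp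
  also have "\<dots> = (idn ?t \<odot> comul Q) \<cdot> ((c \<odot> idn ?q) \<cdot> coact V)" unfolding VD(5) by simp
  also have "\<dots> = ((idn ?t \<odot> comul Q) \<cdot> r) \<cdot> c" unfolding r(4) by simp
  finally have 1: "asc ?t ?q ?q \<cdot> (r \<odot> idn ?q) \<cdot> r = (idn ?t \<odot> comul Q) \<cdot> r"
    using epi_cancel[OF c(1), of "asc ?t ?q ?q \<cdot> (r \<odot> idn ?q) \<cdot> r" "(idn ?t \<odot> comul Q) \<cdot> r"] by simp
  have "(run ?t \<cdot> (idn ?t \<odot> counit Q) \<cdot> r) \<cdot> c = run ?t \<cdot> (idn ?t \<odot> counit Q) \<cdot> (r \<cdot> c)" by simp
  also have "\<dots> = (run ?t \<cdot> (c \<odot> idn I)) \<cdot> (idn ?v \<odot> counit Q) \<cdot> coact V" unfolding r(4)[symmetric] by simp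
  also have "run ?t \<cdot> (c \<odot> idn I) = c \<cdot> run ?v" by (subst run_nat') simp_all
  also have "(c \<cdot> run ?v) \<cdot> (idn ?v \<odot> counit Q) \<cdot> coact V = c \<cdot> (run ?v \<cdot> (idn ?v \<odot> counit Q) \<cdot> coact V)" by simp
  also have "\<dots> = idn ?t \<cdot> c" unfolding VD(6) by simp
  finally have 2: "run ?t \<cdot> (idn ?t \<odot> counit Q) \<cdot> r = idn ?t"
    using epi_cancel[OF c(1), of "run ?t \<cdot> (idn ?t \<odot> counit Q) \<cdot> r" "idn ?t"] by simp
  show ?thesis by (rule right_comoduleI) (use 1 2 in simp_all)
qed

lemma zer_ten_id: assumes [simp]: "X \<in> Ob M" "Y \<in> Ob M" "Z \<in> Ob M" shows "Zer M X Y \<odot> idn Z = Zer M (X \<boxtimes> Z) (Y \<boxtimes> Z)"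
proof -
  have "dif (Zer M X Y) (Zer M X Y) \<odot> idn Z = dif (Zer M X Y \<odot> idn Z) (Zer M X Y \<odot> idn Z)"
    by (rule ten_id_dif) simp_all
  moreover have "dif (Zer M X Y) (Zer M X Y) = Zer M X Y" by (rule dif_zer) simp_all
  moreover have "dif (Zer M X Y \<odot> idn Z) (Zer M X Y \<odot> idn Z) = Zer M (X \<boxtimes> Z) (Y \<boxtimes> Z)"
    using dif_zero_iff[of "Zer M X Y \<odot> idn Z" "Zer M X Y \<odot> idn Z"] by simp
  ultimately show ?thesis by simp
qed

text \<open>The cokernel of a comodule morphism \<open>d\<close> is a comodule; if \<open>d\<close> is epi among comodules, the projection
  to this cokernel agrees with the zero morphism.\<close>

lemma comodule_epi_is_epi:
  assumes Q: "comonoid M Q" and d: "is_epi (RComod M Q) (V, d, W)"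
  shows "is_epi M d"
proof -
  have arr: "(V, d, W) \<in> Arr (RComod M Q)"
    and canc: "\<And>Y g h. g \<in> Hom (RComod M Q) W Y \<Longrightarrow> h \<in> Hom (RComod M Q) W Y \<Longrightarrow>
      Cmp (RComod M Q) g (V, d, W) = Cmp (RComod M Q) h (V, d, W) \<Longrightarrow> g = h"
    using d unfolding is_epi_def RComod_simps by blast+
  have V: "right_comodule M Q V" and W: "right_comodule M Q W" and dh: "right_comodule_hom M Q V W d"
    using arr unfolding RComod_arr by blast+
  note VD = right_comoduleD[OF V] and WD = right_comoduleD[OF W]
  have dD: "d \<in> Arr M" "Dom M d = cmob V" "Cod M d = cmob W" "coact W \<cdot> d = (d \<odot> idn (cob Q)) \<cdot> coact V"
    using dh unfolding right_comodule_hom_def by auto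
  note [simp] = Q VD(1-4) WD(1-4) dD(1-3)
  let ?q = "cob Q"
  obtain c where c: "is_cokernel M c d" using ex_cokernel[of d] by auto
  note ce = cokernel_epi[OF c]
  note [simp] = cokernelD(2)[OF c] and [simp] = cokernelD(3)[OF c, simplified]
  have "((c \<odot> idn ?q) \<cdot> coact W) \<cdot> d = (c \<odot> idn ?q) \<cdot> (coact W \<cdot> d)" by simp
  also have "\<dots> = ((c \<cdot> d) \<odot> idn ?q) \<cdot> coact V" unfolding dD(4) by simp
  also have "\<dots> = Zer M (cmob V) (Cod M c \<boxtimes> ?q)" unfolding cokernel_zero[OF c] by (simp add: zer_ten_id)
  finally obtain r where r: "r \<in> Arr M" "Dom M r = Cod M c" "Cod M r = Cod M c \<boxtimes> ?q" "r \<cdot> c = (c \<odot> idn ?q) \<cdot> coact W"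
    using cokernel_factor[OF c, of "(c \<odot> idn ?q) \<cdot> coact W"] by auto
  let ?T = "\<lparr>cmob = Cod M c, coact = r\<rparr>"
  have T: "right_comodule M Q ?T" by (rule quotient_comodule[OF W Q ce _ r(1-3) r(4)[symmetric]]) simp
  have h1: "right_comodule_hom M Q W ?T c" unfolding right_comodule_hom_def by (simp add: r(4))
  have h2: "right_comodule_hom M Q W ?T (Zer M (cmob W) (Cod M c))" unfolding right_comodule_hom_def
    using r(1-3) by (simp add: zer_ten_id)
  have "(W, c, ?T) = (W, Zer M (cmob W) (Cod M c), ?T)"
    by (rule canc) (simp_all add: Hom_def RComod_arr RComod_simps W T cokernel_zero[OF c] h1 h2)
  then have c0: "c = Zer M (cmob W) (Cod M c)" by simp
  show ?thesis
  proof (rule epiI)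
    fix g h assume gh [simp]: "g \<in> Arr M" "h \<in> Arr M" "Dom M g = Cod M d" "Dom M h = Cod M d" "Cod M g = Cod M h" and e: "g \<cdot> d = h \<cdot> d"
    \<comment> \<open>A coincidence \<open>g \<cdot> d = h \<cdot> d\<close> makes the difference
      factor through \<open>c\<close>, which has just been shown to be zero.\<close>
    have "dif g h \<cdot> d = Zer M (cmob V) (Cod M h)" using dif_zero_iff[of "h \<cdot> d" "h \<cdot> d"] by (simp add: dif_cmp e)
    then obtain y where y: "y \<in> Arr M" "Dom M y = Cod M c" "Cod M y = Cod M h" "y \<cdot> c = dif g h"
      using cokernel_factor[OF c, of "dif g h"] by auto
    have "y \<cdot> Zer M (cmob W) (Cod M c) = Zer M (cmob W) (Cod M h)" using y by simp
    then have "dif g h = Zer M (cmob W) (Cod M h)" unfolding c0[symmetric] y(4) .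
    then show "g = h" using dif_zero_iff[of g h] by simp
  qed simp
qed

lemma cotensorD:
  assumes e: "is_cotensor M q V W e" and "cmob V \<in> Ob M" "cmob W \<in> Ob M" "q \<in> Ob M"
    "coact V \<in> Arr M" "Dom M (coact V) = cmob V" "Cod M (coact V) = cmob V \<boxtimes> q"
    "coact W \<in> Arr M" "Dom M (coact W) = cmob W" "Cod M (coact W) = q \<boxtimes> cmob W"
  shows "e \<in> Arr M" "Cod M e = cmob V \<boxtimes> cmob W" "is_mono M e"
    "asc (cmob V) q (cmob W) \<cdot> (coact V \<odot> idn (cmob W)) \<cdot> e = (idn (cmob V) \<odot> coact W) \<cdot> e"
    "\<And>x. x \<in> Arr M \<Longrightarrow> Cod M x = cmob V \<boxtimes> cmob W \<Longrightarrow>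
      asc (cmob V) q (cmob W) \<cdot> (coact V \<odot> idn (cmob W)) \<cdot> x = (idn (cmob V) \<odot> coact W) \<cdot> x \<Longrightarrow>
      \<exists>y. y \<in> Arr M \<and> Dom M y = Dom M x \<and> Cod M y = Dom M e \<and> e \<cdot> y = x"
proof -
  note [simp] = assms(2-)
  note e' = e[unfolded is_cotensor_def]
  note D = equalizerD[OF e']
  show [simp]: "e \<in> Arr M" "Cod M e = cmob V \<boxtimes> cmob W" using D(5,6) by simp_all
  show "is_mono M e" by (rule equalizer_mono[OF e'])
  show "asc (cmob V) q (cmob W) \<cdot> (coact V \<odot> idn (cmob W)) \<cdot> e = (idn (cmob V) \<odot> coact W) \<cdot> e" using D(7) by simp
  fix x assume "x \<in> Arr M" "Cod M x = cmob V \<boxtimes> cmob W"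
    "asc (cmob V) q (cmob W) \<cdot> (coact V \<odot> idn (cmob W)) \<cdot> x = (idn (cmob V) \<odot> coact W) \<cdot> x"
  then show "\<exists>y. y \<in> Arr M \<and> Dom M y = Dom M x \<and> Cod M y = Dom M e \<and> e \<cdot> y = x"
    by (intro equalizer_factor[OF e']) simp_all
qed

lemma cotensor_ex:
  assumes "cmob V \<in> Ob M" "cmob W \<in> Ob M" "q \<in> Ob M"
    "coact V \<in> Arr M" "Dom M (coact V) = cmob V" "Cod M (coact V) = cmob V \<boxtimes> q"
    "coact W \<in> Arr M" "Dom M (coact W) = cmob W" "Cod M (coact W) = q \<boxtimes> cmob W"
  shows "is_cotensor M q V W (cotensor M q V W)"
proof -
  note [simp] = assms
  let ?f = "asc (cmob V) q (cmob W) \<cdot> (coact V \<odot> idn (cmob W))" and ?g = "idn (cmob V) \<odot> coact W"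
  obtain e where "is_kernel M e (dif ?f ?g)" using ex_kernel[of "dif ?f ?g"] by auto
  then have "is_equalizer M e ?f ?g" by (subst (asm) kernel_dif_iff) simp_all
  then have "is_cotensor M q V W e" by (simp only: is_cotensor_def)
  then show ?thesis unfolding cotensor_def by (rule someI)
qed

text \<open>Identifies the arrow described by \<open>THE\<close> in \<open>cotensor_functor\<close>:
  the factorization exists because \<open>d\<close> respects the coactions, and it is unique because
  \<open>e'\<close> is mono.\<close>

lemma cotensor_map:
  assumes V: "right_comodule M Q V" and V': "right_comodule M Q V'" and d: "right_comodule_hom M Q V V' d" and Q: "comonoid M Q"
    and W: "cmob W \<in> Ob M" "coact W \<in> Arr M" "Dom M (coact W) = cmob W" "Cod M (coact W) = cob Q \<boxtimes> cmob W"
  defines "e \<equiv> cotensor M (cob Q) V W" and "e' \<equiv> cotensor M (cob Q) V' W" and "h \<equiv> cotensor_functor M (cob Q) W (V, d, V')"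
  shows "h \<in> Arr M" "Dom M h = Dom M e" "Cod M h = Dom M e'" "e' \<cdot> h = (d \<odot> idn (cmob W)) \<cdot> e"
proof -
  note VD = right_comoduleD[OF V] and VD' = right_comoduleD[OF V']
  have dD: "d \<in> Arr M" "Dom M d = cmob V" "Cod M d = cmob V'" "coact V' \<cdot> d = (d \<odot> idn (cob Q)) \<cdot> coact V"
    using d unfolding right_comodule_hom_def by auto
  note [simp] = Q W VD(1-4) VD'(1-4) dD(1-3)
  let ?q = "cob Q" and ?w = "cmob W" and ?v = "cmob V" and ?v' = "cmob V'"
  have e: "is_cotensor M ?q V W e" and e': "is_cotensor M ?q V' W e'"
    unfolding e_def e'_def by (rule cotensor_ex; simp)+
  note [simp] = cotensorD(1,2)[OF e, simplified] cotensorD(1,2)[OF e', simplified]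
  note eq = cotensorD(4)[OF e, simplified]
  note e'm = cotensorD(3)[OF e', simplified]
  have "asc ?v' ?q ?w \<cdot> (coact V' \<odot> idn ?w) \<cdot> (d \<odot> idn ?w) \<cdot> e = asc ?v' ?q ?w \<cdot> ((coact V' \<cdot> d) \<odot> idn ?w) \<cdot> e" by simp
  also have "\<dots> = (asc ?v' ?q ?w \<cdot> ((d \<odot> idn ?q) \<odot> idn ?w)) \<cdot> (coact V \<odot> idn ?w) \<cdot> e" unfolding dD(4) by simp
  also have "asc ?v' ?q ?w \<cdot> ((d \<odot> idn ?q) \<odot> idn ?w) = (d \<odot> idn ?q \<odot> idn ?w) \<cdot> asc ?v ?q ?w" by (subst asc_nat') simp_all
  also have "((d \<odot> idn ?q \<odot> idn ?w) \<cdot> asc ?v ?q ?w) \<cdot> (coact V \<odot> idn ?w) \<cdot> e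
    = (d \<odot> idn (?q \<boxtimes> ?w)) \<cdot> (asc ?v ?q ?w \<cdot> (coact V \<odot> idn ?w) \<cdot> e)" by simp
  also have "\<dots> = (idn ?v' \<odot> coact W) \<cdot> (d \<odot> idn ?w) \<cdot> e" unfolding eq by simp
  finally obtain y where y: "y \<in> Arr M" "Dom M y = Dom M e" "Cod M y = Dom M e'" "e' \<cdot> y = (d \<odot> idn ?w) \<cdot> e"
    using cotensorD(5)[OF e', of "(d \<odot> idn ?w) \<cdot> e"] by auto
  have "h = (THE h. h \<in> Hom M (Dom M e) (Dom M e') \<and> e' \<cdot> h = (d \<odot> idn ?w) \<cdot> e)"
    by (simp only: h_def cotensor_functor_def e_def e'_def prod.case)
  also have "\<dots> = y"
  proof (rule the_equality)
    show "y \<in> Hom M (Dom M e) (Dom M e') \<and> e' \<cdot> y = (d \<odot> idn ?w) \<cdot> e" using y by simp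
    fix z assume "z \<in> Hom M (Dom M e) (Dom M e') \<and> e' \<cdot> z = (d \<odot> idn ?w) \<cdot> e"
    then show "z = y" using mono_cancel[OF e'm, of z y] y by simp
  qed
  finally have "h = y" .
  with y show "h \<in> Arr M" "Dom M h = Dom M e" "Cod M h = Dom M e'" "e' \<cdot> h = (d \<odot> idn (cmob W)) \<cdot> e" by simp_all
qed

text \<open>The cotensor condition on elements: the two arrows send \<open>(a, b)\<close> to
  \<open>(a, \<pi> a, b)\<close> and to \<open>(a, \<pi> b, b)\<close>, so
  \<open>A \<box>\<^sub>Q A\<close> is the object of pairs with the same image in
  \<open>Q\<close>.\<close>

lemma coreg_pr:
  assumes A: "coc A" and Q: "comonoid M Q" and \<pi>: "chom A Q \<pi>"
  defines "Y \<equiv> tc A A" and "a \<equiv> fst_ten A A" and "b \<equiv> snd_ten A A"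
  shows "asc (cob A) (cob Q) (cob A) \<cdot> (pr A (idn (cob A)) \<pi> \<odot> idn (cob A)) = pr Y a (pr Y (\<pi> \<cdot> a) b)"
    and "idn (cob A) \<odot> pr A \<pi> (idn (cob A)) = pr Y a (pr Y (\<pi> \<cdot> b) b)"
proof -
  note [simp] = A coc_comonoid[OF A] Q chomD(1-3)[OF \<pi>]
  have Y [simp]: "coc Y" "cob Y = cob A \<boxtimes> cob A" by (simp_all add: Y_def)
  note [simp] = coc_comonoid[OF Y(1)]
  have ac: "chom Y A a" and bc: "chom Y A b" unfolding Y_def a_def b_def by (rule fst_ten_chom snd_ten_chom; simp)+
  note [simp] = chomD(1-3)[OF ac] chomD(1-3)[OF bc]
  have ab: "idn (cob A \<boxtimes> cob A) = pr Y a b" unfolding Y_def a_def b_def by (rule pr_fst_snd[symmetric]) simp_all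
  let ?f = "asc (cob A) (cob Q) (cob A) \<cdot> (pr A (idn (cob A)) \<pi> \<odot> idn (cob A))" and ?g = "idn (cob A) \<odot> pr A \<pi> (idn (cob A))"
  have "?f = ?f \<cdot> idn (cob A \<boxtimes> cob A)" by simp
  also have "\<dots> = pr Y a (pr Y (\<pi> \<cdot> a) b)" unfolding ab by (simp add: pr_cmp[OF ac])
  finally show "?f = pr Y a (pr Y (\<pi> \<cdot> a) b)" .
  have "?g = ?g \<cdot> idn (cob A \<boxtimes> cob A)" by simp
  also have "\<dots> = pr Y a (pr Y (\<pi> \<cdot> b) b)" unfolding ab by (simp add: pr_cmp[OF bc])
  finally show "?g = pr Y a (pr Y (\<pi> \<cdot> b) b)" .
qed

subsection \<open>Quotients of a Hopf monoid as module comonoids\<close>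

text \<open>\<open>A\<close> acts on \<open>Q\<close> through \<open>p\<close>. Coflatness is a
  condition on quotients of \<open>A\<close> as a module comonoid, so a Hopf quotient has to be
  presented in this form.\<close>

definition quot_module_comonoid :: "('o, 'm) hopf \<Rightarrow> 'm \<Rightarrow> ('o, 'm) modcomon" where
  "quot_module_comonoid Q p = \<lparr>cob = cob Q, comul = comul Q, counit = counit Q, act = mul Q \<cdot> (p \<odot> idn (cob Q))\<rparr>"

lemma quot_module_comonoid_sel: "cob (quot_module_comonoid Q p) = cob Q" "comul (quot_module_comonoid Q p) = comul Q"
    "counit (quot_module_comonoid Q p) = counit Q" "act (quot_module_comonoid Q p) = mul Q \<cdot> (p \<odot> idn (cob Q))"
  by (simp_all add: quot_module_comonoid_def)

lemma quot_module_comonoid: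
  assumes A: "hopf_coc A" and Q: "hopf_coc Q" and p: "hopf_hom M A Q p"
  shows "module_comonoid M A (quot_module_comonoid Q p)"
proof -
  note hA = hopf_cocD[OF A] and hQ = hopf_cocD[OF Q] and pD = hopf_homD[OF p]
  note [simp] = hA hQ pD(2-4)
  let ?a = "cob A" and ?q = "cob Q"
  have cQ: "comonoid M (quot_module_comonoid Q p) \<and> cocommutative M (quot_module_comonoid Q p)"
    using hQ(2) unfolding coc_def comonoid_def cocommutative_def quot_module_comonoid_sel .
  have "(mul Q \<cdot> (p \<odot> idn ?q)) \<cdot> (mul A \<odot> idn ?q) = mul Q \<cdot> ((p \<cdot> mul A) \<odot> idn ?q)" by simp
  also have "\<dots> = (mul Q \<cdot> (mul Q \<odot> idn ?q)) \<cdot> ((p \<odot> p) \<odot> idn ?q)" unfolding pD(7) by simp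
  also have "\<dots> = mul Q \<cdot> (idn ?q \<odot> mul Q) \<cdot> (asc ?q ?q ?q \<cdot> ((p \<odot> p) \<odot> idn ?q))" unfolding mul_assoc[OF hQ(1)] by simp
  also have "\<dots> = (mul Q \<cdot> (p \<odot> idn ?q)) \<cdot> (idn ?a \<odot> (mul Q \<cdot> (p \<odot> idn ?q))) \<cdot> asc ?a ?a ?q" by (subst asc_nat') simp_all
  finally have 1: "(mul Q \<cdot> (p \<odot> idn ?q)) \<cdot> (mul A \<odot> idn ?q) = (mul Q \<cdot> (p \<odot> idn ?q)) \<cdot> (idn ?a \<odot> (mul Q \<cdot> (p \<odot> idn ?q))) \<cdot> asc ?a ?a ?q" .
  have "(mul Q \<cdot> (p \<odot> idn ?q)) \<cdot> (unit A \<odot> idn ?q) = mul Q \<cdot> ((p \<cdot> unit A) \<odot> idn ?q)" by simp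
  also have "\<dots> = lun ?q" unfolding pD(8) by (rule mul_unit_left[OF hQ(1)])
  finally have 2: "(mul Q \<cdot> (p \<odot> idn ?q)) \<cdot> (unit A \<odot> idn ?q) = lun ?q" .
  have "comul Q \<cdot> mul Q \<cdot> (p \<odot> idn ?q) = (comul Q \<cdot> mul Q) \<cdot> (p \<odot> idn ?q)" by simp
  also have "\<dots> = (mul Q \<odot> mul Q) \<cdot> mid ?q ?q ?q ?q \<cdot> ((comul Q \<cdot> p) \<odot> comul Q)" unfolding comul_mul[OF hQ(1)] by simp
  also have "\<dots> = (mul Q \<odot> mul Q) \<cdot> (mid ?q ?q ?q ?q \<cdot> ((p \<odot> p) \<odot> (idn ?q \<odot> idn ?q))) \<cdot> (comul A \<odot> comul Q)" unfolding pD(5) by simp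
  also have "mid ?q ?q ?q ?q \<cdot> ((p \<odot> p) \<odot> (idn ?q \<odot> idn ?q)) = ((p \<odot> idn ?q) \<odot> (p \<odot> idn ?q)) \<cdot> mid ?a ?a ?q ?q"
    by (subst mid_nat) simp_all
  finally have 3: "comul Q \<cdot> mul Q \<cdot> (p \<odot> idn ?q) = (((mul Q \<cdot> (p \<odot> idn ?q)) \<odot> (mul Q \<cdot> (p \<odot> idn ?q))) \<cdot>
      mid ?a ?a ?q ?q \<cdot> (comul A \<odot> idn (?q \<boxtimes> ?q))) \<cdot> (idn ?a \<odot> comul Q)" by simp
  have "counit Q \<cdot> mul Q \<cdot> (p \<odot> idn ?q) = (counit Q \<cdot> mul Q) \<cdot> (p \<odot> idn ?q)" by simp
  also have "\<dots> = lun I \<cdot> ((counit Q \<cdot> p) \<odot> counit Q)" unfolding counit_mul[OF hQ(1)] by simp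
  also have "\<dots> = (run I \<cdot> (counit A \<odot> idn I)) \<cdot> (idn ?a \<odot> counit Q)" unfolding pD(6) by (simp add: lun_unit_run_unit)
  also have "run I \<cdot> (counit A \<odot> idn I) = counit A \<cdot> run ?a" by (subst run_nat') simp_all
  finally have 4: "counit Q \<cdot> mul Q \<cdot> (p \<odot> idn ?q) = (counit A \<cdot> run ?a) \<cdot> (idn ?a \<odot> counit Q)" .
  have 5: "mul Q \<cdot> (p \<odot> idn ?q) \<in> Hom M (?a \<boxtimes> ?q) ?q" by simp
  show ?thesis unfolding module_comonoid_def quot_module_comonoid_sel
    by (intro conjI cQ[THEN conjunct1] cQ[THEN conjunct2] 1 2 3 4 5)
qed

lemma quot_module_comonoid_arr:
  assumes A: "hopf_coc A" and Q: "hopf_coc Q" and p: "hopf_hom M A Q p"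
  shows "(reg_module_comonoid A, p, quot_module_comonoid Q p) \<in> Arr (ComonCocMod M A)"
proof -
  note hA = hopf_cocD[OF A] and hQ = hopf_cocD[OF Q] and pD = hopf_homD[OF p]
  note [simp] = hA hQ pD(2-4)
  \<comment> \<open>The regular module comonoid is the case of the identity quotient, which yields
    its laws.\<close>
  have "quot_module_comonoid A (idn (cob A)) = reg_module_comonoid A"
    by (simp add: quot_module_comonoid_def reg_module_comonoid_def)
  then have r: "module_comonoid M A (reg_module_comonoid A)"
    using quot_module_comonoid[OF A A hopf_hom_id[OF hA(1)]] by simp
  have rs: "cob (reg_module_comonoid A) = cob A" "comul (reg_module_comonoid A) = comul A" "counit (reg_module_comonoid A) = counit A"
    "act (reg_module_comonoid A) = mul A" by (simp_all add: reg_module_comonoid_def)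
  have "chom (reg_module_comonoid A) (quot_module_comonoid Q p) p"
    using pD(1) unfolding comonoid_hom_def rs quot_module_comonoid_sel .
  moreover have "p \<cdot> mul A = (mul Q \<cdot> (p \<odot> idn (cob Q))) \<cdot> (idn (cob A) \<odot> p)" unfolding pD(7) by simp
  ultimately have "module_comonoid_hom M A (reg_module_comonoid A) (quot_module_comonoid Q p) p"
    unfolding module_comonoid_hom_def rs quot_module_comonoid_sel by blast
  moreover have "p \<in> Hom M (cob (reg_module_comonoid A)) (cob (quot_module_comonoid Q p))"
    by (simp add: rs quot_module_comonoid_sel)
  ultimately show ?thesis using r quot_module_comonoid[OF A Q p]
    by (simp add: ComonCocMod_def structured_cat_def)
qed

subsection \<open>Faithful coflatness\<close>

text \<open>Once \<open>d\<close> is epi, an arrow coequalizes multiplication and projection exactly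
  when it annihilates \<open>n\<close>, and \<open>\<pi>\<close> is the cokernel of
  \<open>n\<close>. The property \<open>univ\<close> is used at \<open>R\<close>, the comonoid
  carried by \<open>A \<box>\<^sub>Q A\<close>.\<close>

lemma phi_coequalizer:
  assumes FC: "faithfully_coflat M"
    and A: "hopf_coc A" and B: "hopf_coc B" and Q: "hopf_coc Q" and K: "hopf_coc K"
    and \<pi>: "hopf_hom M A Q \<pi>" "is_epi M \<pi>" and i: "hopf_hom M Q B i" "is_mono M i"
    and j: "hopf_hom M K A j" "is_mono M j" and ipj: "(i \<cdot> \<pi>) \<cdot> j = unit B \<cdot> counit K"
    and univ: "\<forall>(Z :: ('o, 'm) comon) w. coc Z \<longrightarrow> chom Z A w \<longrightarrow> (i \<cdot> \<pi>) \<cdot> w = unit B \<cdot> counit Z \<longrightarrow> (\<exists>w'. chom Z K w' \<and> j \<cdot> w' = w)"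
  shows "is_coequalizer M \<pi> (mul A \<cdot> (idn (cob A) \<odot> j)) (run (cob A) \<cdot> (idn (cob A) \<odot> counit K))"
    and "\<pi> \<cdot> j = unit Q \<cdot> counit K"
proof -
  note hA = hopf_cocD[OF A] and hB = hopf_cocD[OF B] and hQ = hopf_cocD[OF Q] and hK = hopf_cocD[OF K]
  note \<pi>D = hopf_homD[OF \<pi>(1)] and iD = hopf_homD[OF i(1)] and jD = hopf_homD[OF j(1)]
  note [simp] = hA hB hQ hK \<pi>D(2-4) iD(2-4) jD(2-4)
  let ?a = "cob A" and ?q = "cob Q" and ?k = "cob K"
  have "i \<cdot> \<pi> \<cdot> j = i \<cdot> unit Q \<cdot> counit K"
    using ipj hopf_hom_unit_counit[OF hQ(1) coc_comonoid[OF hK(2)] i(1)] by simp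
  then show \<pi>j: "\<pi> \<cdot> j = unit Q \<cdot> counit K" using mono_cancel[OF i(2), of "\<pi> \<cdot> j" "unit Q \<cdot> counit K"] by simp
  define X where "X = tc A K"
  define p where "p = fst_ten A K"
  define q where "q = snd_ten A K"
  have cX [simp]: "coc X" and [simp]: "cob X = ?a \<boxtimes> ?k" by (simp_all add: X_def)
  note [simp] = coc_comonoid[OF cX]
  have pc: "chom X A p" and qc: "chom X K q" unfolding X_def p_def q_def by (rule fst_ten_chom snd_ten_chom; simp)+
  note [simp] = chomD(1-3)[OF pc] chomD(1-3)[OF qc]
  have pq: "pr X p q = idn (?a \<boxtimes> ?k)" unfolding X_def p_def q_def by (rule pr_fst_snd) simp_all
  \<comment> \<open>\<open>g\<close> is \<open>(a, k) \<mapsto> a k\<close> and \<open>p\<close> is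
    \<open>(a, k) \<mapsto> a\<close>; \<open>\<pi>\<close> identifies them because it is trivial on
    \<open>K\<close>.\<close>
  define g where "g = mul A \<cdot> (idn ?a \<odot> j)"
  have gcv: "g = cv A X p (j \<cdot> q)"
  proof -
    have "g = (mul A \<cdot> (idn ?a \<odot> j)) \<cdot> pr X p q" unfolding pq g_def by simp
    then show ?thesis by (simp add: cv_def)
  qed
  have jq: "chom X A (j \<cdot> q)" by (rule chom_comp[OF qc jD(1)]) simp_all
  have gc: "chom X A g" unfolding gcv by (rule cv_chom[OF hA(1) cX pc jq hA(2)])
  note [simp] = chomD(1-3)[OF gc]
  have p_run: "p = run ?a \<cdot> (idn ?a \<odot> counit K)" by (simp add: p_def fst_ten_def)
  have "\<pi> \<cdot> j \<cdot> q = (\<pi> \<cdot> j) \<cdot> q" by simp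
  also have "\<dots> = unit Q \<cdot> counit X" unfolding \<pi>j by (simp add: chomD(5)[OF qc])
  finally have \<pi>jq: "\<pi> \<cdot> j \<cdot> q = unit Q \<cdot> counit X" .
  have "\<pi> \<cdot> g = cv Q X (\<pi> \<cdot> p) (\<pi> \<cdot> j \<cdot> q)" unfolding gcv by (rule hopf_hom_cv) (simp_all add: \<pi>(1))
  also have "\<dots> = \<pi> \<cdot> p" unfolding \<pi>jq by (rule cv_unit_right) simp_all
  finally have \<pi>g: "\<pi> \<cdot> g = \<pi> \<cdot> p" .
  obtain n where n: "is_kernel M n \<pi>" using ex_kernel[of \<pi>] by auto
  note nm = kernel_mono[OF n] and n\<pi> = epi_cokernel_of_kernel[OF \<pi>(2) n]
  let ?n = "Dom M n"
  have [simp]: "n \<in> Arr M" "Cod M n = ?a" using kernelD(2,3)[OF n] by simp_all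
  have "\<pi> \<cdot> dif g p = Zer M (?a \<boxtimes> ?k) ?q"
    using dif_zero_iff[of "\<pi> \<cdot> p" "\<pi> \<cdot> p"] by (simp add: cmp_dif \<pi>g)
  then obtain d where d [simp]: "d \<in> Arr M" "Dom M d = ?a \<boxtimes> ?k" "Cod M d = ?n" and nd: "n \<cdot> d = dif g p"
    using kernel_factor[OF n, of "dif g p"] by auto

  define Qm where "Qm = quot_module_comonoid Q \<pi>"
  have Qs [simp]: "cob Qm = ?q" "comul Qm = comul Q" "counit Qm = counit Q" by (simp_all add: Qm_def quot_module_comonoid_sel)
  have cQm: "coc Qm" using hQ(2) unfolding coc_def comonoid_def cocommutative_def Qs .
  note [simp] = coc_comonoid[OF cQm]
  have toQ: "chom Z Qm h \<longleftrightarrow> chom Z Q h" for Z :: "('o, 'm) comon" and h unfolding comonoid_hom_def Qs ..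
  have \<pi>Qm: "chom A Qm \<pi>" using \<pi>D(1) unfolding comonoid_hom_def Qs .
  have \<pi>pc: "chom X Qm (\<pi> \<cdot> p)" unfolding toQ by (rule chom_comp[OF pc \<pi>D(1)]) simp_all
  \<comment> \<open>\<open>A \<otimes> K\<close> coacts through its first factor,
    \<open>(a, k) \<mapsto> (a, k, \<pi> a)\<close>. Then \<open>p\<close> is a comodule morphism by
    construction and \<open>g\<close> is one because
    \<open>\<pi> \<cdot> g = \<pi> \<cdot> p\<close>; hence so is their difference.\<close>
  define VX where "VX = \<lparr>cmob = cob X, coact = pr X (idn (cob X)) (\<pi> \<cdot> p)\<rparr>"
  define VA where "VA = right_coreg M A \<pi>"
  define W where "W = left_coreg M A \<pi>"
  have VX [simp]: "cmob VX = ?a \<boxtimes> ?k" "coact VX = pr X (idn (?a \<boxtimes> ?k)) (\<pi> \<cdot> p)" by (simp_all add: VX_def)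
  have VA [simp]: "cmob VA = ?a" "coact VA = pr A (idn ?a) \<pi>" by (simp_all add: VA_def right_coreg_def pr_def)
  have W [simp]: "cmob W = ?a" "coact W = pr A \<pi> (idn ?a)" by (simp_all add: W_def left_coreg_def pr_def)
  have VAe: "VA = \<lparr>cmob = ?a, coact = pr A (idn ?a) \<pi>\<rparr>" by (simp add: VA_def right_coreg_def pr_def)
  have cVX: "right_comodule M Qm VX" unfolding VX_def by (rule right_comodule_of_chom[OF _ _ \<pi>pc]) simp_all
  have cVA: "right_comodule M Qm VA" unfolding VAe by (rule right_comodule_of_chom[OF _ _ \<pi>Qm]) simp_all
  \<comment> \<open>The coaction of \<open>A\<close> restricts to \<open>N\<close>: composed with
    \<open>\<pi> \<odot> idn ?q\<close> it is \<open>comul Q \<cdot> \<pi>\<close>, which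
    annihilates \<open>n\<close>, and by exactness \<open>n \<odot> idn ?q\<close> is the
    kernel.\<close>
  have "(\<pi> \<odot> idn ?q) \<cdot> pr A (idn ?a) \<pi> \<cdot> n = pr A \<pi> \<pi> \<cdot> n" by simp
  also have "\<dots> = (comul Q \<cdot> \<pi>) \<cdot> n" unfolding comul_cmp[OF \<pi>D(1)] ..
  also have "\<dots> = comul Q \<cdot> (\<pi> \<cdot> n)" by simp
  also have "\<dots> = Zer M ?n (?q \<boxtimes> ?q)" unfolding kernel_zero[OF n] by simp
  finally obtain \<rho> where \<rho>: "\<rho> \<in> Arr M" "Dom M \<rho> = ?n" "Cod M \<rho> = ?n \<boxtimes> ?q" "(n \<odot> idn ?q) \<cdot> \<rho> = pr A (idn ?a) \<pi> \<cdot> n"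
    using kernel_factor[OF ten_id_kernel(2)[OF n, of ?q], of "pr A (idn ?a) \<pi> \<cdot> n"] by auto
  note [simp] = \<rho>(1-3)
  define VN where "VN = \<lparr>cmob = ?n, coact = \<rho>\<rparr>"
  have VN [simp]: "cmob VN = ?n" "coact VN = \<rho>" by (simp_all add: VN_def)
  have cVN: "right_comodule M Qm VN" unfolding VN_def
    by (rule subcomodule[OF cVA]) (simp_all add: nm \<rho>(4))
  have nhom: "right_comodule_hom M Qm VN VA n" unfolding right_comodule_hom_def by (simp add: \<rho>(4))
  have dhom: "right_comodule_hom M Qm VX VN d"
  proof -
    have "(n \<odot> idn ?q) \<cdot> \<rho> \<cdot> d = ((n \<odot> idn ?q) \<cdot> \<rho>) \<cdot> d" by simp
    also have "\<dots> = pr A (idn ?a) \<pi> \<cdot> (n \<cdot> d)" unfolding \<rho>(4) by simp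
    also have "\<dots> = dif (pr A (idn ?a) \<pi> \<cdot> g) (pr A (idn ?a) \<pi> \<cdot> p)" unfolding nd by (rule cmp_dif) simp_all
    also have "\<dots> = dif (pr X g (\<pi> \<cdot> p)) (pr X p (\<pi> \<cdot> p))" by (simp add: pr_cmp[OF gc] pr_cmp[OF pc] \<pi>g)
    also have "\<dots> = dif ((g \<odot> idn ?q) \<cdot> coact VX) ((p \<odot> idn ?q) \<cdot> coact VX)" by simp
    also have "\<dots> = dif (g \<odot> idn ?q) (p \<odot> idn ?q) \<cdot> coact VX" by (rule dif_cmp[symmetric]) simp_all
    also have "\<dots> = ((n \<cdot> d) \<odot> idn ?q) \<cdot> coact VX" unfolding nd by (subst ten_id_dif) simp_all
    also have "\<dots> = (n \<odot> idn ?q) \<cdot> (d \<odot> idn ?q) \<cdot> coact VX" by simp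
    finally have e: "(n \<odot> idn ?q) \<cdot> \<rho> \<cdot> d = (n \<odot> idn ?q) \<cdot> (d \<odot> idn ?q) \<cdot> coact VX" .
    have "\<rho> \<cdot> d = (d \<odot> idn ?q) \<cdot> coact VX"
      by (rule mono_cancel[OF ten_id_mono(2)[OF nm comonoid_ops(1)[OF coc_comonoid[OF hQ(2)]]] e]) simp_all
    then show ?thesis unfolding right_comodule_hom_def by simp
  qed

  define F where "F = cotensor_functor M ?q W"
  define eX where "eX = cotensor M ?q VX W"
  define eN where "eN = cotensor M ?q VN W"
  define r where "r = cotensor M ?q VA W"
  have r: "is_cotensor M ?q VA W r" unfolding r_def by (rule cotensor_ex) simp_all
  have eX: "is_cotensor M ?q VX W eX" unfolding eX_def by (rule cotensor_ex) simp_all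
  have eN: "is_cotensor M ?q VN W eN" unfolding eN_def by (rule cotensor_ex) simp_all
  note rD = cotensorD[OF r, simplified] and eXD = cotensorD[OF eX, simplified] and eND = cotensorD[OF eN, simplified]
  note [simp] = rD(1,2) eXD(1,2) eND(1,2)
  have F: "F (VX, d, VN) \<in> Arr M" "Dom M (F (VX, d, VN)) = Dom M eX" "Cod M (F (VX, d, VN)) = Dom M eN"
      "eN \<cdot> F (VX, d, VN) = (d \<odot> idn ?a) \<cdot> eX"
    using cotensor_map[OF cVX cVN dhom, of W] unfolding F_def eX_def eN_def by simp_all
  have N: "F (VN, n, VA) \<in> Arr M" "Dom M (F (VN, n, VA)) = Dom M eN" "Cod M (F (VN, n, VA)) = Dom M r"
      "r \<cdot> F (VN, n, VA) = (n \<odot> idn ?a) \<cdot> eN"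
    using cotensor_map[OF cVN cVA nhom, of W] unfolding F_def r_def eN_def by simp_all
  define n' where "n' = F (VN, n, VA)"
  note [simp] = F(1-3) N(1-3)[folded n'_def]
  note rn' = N(4)[folded n'_def]

  define Y where "Y = tc A A"
  define a where "a = fst_ten A A"
  define b where "b = snd_ten A A"
  have cY [simp]: "coc Y" and [simp]: "cob Y = ?a \<boxtimes> ?a" by (simp_all add: Y_def)
  note [simp] = coc_comonoid[OF cY]
  have ac: "chom Y A a" and bc: "chom Y A b" unfolding Y_def a_def b_def by (rule fst_ten_chom snd_ten_chom; simp)+
  note [simp] = chomD(1-3)[OF ac] chomD(1-3)[OF bc]
  have ab: "pr Y a b = idn (?a \<boxtimes> ?a)" unfolding Y_def a_def b_def by (rule pr_fst_snd) simp_all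
  have uc: "chom Y Q (\<pi> \<cdot> a)" and vc: "chom Y Q (\<pi> \<cdot> b)" by (rule chom_comp[OF ac \<pi>D(1)] chom_comp[OF bc \<pi>D(1)]; simp)+
  \<comment> \<open>The permutation \<open>((a, b), z) \<mapsto> (a, (z, b))\<close>. It relates the
    pair defining the cotensor product to two graphs over \<open>(a, b)\<close>, so that
    \<open>comonoid_equalizer\<close> makes \<open>A \<box>\<^sub>Q A\<close> a comonoid.\<close>
  let ?phi = "(idn ?a \<odot> swp ?a ?q) \<cdot> asc ?a ?a ?q"
  note f12 = coreg_pr[OF hA(2) coc_comonoid[OF hQ(2)] \<pi>D(1), folded Y_def a_def b_def]
  have "?phi \<cdot> pr Y (pr Y a b) (\<pi> \<cdot> a) = pr Y a (pr Y (\<pi> \<cdot> a) b)" "?phi \<cdot> pr Y (pr Y a b) (\<pi> \<cdot> b) = pr Y a (pr Y (\<pi> \<cdot> b) b)"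
    by simp_all
  then have f1: "?phi \<cdot> pr Y (idn (?a \<boxtimes> ?a)) (\<pi> \<cdot> a) = asc ?a ?q ?a \<cdot> (pr A (idn ?a) \<pi> \<odot> idn ?a)"
    and f2: "?phi \<cdot> pr Y (idn (?a \<boxtimes> ?a)) (\<pi> \<cdot> b) = idn ?a \<odot> pr A \<pi> (idn ?a)"
    unfolding f12 ab .
  have req: "is_equalizer M r (pr Y (idn (cob Y)) (\<pi> \<cdot> a)) (pr Y (idn (cob Y)) (\<pi> \<cdot> b))"
  proof (rule equalizer_cmp_mono)
    show "is_mono M ?phi" by (rule iso_mono) simp
    show "is_equalizer M r (?phi \<cdot> pr Y (idn (cob Y)) (\<pi> \<cdot> a)) (?phi \<cdot> pr Y (idn (cob Y)) (\<pi> \<cdot> b))"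
      using r f1 f2 unfolding is_cotensor_def by simp
  qed simp_all
  obtain R :: "('o, 'm) comon" where cR [simp]: "coc R" and Rr: "cob R = Dom M r" and rc: "chom R Y r" and uv: "(\<pi> \<cdot> a) \<cdot> r = (\<pi> \<cdot> b) \<cdot> r"
    using comonoid_equalizer[OF cY hQ(2) uc vc req] by (elim exE conjE)
  note [simp] = coc_comonoid[OF cR]
  have [simp]: "Dom M r = cob R" using Rr by simp
  \<comment> \<open>\<open>\<alpha>\<close> and \<open>\<beta>\<close> are the generic pair of
    elements of \<open>A\<close> with the same image in \<open>Q\<close>.\<close>
  define \<alpha> where "\<alpha> = a \<cdot> r"
  define \<beta> where "\<beta> = b \<cdot> r"
  have \<alpha>c: "chom R A \<alpha>" and \<beta>c: "chom R A \<beta>" unfolding \<alpha>_def \<beta>_def by (rule chom_comp[OF rc ac] chom_comp[OF rc bc]; simp)+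
  note [simp] = chomD(1-3)[OF \<alpha>c] chomD(1-3)[OF \<beta>c]
  have \<pi>\<alpha>: "\<pi> \<cdot> \<alpha> = \<pi> \<cdot> \<beta>" using uv by (simp add: \<alpha>_def \<beta>_def)
  have "r = pr Y a b \<cdot> r" unfolding ab by simp
  then have r\<alpha>\<beta>: "r = pr R \<alpha> \<beta>" by (simp add: pr_cmp[OF rc] \<alpha>_def \<beta>_def)
  \<comment> \<open>The element \<open>\<beta>\<inverse> \<alpha>\<close>. It is sent to the unit by
    \<open>\<pi>\<close>, hence by \<open>i \<cdot> \<pi>\<close>, and so it comes from
    \<open>K\<close>.\<close>
  define w where "w = cv A R (antipode A \<cdot> \<beta>) \<alpha>"
  have S\<beta>: "chom R A (antipode A \<cdot> \<beta>)" by (rule chom_comp[OF \<beta>c antipode_chom]) simp_all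
  have wc: "chom R A w" unfolding w_def by (rule cv_chom[OF hA(1) cR S\<beta> \<alpha>c hA(2)])
  note [simp] = chomD(1-3)[OF wc]
  have "\<pi> \<cdot> w = cv Q R (\<pi> \<cdot> antipode A \<cdot> \<beta>) (\<pi> \<cdot> \<alpha>)" unfolding w_def by (rule hopf_hom_cv) (simp_all add: \<pi>(1))
  also have "\<dots> = \<pi> \<cdot> cv A R (antipode A \<cdot> \<beta>) \<beta>" unfolding \<pi>\<alpha> by (rule hopf_hom_cv[symmetric]) (simp_all add: \<pi>(1))
  also have "\<dots> = \<pi> \<cdot> unit A \<cdot> counit R" by (subst cv_antipode(1)[OF hA(1) _ \<beta>c]) simp_all
  also have "\<dots> = unit Q \<cdot> counit R" by (rule hopf_hom_unit_counit) (simp_all add: \<pi>(1))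
  finally have "i \<cdot> \<pi> \<cdot> w = i \<cdot> unit Q \<cdot> counit R" by simp
  also have "\<dots> = unit B \<cdot> counit R" by (rule hopf_hom_unit_counit) (simp_all add: i(1))
  finally have "(i \<cdot> \<pi>) \<cdot> w = unit B \<cdot> counit R" by simp
  then obtain w' where w'c: "chom R K w'" and jw': "j \<cdot> w' = w" using univ cR wc by blast
  note [simp] = chomD(1-3)[OF w'c]
  \<comment> \<open>\<open>(\<beta>, \<beta>\<inverse> \<alpha>)\<close> as an element of
    \<open>A \<otimes> K\<close>; \<open>p\<close> sends it to \<open>\<beta>\<close> and
    \<open>g\<close> sends it to \<open>\<alpha>\<close>.\<close>
  define y where "y = pr R \<beta> w'"
  have yc: "chom R X y" unfolding y_def X_def by (rule pr_chom[OF cR _ _ \<beta>c w'c]) simp_all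
  note [simp] = chomD(1-3)[OF yc, simplified]
  have py: "p \<cdot> y = \<beta>" unfolding p_def y_def by (rule fst_ten_pr) (simp_all add: chomD(5)[OF w'c])
  have qy: "q \<cdot> y = w'" unfolding q_def y_def by (rule snd_ten_pr) (simp_all add: chomD(5)[OF \<beta>c])
  have "g \<cdot> y = cv A R (p \<cdot> y) ((j \<cdot> q) \<cdot> y)" unfolding gcv cv_def by (simp add: pr_cmp[OF yc])
  also have "\<dots> = cv A R \<beta> w" by (simp add: py qy jw')
  also have "\<dots> = cv A R (cv A R \<beta> (antipode A \<cdot> \<beta>)) \<alpha>" unfolding w_def by (rule cv_assoc[symmetric]) simp_all
  also have "\<dots> = \<alpha>" by (subst cv_antipode(2)[OF hA(1) _ \<beta>c]) (simp_all add: cv_unit_left)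
  finally have gy: "g \<cdot> y = \<alpha>" .
  \<comment> \<open>The pair of \<open>y\<close> and \<open>\<beta>\<close> lies in the cotensor
    product: both coactions insert the same middle component \<open>\<pi> \<cdot> \<beta>\<close>,
    since \<open>p \<cdot> y = \<beta>\<close>.\<close>
  define s where "s = pr R y \<beta>"
  have sD [simp]: "s \<in> Arr M" "Dom M s = cob R" "Cod M s = (?a \<boxtimes> ?k) \<boxtimes> ?a" by (simp_all add: s_def)
  have "asc (?a \<boxtimes> ?k) ?q ?a \<cdot> (pr X (idn (?a \<boxtimes> ?k)) (\<pi> \<cdot> p) \<odot> idn ?a) \<cdot> s = pr R y (pr R (\<pi> \<cdot> \<beta>) \<beta>)"
    by (simp add: s_def pr_cmp[OF yc] py)
  also have "\<dots> = (idn (?a \<boxtimes> ?k) \<odot> pr A \<pi> (idn ?a)) \<cdot> s" by (simp add: s_def pr_cmp[OF \<beta>c])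
  finally obtain s' where s' [simp]: "s' \<in> Arr M" "Dom M s' = cob R" "Cod M s' = Dom M eX" and eXs': "eX \<cdot> s' = s"
    using eXD(5)[of s] by auto
  have gs: "(g \<odot> idn ?a) \<cdot> s = r" unfolding r\<alpha>\<beta> by (simp add: s_def gy)
  have ps: "(p \<odot> idn ?a) \<cdot> s = comul A \<cdot> \<beta>" by (simp add: s_def py comul_cmp[OF \<beta>c])
  let ?h = "F (VX, d, VN)" and ?m = "(n \<odot> idn ?a) \<cdot> eN"
  \<comment> \<open>\<open>\<beta>\<close> applies the counit to the first component of
    \<open>r\<close>. This counit factors through \<open>\<pi>\<close>, and \<open>\<pi>\<close>
    annihilates \<open>n\<close>, so the term \<open>(\<beta>, \<beta>)\<close> disappears.\<close>
  have "\<beta> \<cdot> n' = b \<cdot> (r \<cdot> n')" by (simp add: \<beta>_def)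
  also have "\<dots> = lun ?a \<cdot> (counit A \<odot> idn ?a) \<cdot> (n \<odot> idn ?a) \<cdot> eN" unfolding rn' by (simp add: b_def snd_ten_def)
  also have "counit A = counit Q \<cdot> \<pi>" by (simp add: \<pi>D(6))
  also have "lun ?a \<cdot> ((counit Q \<cdot> \<pi>) \<odot> idn ?a) \<cdot> (n \<odot> idn ?a) \<cdot> eN = lun ?a \<cdot> (counit Q \<odot> idn ?a) \<cdot> ((\<pi> \<odot> idn ?a) \<cdot> (n \<odot> idn ?a)) \<cdot> eN" by simp
  also have "(\<pi> \<odot> idn ?a) \<cdot> (n \<odot> idn ?a) = Zer M (?n \<boxtimes> ?a) (?q \<boxtimes> ?a)"
    using kernel_zero[OF ten_id_kernel(2)[OF n, of ?a]] by simp
  finally have \<beta>n': "\<beta> \<cdot> n' = Zer M (Dom M eN) ?a" by simp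
  \<comment> \<open>The section \<open>s' \<cdot> n'\<close> is verified after the mono
    \<open>?m\<close> from \<open>N \<box>\<^sub>Q A\<close> into \<open>A \<otimes> A\<close>,
    where \<open>n \<cdot> d\<close> can be replaced by the difference of \<open>g\<close> and
    \<open>p\<close>.\<close>
  have "?m \<cdot> ?h \<cdot> s' \<cdot> n' = (n \<odot> idn ?a) \<cdot> (eN \<cdot> ?h) \<cdot> s' \<cdot> n'" by simp
  also have "\<dots> = ((n \<cdot> d) \<odot> idn ?a) \<cdot> (eX \<cdot> s') \<cdot> n'" unfolding F(4) by simp
  also have "\<dots> = dif (g \<odot> idn ?a) (p \<odot> idn ?a) \<cdot> s \<cdot> n'" unfolding nd eXs' by (subst ten_id_dif) simp_all
  also have "\<dots> = dif ((g \<odot> idn ?a) \<cdot> s \<cdot> n') ((p \<odot> idn ?a) \<cdot> s \<cdot> n')" by (rule dif_cmp) simp_all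
  also have "(g \<odot> idn ?a) \<cdot> s \<cdot> n' = r \<cdot> n'" by (rule cmp_ext[OF gs]) simp_all
  also have "(p \<odot> idn ?a) \<cdot> s \<cdot> n' = comul A \<cdot> (\<beta> \<cdot> n')" using cmp_ext[OF ps, of n'] by simp
  also have "dif (r \<cdot> n') (comul A \<cdot> (\<beta> \<cdot> n')) = ?m \<cdot> idn (Dom M eN)" unfolding \<beta>n' rn'
    by (simp add: dif_zer)
  finally have mh: "?m \<cdot> ?h \<cdot> s' \<cdot> n' = ?m \<cdot> idn (Dom M eN)" .
  have mm: "is_mono M ?m" by (rule mono_comp[OF eND(3) ten_id_mono(2)[OF nm]]) simp_all
  have "?h \<cdot> s' \<cdot> n' = idn (Dom M eN)" by (rule mono_cancel[OF mm mh]) simp_all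
  then have "is_epi M ?h" by (intro split_epi[of ?h "s' \<cdot> n'"]) simp_all
  moreover have "reflects_epis (RComod M Qm) M F"
  proof -
    have "(reg_module_comonoid A, \<pi>, Qm) \<in> Arr (ComonCocMod M A)"
      unfolding Qm_def by (rule quot_module_comonoid_arr[OF A Q \<pi>(1)])
    moreover have "A \<in> Ob H" using A by simp
    ultimately have "reflects_epis (RComod M Qm) M (cotensor_functor M (cob Qm) (left_coreg M A \<pi>))"
      using FC \<pi>(2) unfolding faithfully_coflat_def by blast
    then show ?thesis by (simp add: F_def W_def)
  qed
  moreover have "(VX, d, VN) \<in> Arr (RComod M Qm)" unfolding RComod_arr using cVX cVN dhom by blast
  \<comment> \<open>Reflection yields an epi among comodules; \<open>comodule_epi_is_epi\<close>
    transfers it to \<open>M\<close>.\<close>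
  ultimately have "is_epi (RComod M Qm) (VX, d, VN)" unfolding reflects_epis_def by blast
  then have de: "is_epi M d" by (rule comodule_epi_is_epi[rotated]) simp
  have "is_coequalizer M \<pi> g p"
  proof (rule coequalizerI)
    fix x assume x: "x \<in> Arr M" "Dom M x = Cod M g" "x \<cdot> g = x \<cdot> p"
    note [simp] = x(1) x(2)[simplified]
    have "(x \<cdot> n) \<cdot> d = x \<cdot> (n \<cdot> d)" by simp
    also have "\<dots> = Zer M ?n (Cod M x) \<cdot> d" unfolding nd using dif_zero_iff[of "x \<cdot> p" "x \<cdot> p"] by (simp add: cmp_dif x(3))
    finally have "x \<cdot> n = Zer M ?n (Cod M x)" using epi_cancel[OF de, of "x \<cdot> n" "Zer M ?n (Cod M x)"] by simp
    then show "\<exists>!y. y \<in> Hom M (Cod M \<pi>) (Cod M x) \<and> y \<cdot> \<pi> = x"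
      by (intro cokernel_ex1[OF n\<pi>]) simp_all
  qed (simp_all add: \<pi>g)
  then show "is_coequalizer M \<pi> (mul A \<cdot> (idn (cob A) \<odot> j)) (run (cob A) \<cdot> (idn (cob A) \<odot> counit K))"
    unfolding g_def p_run .
qed

section \<open>Consequences of the coequalizer property\<close>

lemma cotensor_coequalizer:
  assumes A: "hopf_coc A" and Q: "hopf_coc Q" and K: "hopf_coc K"
    and \<pi>: "hopf_hom M A Q \<pi>" "is_epi M \<pi>" and j: "hopf_hom M K A j" and \<pi>j: "\<pi> \<cdot> j = unit Q \<cdot> counit K"
    and co: "is_coequalizer M \<pi> (mul A \<cdot> (idn (cob A) \<odot> j)) (run (cob A) \<cdot> (idn (cob A) \<odot> counit K))"
    and e: "is_cotensor M (cob Q) (right_coreg M A \<pi>) (left_coreg M A \<pi>) e"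
  shows "is_coequalizer M \<pi> (lun (cob A) \<cdot> (counit A \<odot> idn (cob A)) \<cdot> e) (run (cob A) \<cdot> (idn (cob A) \<odot> counit A) \<cdot> e)"
proof -
  note hA = hopf_cocD[OF A] and hQ = hopf_cocD[OF Q] and hK = hopf_cocD[OF K]
  note \<pi>D = hopf_homD[OF \<pi>(1)] and jD = hopf_homD[OF j(1)]
  note [simp] = hA hQ hK \<pi>D(2-4) jD(2-4)
  let ?a = "cob A" and ?q = "cob Q" and ?k = "cob K"
  define X where "X = tc A K"
  define p where "p = fst_ten A K"
  define q where "q = snd_ten A K"
  have cX [simp]: "coc X" and [simp]: "cob X = ?a \<boxtimes> ?k" by (simp_all add: X_def)
  note [simp] = coc_comonoid[OF cX]
  have pc: "chom X A p" and qc: "chom X K q" unfolding X_def p_def q_def by (rule fst_ten_chom snd_ten_chom; simp)+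
  note [simp] = chomD(1-3)[OF pc] chomD(1-3)[OF qc]
  define g where "g = mul A \<cdot> (idn ?a \<odot> j)"
  have gp: "is_coequalizer M \<pi> g p" using co unfolding g_def p_def fst_ten_def .
  have "chom (tc A K) A (mul A \<cdot> (idn ?a \<odot> j))"
    by (rule chom_comp[OF ten_chom[OF chom_id jD(1)] mul_chom]) simp_all
  then have gc: "chom X A g" by (simp only: X_def g_def)
  note [simp] = chomD(1-3)[OF gc]
  note \<pi>g = coequalizerD(7)[OF gp]
  define Y where "Y = tc A A"
  define a where "a = fst_ten A A"
  define b where "b = snd_ten A A"
  have cY [simp]: "coc Y" and [simp]: "cob Y = ?a \<boxtimes> ?a" by (simp_all add: Y_def)
  note [simp] = coc_comonoid[OF cY]
  have ac: "chom Y A a" and bc: "chom Y A b" unfolding Y_def a_def b_def by (rule fst_ten_chom snd_ten_chom; simp)+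
  note [simp] = chomD(1-3)[OF ac] chomD(1-3)[OF bc]
  have ab: "pr Y a b = idn (?a \<boxtimes> ?a)" unfolding Y_def a_def b_def by (rule pr_fst_snd) simp_all
  have cr: "cmob (right_coreg M A \<pi>) = ?a" "coact (right_coreg M A \<pi>) = pr A (idn ?a) \<pi>"
    "cmob (left_coreg M A \<pi>) = ?a" "coact (left_coreg M A \<pi>) = pr A \<pi> (idn ?a)"
    by (simp_all add: right_coreg_def left_coreg_def pr_def)
  note eD = cotensorD[OF e, unfolded cr, simplified]
  note [simp] = eD(1,2)
  note f12 = coreg_pr[OF hA(2) coc_comonoid[OF hQ(2)] \<pi>D(1), folded Y_def a_def b_def]
  have "(asc ?a ?q ?a \<cdot> (pr A (idn ?a) \<pi> \<odot> idn ?a)) \<cdot> e = (idn ?a \<odot> pr A \<pi> (idn ?a)) \<cdot> e" using eD(4) by simp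
  then have fe: "pr Y a (pr Y (\<pi> \<cdot> a) b) \<cdot> e = pr Y a (pr Y (\<pi> \<cdot> b) b) \<cdot> e" unfolding f12 .
  \<comment> \<open>\<open>?\<psi>\<close> discards the outer components of a triple by counits, so
    that the equality of triples on \<open>e\<close> can be compared in the middle.\<close>
  let ?\<psi> = "lun ?q \<cdot> (counit A \<odot> (run ?q \<cdot> (idn ?q \<odot> counit A)))"
  have \<psi>: "?\<psi> \<cdot> pr Y a (pr Y h b) = h" if [simp]: "h \<in> Arr M" "Dom M h = ?a \<boxtimes> ?a" "Cod M h = ?q" for h
    by (simp add: chomD(5)[OF ac] chomD(5)[OF bc])
  have "(\<pi> \<cdot> a) \<cdot> e = (?\<psi> \<cdot> pr Y a (pr Y (\<pi> \<cdot> a) b)) \<cdot> e" by (subst \<psi>) simp_all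
  also have "\<dots> = ?\<psi> \<cdot> (pr Y a (pr Y (\<pi> \<cdot> a) b) \<cdot> e)" by simp
  also have "\<dots> = (?\<psi> \<cdot> pr Y a (pr Y (\<pi> \<cdot> b) b)) \<cdot> e" unfolding fe by simp
  also have "\<dots> = (\<pi> \<cdot> b) \<cdot> e" by (subst \<psi>) simp_all
  finally have \<pi>ab: "\<pi> \<cdot> a \<cdot> e = \<pi> \<cdot> b \<cdot> e" by simp
  \<comment> \<open>The pair of \<open>g\<close> and \<open>p\<close> satisfies the cotensor
    condition because \<open>\<pi> \<cdot> g = \<pi> \<cdot> p\<close>, so it factors as
    \<open>e \<cdot> z\<close>. An arrow that coequalizes the projections of
    \<open>A \<box>\<^sub>Q A\<close> therefore coequalizes \<open>g\<close> and \<open>p\<close>,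
    whose coequalizer is \<open>\<pi>\<close>.\<close>
  have "asc ?a ?q ?a \<cdot> (pr A (idn ?a) \<pi> \<odot> idn ?a) \<cdot> pr X g p = pr X g (pr X (\<pi> \<cdot> g) p)"
    by (simp add: pr_cmp[OF gc])
  also have "\<dots> = (idn ?a \<odot> pr A \<pi> (idn ?a)) \<cdot> pr X g p" unfolding \<pi>g by (simp add: pr_cmp[OF pc])
  finally obtain z where z: "z \<in> Arr M" "Dom M z = ?a \<boxtimes> ?k" "Cod M z = Dom M e" "e \<cdot> z = pr X g p"
    using eD(5)[of "pr X g p"] by auto
  note [simp] = z(1-3)
  have az: "a \<cdot> e \<cdot> z = g" unfolding z(4) a_def by (rule fst_ten_pr) (simp_all add: chomD(5)[OF pc])
  have bz: "b \<cdot> e \<cdot> z = p" unfolding z(4) b_def by (rule snd_ten_pr) (simp_all add: chomD(5)[OF gc])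
  have "is_coequalizer M \<pi> (b \<cdot> e) (a \<cdot> e)"
  proof (rule coequalizerI)
    fix x assume x: "x \<in> Arr M" "Dom M x = Cod M (b \<cdot> e)" "x \<cdot> b \<cdot> e = x \<cdot> a \<cdot> e"
    note [simp] = x(1) x(2)[simplified]
    have "x \<cdot> g = (x \<cdot> a \<cdot> e) \<cdot> z" unfolding az[symmetric] by simp
    also have "\<dots> = x \<cdot> b \<cdot> e \<cdot> z" unfolding x(3)[symmetric] by simp
    also have "\<dots> = x \<cdot> p" unfolding bz ..
    finally show "\<exists>!y. y \<in> Hom M (Cod M \<pi>) (Cod M x) \<and> y \<cdot> \<pi> = x"
      by (intro coequalizer_ex1[OF gp]) simp_all
  qed (simp_all add: \<pi>ab)
  moreover have "b \<cdot> e = lun ?a \<cdot> (counit A \<odot> idn ?a) \<cdot> e" "a \<cdot> e = run ?a \<cdot> (idn ?a \<odot> counit A) \<cdot> e"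
    by (simp_all add: a_def b_def fst_ten_def snd_ten_def)
  ultimately show ?thesis by simp
qed

text \<open>The theorem speaks of every kernel, while the coequalizer was obtained for a constructed
  one. Two kernels factor through each other, so either parallel pair is a precomposite of the other
  and both are coequalized by the same arrows.\<close>

lemma coequalizer_along_kernels:
  assumes A: "hopf_coc A" and K: "hopf_coc K" and K': "hopf_coc K'"
    and j: "hopf_hom M K A j" and j': "hopf_hom M K' A j'"
    and t: "hopf_hom M K' K t" "j \<cdot> t = j'" and t': "hopf_hom M K K' t'" "j' \<cdot> t' = j"
    and co: "is_coequalizer M c (mul A \<cdot> (idn (cob A) \<odot> j)) (run (cob A) \<cdot> (idn (cob A) \<odot> counit K))"
  shows "is_coequalizer M c (mul A \<cdot> (idn (cob A) \<odot> j')) (run (cob A) \<cdot> (idn (cob A) \<odot> counit K'))"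
proof -
  note hA = hopf_cocD[OF A] and hK = hopf_cocD[OF K] and hK' = hopf_cocD[OF K']
  note jD = hopf_homD[OF j] and j'D = hopf_homD[OF j'] and tD = hopf_homD[OF t(1)] and t'D = hopf_homD[OF t'(1)]
  note [simp] = hA hK hK' jD(2-4) j'D(2-4) tD(2-4) t'D(2-4)
  let ?a = "cob A"
  define g where "g = mul A \<cdot> (idn ?a \<odot> j)"
  define p where "p = run ?a \<cdot> (idn ?a \<odot> counit K)"
  define g' where "g' = mul A \<cdot> (idn ?a \<odot> j')"
  define p' where "p' = run ?a \<cdot> (idn ?a \<odot> counit K')"
  have [simp]: "g \<in> Arr M" "Dom M g = ?a \<boxtimes> cob K" "Cod M g = ?a" "p \<in> Arr M" "Dom M p = ?a \<boxtimes> cob K" "Cod M p = ?a"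
    "g' \<in> Arr M" "Dom M g' = ?a \<boxtimes> cob K'" "Cod M g' = ?a" "p' \<in> Arr M" "Dom M p' = ?a \<boxtimes> cob K'" "Cod M p' = ?a"
    by (simp_all add: g_def p_def g'_def p'_def)
  have 1: "g' = g \<cdot> (idn ?a \<odot> t)" "p' = p \<cdot> (idn ?a \<odot> t)" "g = g' \<cdot> (idn ?a \<odot> t')" "p = p' \<cdot> (idn ?a \<odot> t')"
    by (simp_all add: g_def p_def g'_def p'_def t(2) t'(2) tD(6) t'D(6))
  have co: "is_coequalizer M c g p" using co unfolding g_def p_def .
  note cD = coequalizerD[OF co]
  have [simp]: "c \<in> Arr M" "Dom M c = ?a" using cD(5,6) by simp_all
  have "is_coequalizer M c g' p'"
  proof (rule coequalizerI)
    have "(c \<cdot> g) \<cdot> (idn ?a \<odot> t) = (c \<cdot> p) \<cdot> (idn ?a \<odot> t)" by (simp only: cD(7))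
    then show "c \<cdot> g' = c \<cdot> p'" unfolding 1(1,2) by simp
    fix x assume x: "x \<in> Arr M" "Dom M x = Cod M g'" "x \<cdot> g' = x \<cdot> p'"
    then have "(x \<cdot> g') \<cdot> (idn ?a \<odot> t') = (x \<cdot> p') \<cdot> (idn ?a \<odot> t')" by (simp only:)
    then have "x \<cdot> (g' \<cdot> (idn ?a \<odot> t')) = x \<cdot> (p' \<cdot> (idn ?a \<odot> t'))" using x(1,2) by simp
    then have "x \<cdot> g = x \<cdot> p" unfolding 1(3,4)[symmetric] .
    then show "\<exists>!y. y \<in> Hom M (Cod M c) (Cod M x) \<and> y \<cdot> c = x"
      using x(1,2) by (intro coequalizer_ex1[OF co]) simp_all
  qed simp_all
  then show ?thesis unfolding g'_def p'_def .
qed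

text \<open>If \<open>w\<close> is trivial on \<open>K\<close>, then
  \<open>w(a k) = w(a) \<epsilon>(k)\<close>, so \<open>w\<close> factors through the coequalizer in
  \<open>M\<close>; the factor is a Hopf monoid morphism because \<open>\<pi>\<close> is epi in
  \<open>M\<close>.\<close>

lemma hopf_cokernel:
  assumes A: "hopf_coc A" and Q: "hopf_coc Q" and K: "hopf_coc K"
    and \<pi>: "hopf_hom M A Q \<pi>" "is_epi M \<pi>" and j: "hopf_hom M K A j" and \<pi>j: "\<pi> \<cdot> j = unit Q \<cdot> counit K"
    and co: "is_coequalizer M \<pi> (mul A \<cdot> (idn (cob A) \<odot> j)) (run (cob A) \<cdot> (idn (cob A) \<odot> counit K))"
  shows "is_cokernel H (A, \<pi>, Q) (K, j, A)"
  unfolding is_cokernel_def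
proof (intro conjI allI ballI impI)
  note hA = hopf_cocD[OF A] and hQ = hopf_cocD[OF Q] and hK = hopf_cocD[OF K]
  note \<pi>D = hopf_homD[OF \<pi>(1)] and jD = hopf_homD[OF j]
  note [simp] = hA hQ hK \<pi>D(2-4) jD(2-4)
  let ?a = "cob A"
  show "is_zero_arr H (Cmp H (A, \<pi>, Q) (K, j, A))" by (simp add: H_zero_iff K Q \<pi>j)
  fix Z x assume x: "x \<in> Hom H (Cod H (K, j, A)) Z" "is_zero_arr H (Cmp H x (K, j, A))"
  then obtain w where xw: "x = (A, w, Z)" and Z: "hopf_coc Z" and w: "hopf_hom M A Z w"
    by (cases x) (simp only: H_simps H_Hom_iff, blast)
  note hZ = hopf_cocD[OF Z] and wD = hopf_homD[OF w]
  note [simp] = hZ wD(2-4)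
  have wj: "w \<cdot> j = unit Z \<cdot> counit K" using x(2) by (simp add: xw H_zero_iff)
  have "w \<cdot> mul A \<cdot> (idn ?a \<odot> j) = (w \<cdot> mul A) \<cdot> (idn ?a \<odot> j)" by simp
  also have "\<dots> = mul Z \<cdot> (w \<odot> (w \<cdot> j))" unfolding wD(7) by simp
  also have "\<dots> = (mul Z \<cdot> (idn (cob Z) \<odot> unit Z)) \<cdot> (w \<odot> counit K)" unfolding wj by simp
  also have "\<dots> = (run (cob Z) \<cdot> (w \<odot> idn I)) \<cdot> (idn ?a \<odot> counit K)" unfolding mul_unit_right[OF hZ(1)] by simp
  also have "run (cob Z) \<cdot> (w \<odot> idn I) = w \<cdot> run ?a" by (subst run_nat') simp_all
  also have "(w \<cdot> run ?a) \<cdot> (idn ?a \<odot> counit K) = w \<cdot> run ?a \<cdot> (idn ?a \<odot> counit K)" by simp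
  finally obtain v where v: "v \<in> Arr M" "Dom M v = cob Q" "Cod M v = cob Z" "v \<cdot> \<pi> = w"
    using coequalizer_factor[OF co, of w] by auto
  have vh: "hopf_hom M Q Z v" by (rule epi_hopf_factor[OF \<pi>(2,1) w v hA(1) hQ(1) hZ(1)])
  show "\<exists>!y. y \<in> Hom H (Cod H (A, \<pi>, Q)) Z \<and> Cmp H y (A, \<pi>, Q) = x"
  proof (rule ex1I[of _ "(Q, v, Z)"])
    show "(Q, v, Z) \<in> Hom H (Cod H (A, \<pi>, Q)) Z \<and> Cmp H (Q, v, Z) (A, \<pi>, Q) = x"
      using Q Z vh v(4) by (simp add: xw)
    fix y assume y: "y \<in> Hom H (Cod H (A, \<pi>, Q)) Z \<and> Cmp H y (A, \<pi>, Q) = x"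
    then have "y \<in> Hom H Q Z" by simp
    then obtain u where yu: "y = (Q, u, Z)" and u: "hopf_hom M Q Z u" by (rule H_HomE)
    have "u \<cdot> \<pi> = v \<cdot> \<pi>" using y by (simp add: yu xw v(4))
    then show "y = (Q, v, Z)"
      using epi_cancel[OF \<pi>(2), of u v] hopf_homD(2-4)[OF u] v(1-3) by (simp add: yu)
  qed
qed (use A Q K \<pi>(1) j in simp_all)

text \<open>A cokernel of \<open>j\<close> is a coequalizer of \<open>j\<close> and the zero
  morphism. The same fact for \<open>M\<close> was proved in the additive setting, so here it is
  read off from the description of zero arrows.\<close>

lemma hopf_regular_epi:
  assumes c: "is_cokernel H (A, \<pi>, Q) (K, j, A)"
  shows "is_regular_epi H (A, \<pi>, Q)"
proof -
  have j: "(K, j, A) \<in> Arr H" and p: "(A, \<pi>, Q) \<in> Arr H" using H.cokernelD(1,2)[OF c] by simp_all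
  then have A: "hopf_coc A" and K: "hopf_coc K" and Q: "hopf_coc Q" and jh: "hopf_hom M K A j" and \<pi>: "hopf_hom M A Q \<pi>" by simp_all
  let ?z = "unit A \<cdot> counit K"
  have z: "hopf_hom M K A ?z" using trivial_hopf_hom[OF hopf_cocD(1)[OF K] hopf_cocD(1)[OF A]] .
  have zz: "w \<cdot> ?z = unit Z \<cdot> counit K" if "hopf_hom M A Z w" for Z w
    by (rule hopf_hom_unit_counit[OF hopf_cocD(1)[OF A] coc_comonoid[OF hopf_cocD(2)[OF K]] that])
  have "is_coequalizer H (A, \<pi>, Q) (K, j, A) (K, ?z, A)"
  proof (rule H.coequalizerI)
    have "is_zero_arr H (Cmp H (A, \<pi>, Q) (K, j, A))" by (rule H.cokernelD(4)[OF c])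
    then have "\<pi> \<cdot> j = unit Q \<cdot> counit K" by (simp add: H_zero_iff)
    then show "Cmp H (A, \<pi>, Q) (K, j, A) = Cmp H (A, \<pi>, Q) (K, ?z, A)" by (simp add: zz[OF \<pi>])
    fix x assume x: "x \<in> Arr H" "Dom H x = Cod H (K, j, A)" "Cmp H x (K, j, A) = Cmp H x (K, ?z, A)"
    obtain w Z where xw: "x = (A, w, Z)" using x(2) by (cases x) auto
    have Z: "hopf_coc Z" and w: "hopf_hom M A Z w" using x(1) by (simp_all add: xw)
    have "w \<cdot> j = unit Z \<cdot> counit K" using x(3) by (simp add: xw zz[OF w])
    then have "is_zero_arr H (Cmp H x (K, j, A))" by (simp add: xw H_zero_iff K Z)
    moreover have "x \<in> Hom H (Cod H (K, j, A)) (Cod H x)" using x(1,2) by simp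
    ultimately show "\<exists>!y. y \<in> Hom H (Cod H (A, \<pi>, Q)) (Cod H x) \<and> Cmp H y (A, \<pi>, Q) = x"
      by (intro c[unfolded is_cokernel_def, THEN conjunct2, THEN conjunct2, THEN conjunct2, rule_format])
  qed (use A K Q jh \<pi> z in simp_all)
  then show ?thesis unfolding is_regular_epi_def by blast
qed

lemma hopf_mono: assumes i: "(Q, i, B) \<in> Arr H" "is_mono M i" shows "is_mono H (Q, i, B)"
proof (rule H.monoI)
  fix g h assume g: "g \<in> Arr H" "Cod H g = Dom H (Q, i, B)" and h: "h \<in> Arr H" "Cod H h = Dom H (Q, i, B)"
    and d: "Dom H g = Dom H h" and e: "Cmp H (Q, i, B) g = Cmp H (Q, i, B) h"
  obtain X u where gu: "g = (X, u, Q)" using g(2) by (cases g) auto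
  obtain v where hv: "h = (X, v, Q)" using h(2) d gu by (cases h) auto
  have u: "hopf_hom M X Q u" and v: "hopf_hom M X Q v" and ih: "hopf_hom M Q B i" using g(1) h(1) i(1) by (simp_all add: gu hv)
  have "i \<cdot> u = i \<cdot> v" using e by (simp add: gu hv)
  then show "g = h" using mono_cancel[OF i(2), of u v] hopf_homD(2-4)[OF u] hopf_homD(2-4)[OF v] hopf_homD(2-4)[OF ih] by (simp add: gu hv)
qed (rule i(1))

lemma same_quotient_und: assumes "same_quotient H p q" shows "same_quotient M (und p) (und q)"
proof -
  obtain t where t: "t \<in> Hom H (Cod H p) (Cod H q)" "is_iso H t" "Cmp H t p = q" and pq: "p \<in> Arr H" "q \<in> Arr H" "Dom H p = Dom H q"
    using assms unfolding same_quotient_def by blast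
  obtain A p' P where p: "p = (A, p', P)" by (cases p)
  obtain q' Q where q: "q = (A, q', Q)" using pq(3) by (cases q) (simp add: p)
  have P: "hopf_coc P" and Q: "hopf_coc Q" and ph: "hopf_hom M A P p'" and qh: "hopf_hom M A Q q'" using pq(1,2) by (simp_all add: p q)
  have tpq: "t \<in> Hom H P Q" using t(1) by (simp add: p q)
  obtain t' where t': "t = (P, t', Q)" and th: "hopf_hom M P Q t'" using tpq by (rule H_HomE)
  obtain s where s: "are_inverse H t s" using t(2) unfolding is_iso_def by blast
  then have "s \<in> Hom H Q P" unfolding are_inverse_def by (simp add: t')
  then obtain s' where s': "s = (Q, s', P)" and sh: "hopf_hom M Q P s'" by (rule H_HomE)
  note hD = hopf_homD(2-4)[OF th] hopf_homD(2-4)[OF sh] hopf_homD(2-4)[OF ph] hopf_homD(2-4)[OF qh]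
  have "s' \<cdot> t' = idn (cob P)" "t' \<cdot> s' = idn (cob Q)" using s unfolding are_inverse_def by (simp_all add: t' s')
  then have "are_inverse M t' s'" using hD by (simp add: are_inverse_def)
  then have "is_iso M t'" by (rule are_inverse_isoI)
  moreover have "t' \<cdot> p' = q'" using t(3) by (simp add: t' p q)
  ultimately show ?thesis unfolding same_quotient_def using hD by (auto simp: und_def p q)
qed

section \<open>Assembly for arbitrary choices of kernels and cokernels\<close>

lemma hopf_factorization:
  assumes FC: "faithfully_coflat M" and f: "(A, f, B) \<in> Arr H" and k: "is_kernel M k f" and \<pi>: "is_cokernel M \<pi> k"
  shows
    "(\<forall>e. is_cotensor M (Cod M \<pi>) (right_coreg M A \<pi>) (left_coreg M A \<pi>) e \<longrightarrow>
        is_coequalizer M \<pi>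
          (LUn M (cob A) \<cdot> (counit A \<odot> Idn M (cob A)) \<cdot> e)
          (RUn M (cob A) \<cdot> (Idn M (cob A) \<odot> counit A) \<cdot> e))
     \<and>
     (\<exists>j. is_kernel H j (A, f, B))
     \<and>
     (\<exists>!Q. cob Q = Cod M \<pi> \<and> (A, \<pi>, Q) \<in> Arr H)
     \<and>
     (\<forall>j Q. is_kernel H j (A, f, B) \<and>
        cob Q = Cod M \<pi> \<and> (A, \<pi>, Q) \<in> Arr H \<longrightarrow>
        (\<exists>p. is_cokernel H p j) \<and>
        (\<forall>p. is_cokernel H p j \<longrightarrow> same_quotient H p (A, \<pi>, Q)) \<and>
        (\<forall>p c. is_cokernel H p j \<and> is_phi M j c \<longrightarrow>
           same_quotient M c (und p) \<and> same_quotient M c \<pi>))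
     \<and>
     (\<exists>p i. is_regular_epi H p \<and> (\<exists>g. is_cokernel H p g) \<and>
        is_mono H i \<and> Dom H i = Cod H p \<and> Cmp H i p = (A, f, B))"
proof -
  have A: "hopf_coc A" and B: "hopf_coc B" and fh: "hopf_hom M A B f" using f by simp_all
  note e\<pi> = cokernel_epi[OF \<pi>]
  obtain Q i where Q: "hopf_coc Q" "cob Q = Cod M \<pi>" and \<pi>h: "hopf_hom M A Q \<pi>" and i: "hopf_hom M Q B i" "is_mono M i" and ip: "i \<cdot> \<pi> = f"
    using hopf_image[OF f k \<pi>] by blast
  obtain K j where K: "hopf_coc K" and j: "hopf_hom M K A j" "is_mono M j" and fj: "f \<cdot> j = unit B \<cdot> counit K"
    and ker: "is_kernel H (K, j, A) (A, f, B)"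
    and univ: "\<forall>(Z :: ('o, 'm) comon) w. coc Z \<longrightarrow> chom Z A w \<longrightarrow> f \<cdot> w = unit B \<cdot> counit Z \<longrightarrow> (\<exists>w'. chom Z K w' \<and> j \<cdot> w' = w)"
    using hopf_kernel[OF f] by blast
  note phi = phi_coequalizer[OF FC A B Q(1) K \<pi>h e\<pi> i j, unfolded ip, OF fj univ]
  have uniq: "Q' = Q" if "cob Q' = Cod M \<pi> \<and> (A, \<pi>, Q') \<in> Arr H" for Q'
    using that by (intro quotient_hopf_unique[OF e\<pi> _ _ Q(1) \<pi>h A]) simp_all
  have ck: "is_cokernel H (A, \<pi>, Q) (K, j, A)" by (rule hopf_cokernel[OF A Q(1) K \<pi>h e\<pi> j(1) phi(2,1)])
  have part1: "is_coequalizer M \<pi> (lun (cob A) \<cdot> (counit A \<odot> idn (cob A)) \<cdot> e) (run (cob A) \<cdot> (idn (cob A) \<odot> counit A) \<cdot> e)"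
    if "is_cotensor M (Cod M \<pi>) (right_coreg M A \<pi>) (left_coreg M A \<pi>) e" for e
    using cotensor_coequalizer[OF A Q(1) K \<pi>h e\<pi> j(1) phi(2,1)] that Q(2) by simp
  have part4: "(\<exists>p. is_cokernel H p l) \<and> (\<forall>p. is_cokernel H p l \<longrightarrow> same_quotient H p (A, \<pi>, Q)) \<and>
        (\<forall>p c. is_cokernel H p l \<and> is_phi M l c \<longrightarrow> same_quotient M c (und p) \<and> same_quotient M c \<pi>)"
    if l: "is_kernel H l (A, f, B)" for l
  proof -
    have "l \<in> Arr H" "Cod H l = A" using H.kernelD(2,3)[OF l] by simp_all
    then obtain K' j' where lj: "l = (K', j', A)" by (cases l) auto
    have K': "hopf_coc K'" and j': "hopf_hom M K' A j'" using \<open>l \<in> Arr H\<close> by (simp_all add: lj)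
    \<comment> \<open>Comparison of two kernels of \<open>f\<close>, used in both directions between
      the given kernel \<open>l\<close> and the constructed one.\<close>
    have fac: "\<exists>t. hopf_hom M P P' t \<and> b \<cdot> t = a"
      if a: "is_kernel H (P, a, A) (A, f, B)" and b: "is_kernel H (P', b, A) (A, f, B)" for P P' a b
    proof -
      have "(P, a, A) \<in> Hom H P (Dom H (A, f, B))" "is_zero_arr H (Cmp H (A, f, B) (P, a, A))"
        using H.kernelD[OF a] by simp_all
      then have "\<exists>!y. y \<in> Hom H P (Dom H (P', b, A)) \<and> Cmp H (P', b, A) y = (P, a, A)"
        by (rule b[unfolded is_kernel_def, THEN conjunct2, THEN conjunct2, THEN conjunct2, rule_format])
      then obtain y where y: "y \<in> Hom H P P'" "Cmp H (P', b, A) y = (P, a, A)" by auto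
      obtain t where "y = (P, t, P')" "hopf_hom M P P' t" using y(1) by (rule H_HomE)
      then show ?thesis using y(2) by auto
    qed
    obtain t where t: "hopf_hom M K' K t" "j \<cdot> t = j'" using fac[OF l[unfolded lj] ker] by blast
    obtain t' where t': "hopf_hom M K K' t'" "j' \<cdot> t' = j" using fac[OF ker l[unfolded lj]] by blast
    note co = coequalizer_along_kernels[OF A K K' j(1) j' t t' phi(1)]
    \<comment> \<open>The kernel condition on \<open>l\<close> concerns \<open>f\<close>; cancelling
      the mono \<open>i\<close> turns it into a condition on \<open>\<pi>\<close>.\<close>
    have "i \<cdot> \<pi> \<cdot> j' = i \<cdot> unit Q \<cdot> counit K'"
    proof -
      note [simp] = hopf_homD(2-4)[OF \<pi>h] hopf_homD(2-4)[OF i(1)] hopf_homD(2-4)[OF j']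
      have "is_zero_arr H (Cmp H (A, f, B) l)" by (rule H.kernelD(4)[OF l])
      then have "f \<cdot> j' = unit B \<cdot> counit K'" by (simp add: lj H_zero_iff)
      moreover have "i \<cdot> unit Q \<cdot> counit K' = unit B \<cdot> counit K'"
        by (rule hopf_hom_unit_counit[OF hopf_cocD(1)[OF Q(1)] coc_comonoid[OF hopf_cocD(2)[OF K']] i(1)])
      ultimately show ?thesis by (simp flip: ip)
    qed
    then have \<pi>j': "\<pi> \<cdot> j' = unit Q \<cdot> counit K'"
      by (rule mono_cancel[OF i(2)])
        (use hopf_homD(2-4)[OF \<pi>h] hopf_homD(2-4)[OF i(1)] hopf_homD(2-4)[OF j'] hopf_cocD[OF Q(1)] hopf_cocD[OF K'] in simp_all)
    have ck': "is_cokernel H (A, \<pi>, Q) l" unfolding lj by (rule hopf_cokernel[OF A Q(1) K' \<pi>h e\<pi> j' \<pi>j' co])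
    have sq: "same_quotient H p (A, \<pi>, Q)" if "is_cokernel H p l" for p by (rule H.cokernel_unique[OF that ck'])
    have "same_quotient M c (und p) \<and> same_quotient M c \<pi>" if p: "is_cokernel H p l" and c: "is_phi M l c" for p c
    proof -
      \<comment> \<open>\<open>c\<close> and \<open>\<pi>\<close> are coequalizers of the same pair
        in \<open>M\<close>, whereas \<open>p\<close> and \<open>\<pi>\<close> are compared as
        cokernels of Hopf monoids before passing to \<open>M\<close>.\<close>
      have "is_coequalizer M c (mul A \<cdot> (idn (cob A) \<odot> j')) (run (cob A) \<cdot> (idn (cob A) \<odot> counit K'))"
        using c by (simp add: is_phi_def lj)
      then have c\<pi>: "same_quotient M c \<pi>" using co by (rule coequalizer_unique)
      have "same_quotient M (und p) \<pi>" using same_quotient_und[OF sq[OF p]] by (simp add: und_def)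
      then show ?thesis using c\<pi> same_quotient_trans same_quotient_sym by blast
    qed
    with ck' sq show ?thesis by blast
  qed
  have "is_mono H (Q, i, B)" using hopf_mono[of Q i B] Q(1) B i by simp
  moreover have "Cmp H (Q, i, B) (A, \<pi>, Q) = (A, f, B)" "Dom H (Q, i, B) = Cod H (A, \<pi>, Q)" by (simp_all add: ip)
  ultimately have part5: "\<exists>p i. is_regular_epi H p \<and> (\<exists>g. is_cokernel H p g) \<and>
        is_mono H i \<and> Dom H i = Cod H p \<and> Cmp H i p = (A, f, B)"
    using ck hopf_regular_epi[OF ck] by blast
  have part3: "\<exists>!Q. cob Q = Cod M \<pi> \<and> (A, \<pi>, Q) \<in> Arr H"
    using Q A \<pi>h by (intro ex1I[of _ Q] uniq) simp_all
  show ?thesis using part1 ker part3 part4 part5 uniq by blast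
qed

end

theorem proposition7p8:
  fixes M :: "('o, 'm) smc"
    and A B :: "('o, 'm) hopf"
    and f k \<pi> :: 'm
  assumes "abelian_smc M"
    and "faithfully_coflat M"
    and "(A, f, B) \<in> Arr (HopfCoc M)"
    and "is_kernel M k f"
    and "is_cokernel M \<pi> k"
  shows
    "(\<forall>e. is_cotensor M (Cod M \<pi>) (right_coreg M A \<pi>) (left_coreg M A \<pi>) e \<longrightarrow>
        is_coequalizer M \<pi>
          (LUn M (cob A) \<cdot>\<^bsub>M\<^esub> (counit A \<odot>\<^bsub>M\<^esub> Idn M (cob A)) \<cdot>\<^bsub>M\<^esub> e)
          (RUn M (cob A) \<cdot>\<^bsub>M\<^esub> (Idn M (cob A) \<odot>\<^bsub>M\<^esub> counit A) \<cdot>\<^bsub>M\<^esub> e))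
     \<and>
     (\<exists>j. is_kernel (HopfCoc M) j (A, f, B))
     \<and>
     (\<exists>!Q. cob Q = Cod M \<pi> \<and> (A, \<pi>, Q) \<in> Arr (HopfCoc M))
     \<and>
     (\<forall>j Q. is_kernel (HopfCoc M) j (A, f, B) \<and>
        cob Q = Cod M \<pi> \<and> (A, \<pi>, Q) \<in> Arr (HopfCoc M) \<longrightarrow>
        (\<exists>p. is_cokernel (HopfCoc M) p j) \<and>
        (\<forall>p. is_cokernel (HopfCoc M) p j \<longrightarrow> same_quotient (HopfCoc M) p (A, \<pi>, Q)) \<and>
        (\<forall>p c. is_cokernel (HopfCoc M) p j \<and> is_phi M j c \<longrightarrow>
           same_quotient M c (und p) \<and> same_quotient M c \<pi>))
     \<and>
     (\<exists>p i. is_regular_epi (HopfCoc M) p \<and> (\<exists>g. is_cokernel (HopfCoc M) p g) \<and>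
        is_mono (HopfCoc M) i \<and> Dom (HopfCoc M) i = Cod (HopfCoc M) p \<and>
        i \<cdot>\<^bsub>HopfCoc M\<^esub> p = (A, f, B))"
proof -
  interpret abelian_smc M by (fact assms(1))
  show ?thesis by (rule hopf_factorization) (fact assms(2-5))+
qed

end
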